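(* Let $(\Omega,\mathscr A,\wp)$ be a given probability space with associated module $\mathscr H$, and let $\Lambda$ be an arbitrary set (respectively, a topological space). (i) For any positive definite $\mathscr C_1(H)$-valued kernel $\Gamma$ on $\Lambda$ (respectively, which is moreover continuous on $\Lambda\times\Lambda$), there exists a (respectively, continuous) multivariate second order stochastic mapping $\Phi:\Lambda\to\mathscr H$ which assures for $\Gamma$ a Kolmogorov factorization: $$\Gamma(\lambda,\mu)=[\Phi(\lambda),\Phi(\mu)]_{\mathscr H},\qquad \lambda,\mu\in\Lambda,$$ i.e. $\Gamma$ coincides with the operator covariance function $\Gamma_\Phi$ of $\Phi$. (ii) If $\Phi_1$ and $\Phi_2$ are two (respectively, continuous) multivariate second order stochastic mappings on $\Lambda$ for which $\Gamma_{\Phi_1}=\Gamma_{\Phi_2}$, then $\Phi_1$ and $\Phi_2$ are Gramian unitarily equivalent, i.e. there exists a Gramian unitary operator $W:\mathscr H_{\Phi_2}\to\mathscr H_{\Phi_1}$ such that $$\Phi_1(\lambda)=W\Phi_2(\lambda),\qquad\lambda\in\Lambda.$$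
   Context: $H$ is an infinite dimensional separable complex Hilbert space; $\mathcal B(H)$ is the algebra of bounded operators, $\mathscr C_1(H)$ the trace class operators with the trace norm. For $h,k\in H$, $h\otimes\bar k$ is the operator $h'\mapsto (h',k)_H h$ (inner products linear in the first variable). For the probability space $(\Omega,\mathscr A,\wp)$, $\mathscr H=L^2_{s,0}[\wp,H]$ is the space of strongly measurable zero mean $f:\Omega\to H$ with $\int\|f\|^2d\wp<\infty$, with pointwise action of $\mathcal B(H)$, the $\mathscr C_1(H)$-valued Gramian $[f,g]_{\mathscr H}=\int f(\omega)\otimes\overline{g(\omega)}\,d\wp(\omega)$ and the norm $\|[f,f]\|_{\mathscr C_1(H)}^{1/2}$ (equal to the usual $L^2$ norm). It is identified, via $f\mapsto V_f$, $V_f\chi=\int\chi f\,d\wp$, with the module $\mathscr C_2(L^2_0(\wp),H)$ of Hilbert-Schmidt operators with Gramian $[S,T]=ST^*$, where $L^2_0(\wp)$ is the space of zero mean square integrable complex random variables. A multivariate second order stochastic mapping on $\Lambda$ is a map $\Phi:\Lambda\to\mathscr H$. Its modular domain $\mathscr H_\Phi$ is the closure in $\mathscr H$ of $\{\sum_{i=1}^m a_i\Phi(\lambda_i):a_i\in\mathcal B(H),\lambda_i\in\Lambda,m\in\mathbb N\}$, and its operator covariance function is $\Gamma_\Phi(\lambda,\mu)=[\Phi(\lambda),\Phi(\mu)]_{\mathscr H}$. A kernel $\Gamma:\Lambda\times\Lambda\to\mathscr C_1(H)$ is positive definite if $\sum_{i,j=1}^m a_i\Gamma(\lambda_i,\lambda_j)a_j^*\ge0$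 in $\mathcal B(H)$ for all $m\in\mathbb N$, $a_1,\dots,a_m\in\mathcal B(H)$, $\lambda_1,\dots,\lambda_m\in\Lambda$. A Gramian unitary operator is a surjective $\mathcal B(H)$-linear map preserving the Gramian.
   Formalization: In (i) the zero mean space L²₀(℘) is also assumed to contain an orthonormal family indexed by Λ×ℕ (for continuous kernels, by D×ℕ with D dense in Λ); without a size condition (i) fails, e.g. when ℘ is a point mass. Part (ii) is unchanged. *)

theory Defs
  imports "HOL-Probability.Probability"
begin

section \<open>Separable complex Hilbert spaces\<close>

text \<open>The real inner product carried by a complex one is its real part; in particular the norm of
  the class \<open>real_inner\<close> is the Hilbert space norm.  As in the source, \<open>cinner\<close> is linear in its
  first argument.\<close>

class complex_inner = real_inner +
  fixes scaleC :: "complex \<Rightarrow> 'a \<Rightarrow> 'a" (infixr "*\<^sub>C" 75)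
    and cinner :: "'a \<Rightarrow> 'a \<Rightarrow> complex"
  assumes scaleC_add_right: "c *\<^sub>C (x + y) = c *\<^sub>C x + c *\<^sub>C y"
    and scaleC_add_left: "(c + d) *\<^sub>C x = c *\<^sub>C x + d *\<^sub>C x"
    and scaleC_scaleC: "c *\<^sub>C d *\<^sub>C x = (c * d) *\<^sub>C x"
    and scaleC_one: "1 *\<^sub>C x = x"
    and scaleR_scaleC: "r *\<^sub>R x = complex_of_real r *\<^sub>C x"
    and cinner_add_left: "cinner (x + y) z = cinner x z + cinner y z"
    and cinner_scaleC_left: "cinner (c *\<^sub>C x) y = c * cinner x y"
    and cinner_commute: "cinner y x = cnj (cinner x y)"
    and inner_cinner: "x \<bullet> y = Re (cinner x y)"

class separable_complex_hilbert = complex_inner + banach + second_countable_topology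

interpretation complex_vector: vector_space "scaleC :: complex \<Rightarrow> 'a::complex_inner \<Rightarrow> 'a"
  by unfold_locales (simp_all add: scaleC_add_right scaleC_add_left scaleC_scaleC scaleC_one)

section \<open>Bounded and trace class operators\<close>

definition bounded_clinear :: "('h::complex_inner \<Rightarrow> 'h) \<Rightarrow> bool" where
  "bounded_clinear a \<longleftrightarrow> bounded_linear a \<and> (\<forall>c x. a (c *\<^sub>C x) = c *\<^sub>C a x)"

definition adj :: "('h::separable_complex_hilbert \<Rightarrow> 'h) \<Rightarrow> 'h \<Rightarrow> 'h" where
  "adj a = (THE b. bounded_clinear b \<and> (\<forall>x y. cinner (a x) y = cinner x (b y)))"

definition positive_op :: "('h::complex_inner \<Rightarrow> 'h) \<Rightarrow> bool" where
  "positive_op P \<longleftrightarrow> bounded_clinear P \<and>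
     (\<forall>x. Im (cinner (P x) x) = 0 \<and> 0 \<le> Re (cinner (P x) x))"

text \<open>The modulus $|T| = (T^* T)^{1/2}$.\<close>

definition abs_op :: "('h::separable_complex_hilbert \<Rightarrow> 'h) \<Rightarrow> 'h \<Rightarrow> 'h" where
  "abs_op T = (THE P. positive_op P \<and> P \<circ> P = adj T \<circ> T)"

definition orthonormal_basis :: "(nat \<Rightarrow> 'h::complex_inner) \<Rightarrow> bool" where
  "orthonormal_basis e \<longleftrightarrow>
     (\<forall>m n. cinner (e m) (e n) = (if m = n then 1 else 0)) \<and>
     (\<forall>x. (\<forall>n. cinner x (e n) = 0) \<longrightarrow> x = 0)"

text \<open>The trace of a positive operator does not depend on the orthonormal basis, so an arbitrary
  one is fixed.  It is indexed by the natural numbers because the space is separable and, in the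
  theorem, infinite dimensional.\<close>

definition some_basis :: "nat \<Rightarrow> 'h::separable_complex_hilbert" where
  "some_basis = (SOME e. orthonormal_basis e)"

definition trace_class :: "('h::separable_complex_hilbert \<Rightarrow> 'h) \<Rightarrow> bool" where
  "trace_class T \<longleftrightarrow> bounded_clinear T \<and>
     summable (\<lambda>n. Re (cinner (abs_op T (some_basis n)) (some_basis n)))"

definition trace_norm :: "('h::separable_complex_hilbert \<Rightarrow> 'h) \<Rightarrow> real" where
  "trace_norm T = (\<Sum>n. Re (cinner (abs_op T (some_basis n)) (some_basis n)))"

section \<open>The Hilbert module of zero mean square integrable random variables\<close>

text \<open>Elements are represented by functions, and almost everywhere equal functions represent the
  same element.  For functions with values in a separable space, strong measurability is Borel
  measurability.  With \<open>'a = complex\<close> this is the space $L^2_0(\wp)$, with \<open>'a\<close> a Hilbert space it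
  is $L^2_{s,0}[\wp, H]$.\<close>

definition L2_0 :: "'w measure \<Rightarrow> ('w \<Rightarrow> 'a::{banach, second_countable_topology}) set" where
  "L2_0 M = {f \<in> borel_measurable M.
     integrable M (\<lambda>\<omega>. (norm (f \<omega>))\<^sup>2) \<and> (\<integral>\<omega>. f \<omega> \<partial>M) = 0}"

definition L2_norm :: "'w measure \<Rightarrow> ('w \<Rightarrow> 'a::{banach, second_countable_topology}) \<Rightarrow> real" where
  "L2_norm M f = sqrt (\<integral>\<omega>. (norm (f \<omega>))\<^sup>2 \<partial>M)"

definition rank_one :: "'h::complex_inner \<Rightarrow> 'h \<Rightarrow> 'h \<Rightarrow> 'h" where
  "rank_one h k = (\<lambda>h'. cinner h' k *\<^sub>C h)"

text \<open>The operator-valued integral of $f(\omega) \otimes \overline{g(\omega)}$ is evaluated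
  pointwise; evaluation at a vector is continuous on the trace class, so this is the same operator
  as the Bochner integral in the trace norm.\<close>

definition gramian ::
  "'w measure \<Rightarrow> ('w \<Rightarrow> 'h::separable_complex_hilbert) \<Rightarrow> ('w \<Rightarrow> 'h) \<Rightarrow> 'h \<Rightarrow> 'h" where
  "gramian M f g = (\<lambda>h. \<integral>\<omega>. rank_one (f \<omega>) (g \<omega>) h \<partial>M)"

section \<open>Stochastic mappings and kernels\<close>

definition stochastic_mapping ::
  "'w measure \<Rightarrow> ('l \<Rightarrow> 'w \<Rightarrow> 'h::separable_complex_hilbert) \<Rightarrow> bool" where
  "stochastic_mapping M \<Phi> \<longleftrightarrow> (\<forall>l. \<Phi> l \<in> L2_0 M)"

definition continuous_mapping ::
  "'w measure \<Rightarrow> ('l::topological_space \<Rightarrow> 'w \<Rightarrow> 'h::separable_complex_hilbert) \<Rightarrow> bool" where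
  "continuous_mapping M \<Phi> \<longleftrightarrow>
     (\<forall>l0. ((\<lambda>l. L2_norm M (\<lambda>\<omega>. \<Phi> l \<omega> - \<Phi> l0 \<omega>)) \<longlongrightarrow> 0) (at l0))"

definition op_covariance ::
  "'w measure \<Rightarrow> ('l \<Rightarrow> 'w \<Rightarrow> 'h::separable_complex_hilbert) \<Rightarrow> 'l \<Rightarrow> 'l \<Rightarrow> 'h \<Rightarrow> 'h" where
  "op_covariance M \<Phi> = (\<lambda>l m. gramian M (\<Phi> l) (\<Phi> m))"

definition module_combinations ::
  "('l \<Rightarrow> 'w \<Rightarrow> 'h::separable_complex_hilbert) \<Rightarrow> ('w \<Rightarrow> 'h) set" where
  "module_combinations \<Phi> =
     {(\<lambda>\<omega>. \<Sum>i<m. a i (\<Phi> (l i) \<omega>)) | (m::nat) a l. \<forall>i<m. bounded_clinear (a i)}"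

definition modular_domain ::
  "'w measure \<Rightarrow> ('l \<Rightarrow> 'w \<Rightarrow> 'h::separable_complex_hilbert) \<Rightarrow> ('w \<Rightarrow> 'h) set" where
  "modular_domain M \<Phi> =
     {f \<in> L2_0 M. \<forall>\<epsilon>>0. \<exists>g \<in> module_combinations \<Phi>. L2_norm M (\<lambda>\<omega>. f \<omega> - g \<omega>) < \<epsilon>}"

definition trace_class_kernel ::
  "('l \<Rightarrow> 'l \<Rightarrow> 'h::separable_complex_hilbert \<Rightarrow> 'h) \<Rightarrow> bool" where
  "trace_class_kernel \<Gamma> \<longleftrightarrow> (\<forall>l m. trace_class (\<Gamma> l m))"

definition positive_definite_kernel ::
  "('l \<Rightarrow> 'l \<Rightarrow> 'h::separable_complex_hilbert \<Rightarrow> 'h) \<Rightarrow> bool" where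
  "positive_definite_kernel \<Gamma> \<longleftrightarrow>
     (\<forall>(m::nat) a l. (\<forall>i<m. bounded_clinear (a i)) \<longrightarrow>
        positive_op (\<lambda>x. \<Sum>i<m. \<Sum>j<m. a i (\<Gamma> (l i) (l j) (adj (a j) x))))"

definition continuous_kernel ::
  "('l::topological_space \<Rightarrow> 'l \<Rightarrow> 'h::separable_complex_hilbert \<Rightarrow> 'h) \<Rightarrow> bool" where
  "continuous_kernel \<Gamma> \<longleftrightarrow>
     (\<forall>l0 m0. ((\<lambda>(l, m). trace_norm (\<lambda>x. \<Gamma> l m x - \<Gamma> l0 m0 x)) \<longlongrightarrow> 0) (at (l0, m0)))"

text \<open>Surjective \<open>B(H)\<close>-linear Gramian preserving maps between submodules \<open>S\<close> and \<open>S'\<close> of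
  \<open>L2_0 M\<close>.  All equations hold between elements of the module, that is, almost everywhere, and
  \<open>W\<close> is compatible with almost everywhere equality.\<close>

definition gramian_unitary ::
  "'w measure \<Rightarrow> ('w \<Rightarrow> 'h::separable_complex_hilbert) set \<Rightarrow> ('w \<Rightarrow> 'h) set \<Rightarrow>
   (('w \<Rightarrow> 'h) \<Rightarrow> 'w \<Rightarrow> 'h) \<Rightarrow> bool" where
  "gramian_unitary M S S' W \<longleftrightarrow>
     (\<forall>f\<in>S. W f \<in> S') \<and>
     (\<forall>f\<in>S. \<forall>g\<in>S. (AE \<omega> in M. f \<omega> = g \<omega>) \<longrightarrow> (AE \<omega> in M. W f \<omega> = W g \<omega>)) \<and>
     (\<forall>f\<in>S. \<forall>g\<in>S. AE \<omega> in M. W (\<lambda>\<omega>. f \<omega> + g \<omega>) \<omega> = W f \<omega> + W g \<omega>) \<and>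
     (\<forall>a. \<forall>f\<in>S. bounded_clinear a \<longrightarrow> (AE \<omega> in M. W (\<lambda>\<omega>. a (f \<omega>)) \<omega> = a (W f \<omega>))) \<and>
     (\<forall>g\<in>S'. \<exists>f\<in>S. AE \<omega> in M. W f \<omega> = g \<omega>) \<and>
     (\<forall>f\<in>S. \<forall>g\<in>S. gramian M (W f) (W g) = gramian M f g)"

section \<open>Size of the probability space\<close>

text \<open>\<open>L2_0_family M I\<close> says that $L^2_0(\wp)$ contains an orthonormal family indexed by \<open>I\<close>.
  A kernel on a nonempty set $\Lambda$ can only be factored through a given probability space if
  $L^2_0(\wp)$ is large enough.  If $\wp$ is a point mass, $L^2_0(\wp) = 0$ and only the zero kernel
  factors.  If $\|e\| = 1$ and
  $\Gamma(\lambda,\mu) = \delta_{\lambda\mu}\, e \otimes \overline{e}$, every factorization yields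
  the orthonormal family $\omega \mapsto (\Phi(\lambda)(\omega), e)$ indexed by $\Lambda$; if
  $\Gamma(\lambda,\mu) = T$ is constant with $T$ positive, injective and trace class, it yields an
  infinite one.  Hence all kernels on $\Lambda$ factor only if there is an orthonormal family
  indexed by $\Lambda \times \mathbb{N}$, and this is also sufficient.  For continuous kernels it
  is enough that $\Lambda$ is replaced by a dense subset.\<close>

definition L2_0_family :: "'w measure \<Rightarrow> 'i set \<Rightarrow> bool" where
  "L2_0_family M I \<longleftrightarrow>
     (\<exists>u :: 'i \<Rightarrow> 'w \<Rightarrow> complex. (\<forall>i\<in>I. u i \<in> L2_0 M) \<and>
        (\<forall>i\<in>I. \<forall>j\<in>I. (\<integral>\<omega>. u i \<omega> * cnj (u j \<omega>) \<partial>M) = (if i = j then 1 else 0)))"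

end

theory Submission
  imports Defs
begin

text \<open>Testing a Gramian against vectors turns it into scalar inner products:
  $([f,g]h,k)$ is the $L^2$ inner product of $(f(\cdot),k)$ and $(g(\cdot),h)$.  Both parts rest on this.

  Existence.  Fix an orthonormal basis $e$ of $H$.  A factorization of $\Gamma$ amounts to random variables
  $v_{\lambda n}$, the coordinates $(\Phi(\lambda)(\cdot),e_n)$, with Gram matrix
  $((\Gamma(\lambda,\mu)e_p,e_n))$; the diagonal sums over $n$ are the traces of $\Gamma(\lambda,\lambda)$,
  so the coordinates are summable to an element of the module.  Rank one coefficients $a_i$ in the definition
  of positivity show that this scalar matrix is positive definite.  Vectors with a prescribed positive definite
  Gram matrix are produced by a Cholesky decomposition along a well-ordering of the index set, inside the given
  space $L^2_0(\wp)$: the new vector is the one prescribed in the closed span of its predecessors, plus a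
  multiple of the orthonormal vector $u_i$ reserved for the index (\<open>transfinite_cholesky\<close>).
  If only a dense subset of the indices has a reserved vector, the remaining Gram vectors are limits
  of those already constructed, and the Riesz theorem delivers them directly (\<open>gram_vectors_exist\<close>).

  Continuity.  The distance $\|\Phi(\lambda)-\Phi(\lambda_0)\|^2$ is the trace of a combination of the
  $\Gamma(\lambda,\mu)-\Gamma(\lambda_0,\lambda_0)$, hence bounded by their trace norms.  For this the
  trace norm must be meaningful: the modulus exists by a square root construction, differences of values of
  $\Gamma$ are again trace class, and $\sum_n|(Te_n,e_n)|\le\|T\|_1$; the last two follow from a
  form of the polar decomposition (\<open>kernel_difference_trace_norm\<close>).

  Uniqueness.  Equal covariances make
  $\sum a_i\Phi_2(\lambda_i)\mapsto\sum a_i\Phi_1(\lambda_i)$ Gramian preserving, hence isometric, because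
  the norm is the trace of the Gramian.  The closure of its graph is therefore the graph of a Gramian unitary
  operator (\<open>gramian_unitary_equivalence\<close>).\<close>

section \<open>Complex inner products and bounded operators\<close>

lemma scaleC_zero_right [simp]: "c *\<^sub>C (0::'a::complex_inner) = 0"
  by (rule complex_vector.scale_zero_right)

lemma scaleC_zero_left [simp]: "0 *\<^sub>C (x::'a::complex_inner) = 0"
  by (rule complex_vector.scale_zero_left)

lemma scaleC_one_left [simp]: "1 *\<^sub>C (x::'a::complex_inner) = x"
  by (rule scaleC_one)

lemma scaleC_diff_right: "c *\<^sub>C (x - y) = c *\<^sub>C x - c *\<^sub>C (y::'a::complex_inner)"
  by (rule complex_vector.scale_right_diff_distrib)

lemma cinner_scaleC_right [simp]:
  "cinner x (c *\<^sub>C y) = cnj c * cinner x (y::'a::complex_inner)"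
  by (metis cinner_commute cinner_scaleC_left complex_cnj_mult)

lemma cinner_add_right: "cinner x (y + z) = cinner x y + cinner x (z::'a::complex_inner)"
  by (metis cinner_commute cinner_add_left complex_cnj_add)

lemma cinner_zero_left [simp]: "cinner 0 (x::'a::complex_inner) = 0"
  using cinner_scaleC_left[of 0 0 x] by simp

lemma cinner_zero_right [simp]: "cinner (x::'a::complex_inner) 0 = 0"
  using cinner_scaleC_right[of x 0 0] by simp

lemma cinner_minus_left [simp]: "cinner (- x) y = - cinner x (y::'a::complex_inner)"
  using cinner_add_left[of x "-x" y] by (simp add: eq_neg_iff_add_eq_0 add.commute)

lemma cinner_minus_right [simp]: "cinner x (- y) = - cinner x (y::'a::complex_inner)"
  using cinner_add_right[of x y "-y"] by (simp add: eq_neg_iff_add_eq_0 add.commute)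

lemma cinner_diff_left: "cinner (x - y) z = cinner x z - cinner y (z::'a::complex_inner)"
  using cinner_add_left[of x "-y" z] by simp

lemma cinner_diff_right: "cinner x (y - z) = cinner x y - cinner x (z::'a::complex_inner)"
  using cinner_add_right[of x y "-z"] by simp

lemma cinner_sum_left: "cinner (\<Sum>i\<in>F. f i) x = (\<Sum>i\<in>F. cinner (f i) (x::'a::complex_inner))"
  by (induction F rule: infinite_finite_induct) (simp_all add: cinner_add_left)

lemma cinner_sum_right: "cinner x (\<Sum>i\<in>F. f i) = (\<Sum>i\<in>F. cinner (x::'a::complex_inner) (f i))"
  by (induction F rule: infinite_finite_induct) (simp_all add: cinner_add_right)

lemma Im_cinner_self [simp]: "Im (cinner x (x::'a::complex_inner)) = 0"
  by (metis Im_complex_of_real Reals_cnj_iff cinner_commute complex_is_Real_iff)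

lemma Re_cinner_self: "Re (cinner x (x::'a::complex_inner)) = (norm x)\<^sup>2"
  by (simp add: inner_cinner[symmetric] power2_norm_eq_inner)

lemma cinner_self: "cinner x (x::'a::complex_inner) = of_real ((norm x)\<^sup>2)"
  by (simp add: complex_eq_iff Re_cinner_self)

lemma cinner_self_eq_0 [simp]: "cinner x x = 0 \<longleftrightarrow> (x::'a::complex_inner) = 0"
  by (simp add: cinner_self)

lemma norm_scaleC [simp]: "norm (c *\<^sub>C x) = cmod c * norm (x::'a::complex_inner)"
proof -
  have "cnj c * c = (of_real (cmod c))\<^sup>2"
    using complex_norm_square[of c] by (simp add: mult.commute)
  then have "cinner (c *\<^sub>C x) (c *\<^sub>C x) = of_real ((cmod c * norm x)\<^sup>2)"
    by (simp add: cinner_scaleC_left cinner_self[of x] power_mult_distrib flip: mult.assoc)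
  then have "(norm (c *\<^sub>C x))\<^sup>2 = (cmod c * norm x)\<^sup>2"
    unfolding cinner_self of_real_eq_iff .
  then show ?thesis by (simp add: power2_eq_iff_nonneg)
qed

text \<open>Rotating by a phase makes the inner product real, which reduces the complex Cauchy-Schwarz
  inequality to the real one.\<close>

lemma norm_cinner_le: "cmod (cinner x y) \<le> norm x * norm (y::'a::complex_inner)"
proof (cases "cinner x y = 0")
  case False
  define c where "c = cnj (sgn (cinner x y))"
  have c: "cmod c = 1" using False by (simp add: c_def norm_sgn)
  have "c * cinner x y = of_real (cmod (cinner x y))"
    using False by (simp add: c_def sgn_eq complex_norm_square[symmetric] power2_eq_square
        mult.commute)
  then have "cmod (cinner x y) = (c *\<^sub>C x) \<bullet> y"
    by (simp add: inner_cinner cinner_scaleC_left)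
  also have "\<dots> \<le> norm (c *\<^sub>C x) * norm y" by (rule norm_cauchy_schwarz)
  finally show ?thesis by (simp add: c)
qed simp

lemma cinner_eqI: "(\<And>z. cinner x z = cinner y z) \<Longrightarrow> x = (y::'a::complex_inner)"
  using cinner_self_eq_0[of "x - y"] by (simp add: cinner_diff_left)

lemma scaleR_scaleC_commute: "r *\<^sub>R c *\<^sub>C x = c *\<^sub>C r *\<^sub>R (x::'a::complex_inner)"
  by (simp add: scaleR_scaleC scaleC_scaleC mult.commute)

lemma bounded_bilinear_scaleC:
  "bounded_bilinear ((*\<^sub>C) :: complex \<Rightarrow> 'a \<Rightarrow> 'a::complex_inner)"
proof
  show "\<exists>K. \<forall>a (b::'a). norm (a *\<^sub>C b) \<le> norm a * norm b * K" by (rule exI[of _ 1]) simp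
qed (simp_all add: scaleC_add_left scaleC_add_right scaleR_scaleC scaleC_scaleC scaleR_conv_of_real
    mult.commute)

lemma bounded_bilinear_cinner: "bounded_bilinear (cinner :: 'a \<Rightarrow> 'a \<Rightarrow> complex)"
  for dummy :: "'a::complex_inner"
proof
  show "\<exists>K. \<forall>a (b::'a). norm (cinner a b) \<le> norm a * norm b * K"
    by (rule exI[of _ 1]) (simp add: norm_cinner_le)
qed (simp_all add: cinner_add_left cinner_add_right scaleR_scaleC cinner_scaleC_left
    scaleR_conv_of_real)

lemmas tendsto_cinner = bounded_bilinear.tendsto[OF bounded_bilinear_cinner]
lemmas tendsto_scaleC = bounded_bilinear.tendsto[OF bounded_bilinear_scaleC]

lemma borel_measurable_cinner [measurable]:
  fixes f g :: "'w \<Rightarrow> 'a::{complex_inner, second_countable_topology}"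
  assumes "f \<in> borel_measurable M" "g \<in> borel_measurable M"
  shows "(\<lambda>\<omega>. cinner (f \<omega>) (g \<omega>)) \<in> borel_measurable M"
  by (rule borel_measurable_continuous_Pair[OF assms])
    (intro bounded_bilinear.continuous_on[OF bounded_bilinear_cinner] continuous_intros)

lemma borel_measurable_scaleC [measurable]:
  fixes f :: "'w \<Rightarrow> 'a::{complex_inner, second_countable_topology}"
  assumes "c \<in> borel_measurable M" "f \<in> borel_measurable M"
  shows "(\<lambda>\<omega>. c \<omega> *\<^sub>C f \<omega>) \<in> borel_measurable M"
  by (rule borel_measurable_continuous_Pair[OF assms])
    (intro bounded_bilinear.continuous_on[OF bounded_bilinear_scaleC] continuous_intros)

text \<open>As a Hilbert space, the scalars make complex random variables a special case of vector-valued ones.\<close>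

instantiation complex :: separable_complex_hilbert
begin

definition scaleC_complex :: "complex \<Rightarrow> complex \<Rightarrow> complex" where
  "scaleC_complex c z = c * z"

definition cinner_complex :: "complex \<Rightarrow> complex \<Rightarrow> complex" where
  "cinner_complex z w = z * cnj w"

instance
  by standard
    (simp_all add: scaleC_complex_def cinner_complex_def algebra_simps scaleR_conv_of_real
      inner_complex_def)

end

lemma bounded_clinear_add: "bounded_clinear a \<Longrightarrow> a (x + y) = a x + a y"
  by (simp add: bounded_clinear_def linear_add bounded_linear.linear)

lemma bounded_clinear_diff: "bounded_clinear a \<Longrightarrow> a (x - y) = a x - a y"
  by (simp add: bounded_clinear_def linear_diff bounded_linear.linear)

lemma bounded_clinear_scaleC: "bounded_clinear a \<Longrightarrow> a (c *\<^sub>C x) = c *\<^sub>C a x"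
  by (simp add: bounded_clinear_def)

lemma bounded_clinear_scaleR: "bounded_clinear a \<Longrightarrow> a (c *\<^sub>R x) = c *\<^sub>R a x"
  by (simp add: bounded_clinear_scaleC scaleR_scaleC)

lemma bounded_clinear_zero: "bounded_clinear a \<Longrightarrow> a 0 = 0"
  by (simp add: bounded_clinear_def linear_0 bounded_linear.linear)

lemma bounded_clinear_sum: "bounded_clinear a \<Longrightarrow> a (\<Sum>i\<in>F. f i) = (\<Sum>i\<in>F. a (f i))"
  by (simp add: bounded_clinear_def linear_sum bounded_linear.linear)

lemma bounded_clinear_bounded:
  assumes "bounded_clinear a"
  obtains K where "K > 0" "\<And>x. norm (a x) \<le> K * norm x"
  using bounded_linear.pos_bounded[of a] assms
  by (auto simp: bounded_clinear_def mult.commute)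

lemma bounded_clinearI:
  assumes "\<And>x y. a (x + y) = a x + a y" "\<And>c x. a (c *\<^sub>C x) = c *\<^sub>C a x"
    and "\<And>x. norm (a x) \<le> K * norm x"
  shows "bounded_clinear a"
  unfolding bounded_clinear_def
  by (auto intro!: bounded_linear_intro[where K=K] simp: assms scaleR_scaleC
      mult.commute[of "norm _"])

lemma bounded_clinear_id: "bounded_clinear (\<lambda>x. x)"
  by (rule bounded_clinearI[where K=1]) auto

lemma bounded_clinear_0: "bounded_clinear (\<lambda>x. 0)"
  by (rule bounded_clinearI[where K=0]) auto

lemma bounded_clinear_compose:
  "bounded_clinear a \<Longrightarrow> bounded_clinear b \<Longrightarrow> bounded_clinear (\<lambda>x. a (b x))"
  by (simp add: bounded_clinear_def bounded_linear_compose)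

lemma bounded_clinear_plus:
  "bounded_clinear a \<Longrightarrow> bounded_clinear b \<Longrightarrow> bounded_clinear (\<lambda>x. a x + b x)"
  by (simp add: bounded_clinear_def bounded_linear_add scaleC_add_right)

lemma bounded_clinear_minus:
  "bounded_clinear a \<Longrightarrow> bounded_clinear b \<Longrightarrow> bounded_clinear (\<lambda>x. a x - b x)"
  by (simp add: bounded_clinear_def bounded_linear_sub scaleC_diff_right)

lemma bounded_clinear_scaleR_op: "bounded_clinear a \<Longrightarrow> bounded_clinear (\<lambda>x. r *\<^sub>R a x)"
  by (auto simp: bounded_clinear_def scaleR_scaleC_commute
      intro: bounded_linear_compose[OF bounded_linear_scaleR_right])

section \<open>Linear functionals on semi-inner product spaces\<close>

text \<open>It yields the Cauchy-Schwarz inequality for semi-inner products and the first variation in the Riesz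
  theorem.\<close>

lemma nonneg_quadratic_discriminant:
  fixes a b c :: real
  assumes "\<And>t. 0 \<le> a + 2 * t * b + t\<^sup>2 * c"
  shows "b\<^sup>2 \<le> a * c"
proof -
  have a: "0 \<le> a" using assms[of 0] by simp
  show ?thesis
  proof (cases "c > 0")
    case True
    have "0 \<le> a + 2 * (- b / c) * b + (- b / c)\<^sup>2 * c" by (rule assms)
    then show ?thesis using True by (simp add: field_simps power2_eq_square)
  next
    case c: False
    have "b = 0"
    proof (rule ccontr)
      assume b: "b \<noteq> 0"
      define t where "t = - (a + 1) / (2 * b)"
      have "a + 2 * t * b = -1" using b by (simp add: t_def field_simps)
      moreover have "t\<^sup>2 * c \<le> 0" using c by (simp add: mult_nonneg_nonpos)
      ultimately show False using assms[of t] by simp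
    qed
    moreover have "0 \<le> c"
    proof (rule ccontr)
      assume "\<not> 0 \<le> c"
      then have "sqrt ((a + 1) / - c) ^ 2 * c = - (a + 1)"
        using a by (simp add: field_simps)
      then show False using assms[of "sqrt ((a + 1) / - c)"] \<open>b = 0\<close> by simp
    qed
    ultimately show ?thesis using a by simp
  qed
qed

text \<open>Random variables that agree almost everywhere are not identified, so the inner product on them is only
  semidefinite.  A carrier \<open>V\<close> and the single operation \<open>lin s x t y\<close>, which stands for $sx + ty$, treat these
  functions, the Hilbert space itself and the coefficients of a kernel alike.\<close>

locale semi_inner =
  fixes V :: "'x set" and lin :: "complex \<Rightarrow> 'x \<Rightarrow> complex \<Rightarrow> 'x \<Rightarrow> 'x" and ip :: "'x \<Rightarrow> 'x \<Rightarrow> complex"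
  assumes lin_mem: "x \<in> V \<Longrightarrow> y \<in> V \<Longrightarrow> lin s x t y \<in> V"
    and ip_lin_left: "x \<in> V \<Longrightarrow> y \<in> V \<Longrightarrow> z \<in> V \<Longrightarrow> ip (lin s x t y) z = s * ip x z + t * ip y z"
    and ip_commute: "x \<in> V \<Longrightarrow> y \<in> V \<Longrightarrow> ip y x = cnj (ip x y)"
    and ip_nonneg: "x \<in> V \<Longrightarrow> 0 \<le> Re (ip x x)"
begin

abbreviation nsq :: "'x \<Rightarrow> real" where "nsq x \<equiv> Re (ip x x)"

lemma ip_lin_right:
  assumes "x \<in> V" "y \<in> V" "z \<in> V"
  shows "ip z (lin s x t y) = cnj s * ip z x + cnj t * ip z y"
  using assms by (simp add: ip_commute[of _ z] ip_lin_left lin_mem)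

lemma nsq_lin:
  assumes "x \<in> V" "y \<in> V"
  shows "nsq (lin s x t y) = (cmod s)\<^sup>2 * nsq x + 2 * Re (s * cnj t * ip x y) + (cmod t)\<^sup>2 * nsq y"
proof -
  have real: "Im (ip x x) = 0" "Im (ip y y) = 0"
    using ip_commute[of x x] ip_commute[of y y] assms by (simp_all add: complex_eq_iff)
  have "ip (lin s x t y) (lin s x t y) =
      s * cnj s * ip x x + (s * cnj t * ip x y + cnj (s * cnj t * ip x y)) + t * cnj t * ip y y"
    using assms by (simp add: ip_lin_left ip_lin_right lin_mem ip_commute[of x y] algebra_simps)
  then show ?thesis
    by (simp add: complex_norm_square[symmetric] real) (simp add: algebra_simps)
qed

lemma cauchy_schwarz:
  assumes "x \<in> V" "y \<in> V"
  shows "(cmod (ip x y))\<^sup>2 \<le> nsq x * nsq y"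
proof -
  define b where "b = (cmod (ip x y))\<^sup>2"
  have "0 \<le> nsq x + 2 * t * b + t\<^sup>2 * (b * nsq y)" for t
  proof -
    have "0 \<le> nsq (lin 1 x (of_real t * ip x y) y)"
      using assms by (intro ip_nonneg lin_mem)
    also have "\<dots> = nsq x + 2 * t * b + t\<^sup>2 * (b * nsq y)"
      using assms by (simp add: nsq_lin norm_mult power_mult_distrib b_def cmod_power2)
        (simp add: algebra_simps power2_eq_square)
    finally show ?thesis .
  qed
  then have "b\<^sup>2 \<le> nsq x * (b * nsq y)"
    by (rule nonneg_quadratic_discriminant)
  moreover have "0 \<le> b" by (simp add: b_def)
  moreover have "0 \<le> nsq x * nsq y" using assms by (simp add: ip_nonneg)
  ultimately have "b \<le> nsq x * nsq y"
    by (cases "b = 0") (auto simp: power2_eq_square mult.left_commute[of "nsq x"])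
  then show ?thesis by (simp add: b_def)
qed

end

locale semi_hilbert = semi_inner +
  assumes complete:
      "(\<And>n. X n \<in> V) \<Longrightarrow>
       (\<And>e. 0 < e \<Longrightarrow> \<exists>N. \<forall>m\<ge>N. \<forall>n\<ge>N. Re (ip (lin 1 (X m) (-1) (X n)) (lin 1 (X m) (-1) (X n))) < e) \<Longrightarrow>
       \<exists>x\<in>V. (\<lambda>n. Re (ip (lin 1 (X n) (-1) x) (lin 1 (X n) (-1) x))) \<longlonglongrightarrow> 0"
begin

lemma tendsto_ip_left:
  assumes "\<And>n. X n \<in> V" "w \<in> V" "v \<in> V" and lim: "(\<lambda>n. nsq (lin 1 (X n) (-1) w)) \<longlonglongrightarrow> 0"
  shows "(\<lambda>n. ip (X n) v) \<longlonglongrightarrow> ip w v"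
proof -
  have "(\<lambda>n. nsq (lin 1 (X n) (-1) w) * nsq v) \<longlonglongrightarrow> 0"
    using tendsto_mult_right[OF lim, of "nsq v"] by simp
  then have "(\<lambda>n. (cmod (ip (X n) v - ip w v))\<^sup>2) \<longlonglongrightarrow> 0"
  proof (rule tendsto_sandwich[rotated 2, OF tendsto_const])
    have "(cmod (ip (X n) v - ip w v))\<^sup>2 \<le> nsq (lin 1 (X n) (-1) w) * nsq v" for n
      using cauchy_schwarz[OF lin_mem, of "X n" w v 1 "-1"] assms by (simp add: ip_lin_left)
    then show "\<forall>\<^sub>F n in sequentially.
        (cmod (ip (X n) v - ip w v))\<^sup>2 \<le> nsq (lin 1 (X n) (-1) w) * nsq v"
      by simp
  qed simp
  then have "(\<lambda>n. cmod (ip (X n) v - ip w v)) \<longlonglongrightarrow> 0"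
    using tendsto_real_sqrt by fastforce
  then show ?thesis
    by (metis Lim_null tendsto_norm_zero_iff)
qed

text \<open>The Riesz representation theorem for a functional given as a linear relation \<open>G\<close> between vectors and
  values; a relation spares the proof that values on a span are well defined.  The representing vector is the
  minimizer of $\|x\|^2 - 2\,\mathrm{Re}\,z$ over \<open>G\<close>.  As a limit of vectors in the domain of \<open>G\<close> it is
  orthogonal to whatever that domain is orthogonal to.\<close>

lemma riesz_relation:
  assumes G: "\<And>x z. (x, z) \<in> G \<Longrightarrow> x \<in> V" and ne: "G \<noteq> {}"
    and closed: "\<And>s x z t x' z'. (x, z) \<in> G \<Longrightarrow> (x', z') \<in> G \<Longrightarrow> (lin s x t x', s * z + t * z') \<in> G"
    and bound: "\<And>x z. (x, z) \<in> G \<Longrightarrow> (cmod z)\<^sup>2 \<le> C * nsq x" and C: "0 \<le> C"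
  shows "\<exists>w\<in>V. (\<forall>x z. (x, z) \<in> G \<longrightarrow> ip x w = z) \<and> nsq w \<le> C \<and>
    (\<forall>v\<in>V. (\<forall>x z. (x, z) \<in> G \<longrightarrow> ip x v = 0) \<longrightarrow> ip w v = 0)"
proof -
  define q where "q = (\<lambda>(x, z). nsq x - 2 * Re z)"
  have lower: "- C \<le> q g" if "g \<in> G" for g
  proof -
    obtain x z where g: "g = (x, z)" by (cases g)
    have b: "(cmod z)\<^sup>2 \<le> C * nsq x" and x: "0 \<le> nsq x" using that g bound G ip_nonneg by blast+
    have "(2 * cmod z)\<^sup>2 \<le> (C + nsq x)\<^sup>2"
      using b zero_le_power2[of "C - nsq x"] by (simp add: power2_eq_square algebra_simps)
    then have "2 * cmod z \<le> C + nsq x"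
      by (rule power2_le_imp_le) (use C x in simp)
    then show ?thesis using complex_Re_le_cmod[of z] by (simp add: q_def g)
  qed
  define d where "d = Inf (q ` G)"
  have bdd: "bdd_below (q ` G)" using lower by (intro bdd_belowI[of _ "-C"]) auto
  have d: "d \<le> q g" if "g \<in> G" for g
    unfolding d_def using that bdd by (intro cInf_lower) auto
  have "\<exists>g\<in>G. q g < d + 1 / Suc n" for n
  proof -
    have "Inf (q ` G) < d + 1 / Suc n" by (simp add: d_def)
    then show ?thesis using ne bdd by (simp add: cInf_less_iff)
  qed
  then obtain g where g: "\<And>n. g n \<in> G" "\<And>n. q (g n) < d + 1 / Suc n" by metis
  define X Z where "X = fst \<circ> g" and "Z = snd \<circ> g"
  have XZ: "(X n, Z n) \<in> G" "q (X n, Z n) < d + 1 / Suc n" for n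
    using g[of n] by (simp_all add: X_def Z_def)
  have XV: "X n \<in> V" for n using XZ G by blast
  have q_lim: "(\<lambda>n. q (X n, Z n)) \<longlonglongrightarrow> d"
  proof (rule tendsto_sandwich[of "\<lambda>n. d" _ _ "\<lambda>n. d + 1 / Suc n"])
    have "(\<lambda>n. d + 1 / Suc n) \<longlonglongrightarrow> d + 0"
      by (intro tendsto_add tendsto_const LIMSEQ_Suc lim_1_over_n)
    then show "(\<lambda>n. d + 1 / Suc n) \<longlonglongrightarrow> d" by simp
  qed (use XZ d in \<open>auto intro!: always_eventually less_imp_le\<close>)
  \<comment> \<open>The parallelogram law makes a minimizing sequence Cauchy.\<close>
  have par: "nsq (lin 1 (X m) (-1) (X n)) \<le> 2 / Suc m + 2 / Suc n" for m n
  proof -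
    have "d \<le> q (lin (1/2) (X m) (1/2) (X n), 1/2 * Z m + 1/2 * Z n)"
      by (intro d closed XZ)
    moreover have "nsq (lin 1 (X m) (-1) (X n)) = 2 * q (X m, Z m) + 2 * q (X n, Z n)
        - 4 * q (lin (1/2) (X m) (1/2) (X n), 1/2 * Z m + 1/2 * Z n)"
      using XV[of m] XV[of n] by (simp add: q_def nsq_lin power2_eq_square)
    ultimately show ?thesis using XZ(2)[of m] XZ(2)[of n] by simp
  qed
  have "\<exists>w\<in>V. (\<lambda>n. nsq (lin 1 (X n) (-1) w)) \<longlonglongrightarrow> 0"
  proof (rule complete[OF XV])
    fix e :: real assume "0 < e"
    then obtain N where N: "4 / e < real N" using reals_Archimedean2 by blast
    have "nsq (lin 1 (X m) (-1) (X n)) < e" if "m \<ge> N" "n \<ge> N" for m n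
    proof -
      have h: "2 / Suc k < e / 2" if "k \<ge> N" for k
      proof -
        have "4 / e < Suc k" using N that by linarith
        then show ?thesis using \<open>0 < e\<close> by (simp add: field_simps)
      qed
      show ?thesis using par[of m n] h[of m] h[of n] that by linarith
    qed
    then show "\<exists>N. \<forall>m\<ge>N. \<forall>n\<ge>N. nsq (lin 1 (X m) (-1) (X n)) < e" by blast
  qed
  then obtain w where w: "w \<in> V" and lim: "(\<lambda>n. nsq (lin 1 (X n) (-1) w)) \<longlonglongrightarrow> 0" by blast
  note ip_lim = tendsto_ip_left[OF XV w _ lim]
  have Re_eq: "Re (ip x w) = Re z" if xz: "(x, z) \<in> G" for x z
  proof -
    have x: "x \<in> V" using xz G by blast
    have "0 \<le> 0 + 2 * t * (Re (ip w x) - Re z) + t\<^sup>2 * nsq x" for t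
    proof -
      have "d \<le> q (X n, Z n) + 2 * t * (Re (ip (X n) x) - Re z) + t\<^sup>2 * nsq x" for n
        using d[OF closed[OF XZ(1)[of n] xz, of 1 "of_real t"]] XV[of n] x
        by (simp add: q_def nsq_lin algebra_simps)
      moreover have "(\<lambda>n. q (X n, Z n) + 2 * t * (Re (ip (X n) x) - Re z) + t\<^sup>2 * nsq x)
          \<longlonglongrightarrow> d + 2 * t * (Re (ip w x) - Re z) + t\<^sup>2 * nsq x"
        by (intro tendsto_intros q_lim ip_lim x)
      ultimately have "d \<le> d + 2 * t * (Re (ip w x) - Re z) + t\<^sup>2 * nsq x"
        by (intro LIMSEQ_le_const) auto
      then show ?thesis by simp
    qed
    then have "(Re (ip w x) - Re z)\<^sup>2 \<le> 0 * nsq x" by (rule nonneg_quadratic_discriminant)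
    then show ?thesis using ip_commute[of w x] w x by simp
  qed
  have eq: "ip x w = z" if xz: "(x, z) \<in> G" for x z
  proof -
    have x: "x \<in> V" using xz G by blast
    have "Re (ip (lin \<i> x 0 x) w) = Re (\<i> * z + 0 * z)"
      by (intro Re_eq closed xz)
    then show ?thesis using Re_eq[OF xz] w x by (simp add: ip_lin_left complex_eq_iff)
  qed
  show ?thesis
  proof (intro bexI[of _ w] conjI allI ballI impI)
    have "(\<lambda>n. nsq (lin 1 (X n) (-1) w) + 2 * Re (ip (X n) w) - nsq w)
        \<longlonglongrightarrow> 0 + 2 * nsq w - nsq w"
      by (intro tendsto_intros lim ip_lim w)
    then have nX: "(\<lambda>n. nsq (X n)) \<longlonglongrightarrow> nsq w"
      using XV w by (simp add: nsq_lin)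
    have "(\<lambda>n. Re (ip (X n) w)) \<longlonglongrightarrow> nsq w" by (intro tendsto_intros ip_lim w)
    then have "(\<lambda>n. (Re (ip (X n) w))\<^sup>2) \<longlonglongrightarrow> (nsq w)\<^sup>2" by (rule tendsto_power)
    moreover have "(\<lambda>n. C * nsq (X n)) \<longlonglongrightarrow> C * nsq w" by (intro tendsto_intros nX)
    moreover have "(Re (ip (X n) w))\<^sup>2 \<le> C * nsq (X n)" for n
    proof -
      have "(Re (ip (X n) w))\<^sup>2 \<le> (cmod (Z n))\<^sup>2"
        using eq[OF XZ(1)[of n]] abs_Re_le_cmod[of "Z n"] by (metis abs_ge_zero power2_abs power_mono)
      then show ?thesis using bound[OF XZ(1)[of n]] by linarith
    qed
    ultimately have "(nsq w)\<^sup>2 \<le> C * nsq w" by (intro LIMSEQ_le) auto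
    then show "nsq w \<le> C"
      using ip_nonneg[OF w] C by (cases "nsq w = 0") (auto simp: power2_eq_square)
  next
    fix v assume v: "v \<in> V" and orth: "\<forall>x z. (x, z) \<in> G \<longrightarrow> ip x v = 0"
    have "(\<lambda>n. ip (X n) v) \<longlonglongrightarrow> ip w v" by (rule ip_lim[OF v])
    moreover have "ip (X n) v = 0" for n using orth XZ(1)[of n] by blast
    ultimately show "ip w v = 0" by (simp add: LIMSEQ_const_iff)
  qed (use w eq in auto)
qed

end

section \<open>Orthonormal bases\<close>

lemma semi_hilbert_UNIV:
  "semi_hilbert (UNIV :: 'h::separable_complex_hilbert set) (\<lambda>s x t y. s *\<^sub>C x + t *\<^sub>C y) cinner"
proof
  fix X :: "nat \<Rightarrow> 'h"
  assume "\<And>e. 0 < e \<Longrightarrow> \<exists>N. \<forall>m\<ge>N. \<forall>n\<ge>N.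
    Re (cinner (1 *\<^sub>C X m + (-1) *\<^sub>C X n) (1 *\<^sub>C X m + (-1) *\<^sub>C X n)) < e"
  then have *: "\<exists>N. \<forall>m\<ge>N. \<forall>n\<ge>N. (norm (X m - X n))\<^sup>2 < e" if "e > 0" for e
    using that by (simp add: Re_cinner_self complex_vector.scale_minus_left)
  have "Cauchy X"
  proof (rule metric_CauchyI)
    fix e :: real assume "0 < e"
    then have "0 < e\<^sup>2" by simp
    from *[OF this] obtain N where N: "\<And>m n. m \<ge> N \<Longrightarrow> n \<ge> N \<Longrightarrow> (norm (X m - X n))\<^sup>2 < e\<^sup>2"
      by blast
    then show "\<exists>M. \<forall>m\<ge>M. \<forall>n\<ge>M. dist (X m) (X n) < e"
      using power_less_imp_less_base[OF N] \<open>0 < e\<close> by (metis dist_norm less_imp_le)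
  qed
  then obtain x where "X \<longlonglongrightarrow> x" using Cauchy_convergent convergent_def by blast
  then have "(\<lambda>n. norm (X n - x)) \<longlonglongrightarrow> 0" using LIM_zero tendsto_norm_zero by blast
  then have "(\<lambda>n. (norm (X n - x))\<^sup>2) \<longlonglongrightarrow> 0" using tendsto_power[of _ 0 _ 2] by fastforce
  then show "\<exists>x\<in>UNIV. (\<lambda>n. Re (cinner (1 *\<^sub>C X n + (-1) *\<^sub>C x) (1 *\<^sub>C X n + (-1) *\<^sub>C x))) \<longlonglongrightarrow> 0"
    by (intro bexI[of _ x]) (simp_all add: Re_cinner_self complex_vector.scale_minus_left)
qed (auto simp: cinner_add_left cinner_scaleC_left Re_cinner_self intro: cinner_commute)

lemma norm_sum_orthonormal:
  fixes e :: "'i \<Rightarrow> 'h::complex_inner"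
  assumes e: "\<And>i j. i \<in> F \<Longrightarrow> j \<in> F \<Longrightarrow> cinner (e i) (e j) = (if i = j then 1 else 0)" and F: "finite F"
  shows "(norm (\<Sum>i\<in>F. c i *\<^sub>C e i))\<^sup>2 = (\<Sum>i\<in>F. (cmod (c i))\<^sup>2)"
proof -
  have "cinner (\<Sum>i\<in>F. c i *\<^sub>C e i) (\<Sum>i\<in>F. c i *\<^sub>C e i) =
      (\<Sum>i\<in>F. \<Sum>j\<in>F. c i * cnj (c j) * cinner (e i) (e j))"
    by (simp add: cinner_sum_left cinner_sum_right cinner_scaleC_left sum_distrib_left mult_ac)
      (rule sum.swap)
  also have "\<dots> = (\<Sum>i\<in>F. \<Sum>j\<in>F. if i = j then c i * cnj (c j) else 0)"
    by (intro sum.cong) (auto simp: e)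
  also have "\<dots> = (\<Sum>i\<in>F. c i * cnj (c i))" using F by (simp add: sum.delta)
  finally show ?thesis
    by (simp add: Re_cinner_self[symmetric] flip: complex_norm_square)
qed

lemma orthonormal_remainder:
  fixes e :: "'i \<Rightarrow> 'h::complex_inner"
  assumes e: "\<And>i j. i \<in> F \<Longrightarrow> j \<in> F \<Longrightarrow> cinner (e i) (e j) = (if i = j then 1 else 0)" and F: "finite F"
    and k: "k \<in> F"
  shows "cinner (x - (\<Sum>i\<in>F. cinner x (e i) *\<^sub>C e i)) (e k) = 0"
proof -
  have "cinner (\<Sum>i\<in>F. cinner x (e i) *\<^sub>C e i) (e k) = (\<Sum>i\<in>F. if i = k then cinner x (e i) else 0)"
    by (simp add: cinner_sum_left cinner_scaleC_left e k if_distrib cong: if_cong)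
  then show ?thesis using F k by (simp add: cinner_diff_left sum.delta)
qed

lemma bessel:
  fixes e :: "'i \<Rightarrow> 'h::complex_inner"
  assumes e: "\<And>i j. i \<in> F \<Longrightarrow> j \<in> F \<Longrightarrow> cinner (e i) (e j) = (if i = j then 1 else 0)" and F: "finite F"
  shows "(\<Sum>i\<in>F. (cmod (cinner x (e i)))\<^sup>2) \<le> (norm x)\<^sup>2"
proof -
  define s where "s = (\<Sum>i\<in>F. cinner x (e i) *\<^sub>C e i)"
  have "cinner (x - s) s = 0"
    using orthonormal_remainder[OF e F] by (simp add: s_def cinner_sum_right)
  then have "(x - s) \<bullet> s = 0" by (simp add: inner_cinner)
  then have "(norm x)\<^sup>2 = (norm (x - s))\<^sup>2 + (norm s)\<^sup>2"
    using norm_add_Pythagorean[of "x - s" s] by (simp add: orthogonal_def)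
  then show ?thesis
    using norm_sum_orthonormal[OF e F, of "\<lambda>i. cinner x (e i)"] by (simp add: s_def)
qed

context
  fixes e :: "nat \<Rightarrow> 'h::separable_complex_hilbert"
  assumes e: "orthonormal_basis e"
begin

lemma basis_orthonormal: "cinner (e m) (e n) = (if m = n then 1 else 0)"
  using e by (simp add: orthonormal_basis_def)

lemma norm_basis [simp]: "norm (e n) = 1"
  using basis_orthonormal[of n n] Re_cinner_self[of "e n"] by (simp add: power2_eq_1_iff)
    (metis norm_ge_zero not_one_le_zero neg_0_le_iff_le)

lemma basis_total: "(\<And>n. cinner x (e n) = cinner y (e n)) \<Longrightarrow> x = y"
  using e unfolding orthonormal_basis_def by (metis cinner_diff_left eq_iff_diff_eq_0)

text \<open>Bessel's inequality makes the series Cauchy, and totality identifies its sum.\<close>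

lemma basis_expansion: "(\<lambda>n. cinner x (e n) *\<^sub>C e n) sums x"
proof -
  have "summable (\<lambda>n. (cmod (cinner x (e n)))\<^sup>2)"
    using bessel[of _ e x] by (intro summableI_nonneg_bounded) (auto simp: basis_orthonormal)
  have "summable (\<lambda>n. cinner x (e n) *\<^sub>C e n)"
    unfolding summable_Cauchy
  proof (intro allI impI)
    fix d :: real assume "0 < d"
    then obtain N where N: "\<And>m n. m \<ge> N \<Longrightarrow> norm (\<Sum>k = m..<n. (cmod (cinner x (e k)))\<^sup>2) < d\<^sup>2"
      using \<open>summable (\<lambda>n. (cmod (cinner x (e n)))\<^sup>2)\<close>[unfolded summable_Cauchy, rule_format, of "d\<^sup>2"]
      by auto
    have "norm (\<Sum>k = m..<n. cinner x (e k) *\<^sub>C e k) < d" if "m \<ge> N" for m n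
    proof (rule power2_less_imp_less)
      show "(norm (\<Sum>k = m..<n. cinner x (e k) *\<^sub>C e k))\<^sup>2 < d\<^sup>2"
        using N[OF that, of n] by (subst norm_sum_orthonormal) (auto simp: basis_orthonormal)
    qed (use \<open>0 < d\<close> in simp)
    then show "\<exists>N. \<forall>m\<ge>N. \<forall>n. norm (\<Sum>k = m..<n. cinner x (e k) *\<^sub>C e k) < d" by blast
  qed
  then obtain s where s: "(\<lambda>n. cinner x (e n) *\<^sub>C e n) sums s" by (auto simp: summable_def)
  have "cinner s (e k) = cinner x (e k)" for k
  proof -
    have "(\<lambda>n. cinner (cinner x (e n) *\<^sub>C e n) (e k)) sums cinner s (e k)"
      using bounded_linear.sums[OF bounded_bilinear.bounded_linear_left[OF bounded_bilinear_cinner] s] .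
    moreover have "cinner (cinner x (e n) *\<^sub>C e n) (e k) = (if n = k then cinner x (e k) else 0)" for n
      by (simp add: cinner_scaleC_left basis_orthonormal)
    ultimately have "(\<lambda>n. if n = k then cinner x (e k) else 0) sums cinner s (e k)" by simp
    moreover have "(\<lambda>n. if n = k then cinner x (e k) else 0) sums cinner x (e k)"
      by (rule sums_single)
    ultimately show ?thesis by (rule sums_unique2)
  qed
  then have "s = x" by (rule basis_total)
  then show ?thesis using s by simp
qed

lemma parseval: "(\<lambda>n. (cmod (cinner x (e n)))\<^sup>2) sums (norm x)\<^sup>2"
proof -
  have "(\<lambda>n. Re (cinner (cinner x (e n) *\<^sub>C e n) x)) sums Re (cinner x x)"
    by (intro sums_Re bounded_linear.sums[OF bounded_bilinear.bounded_linear_left[OF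
            bounded_bilinear_cinner] basis_expansion])
  moreover have "Re (cinner (cinner x (e n) *\<^sub>C e n) x) = (cmod (cinner x (e n)))\<^sup>2" for n
    by (simp add: cinner_scaleC_left cinner_commute[of "e n" x] flip: complex_norm_square)
  ultimately show ?thesis by (simp add: Re_cinner_self)
qed

lemma bounded_clinear_eqI:
  assumes "bounded_clinear a" "bounded_clinear b" "\<And>m n. cinner (a (e m)) (e n) = cinner (b (e m)) (e n)"
  shows "a = b"
proof
  fix x
  have "(\<lambda>n. f (cinner x (e n) *\<^sub>C e n)) sums f x" if "bounded_clinear f" for f :: "'h \<Rightarrow> 'h"
  proof -
    have "bounded_linear f" using that by (simp add: bounded_clinear_def)
    then show ?thesis by (rule bounded_linear.sums[OF _ basis_expansion])
  qed
  from this[OF assms(1)] this[OF assms(2)]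
  have "(\<lambda>n. a (cinner x (e n) *\<^sub>C e n)) sums a x" "(\<lambda>n. b (cinner x (e n) *\<^sub>C e n)) sums b x" .
  moreover have "a (e n) = b (e n)" for n using assms(3) by (rule basis_total)
  ultimately show "a x = b x"
    using assms by (simp add: bounded_clinear_scaleC sums_unique2)
qed

end

text \<open>A maximal orthonormal set is total.  It is countable because the balls of radius 1/2 around its points
  are disjoint, and infinite because a finite one would span the space.\<close>

lemma orthonormal_basis_exists:
  assumes inf: "\<nexists>B :: 'h::separable_complex_hilbert set. finite B \<and> complex_vector.span B = UNIV"
  shows "\<exists>e :: nat \<Rightarrow> 'h. orthonormal_basis e"
proof -
  define ons where "ons = {S :: 'h set. \<forall>x\<in>S. \<forall>y\<in>S. cinner x y = (if x = y then 1 else 0)}"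
  have "\<exists>S\<in>ons. \<forall>X\<in>ons. S \<subseteq> X \<longrightarrow> X = S"
  proof (rule subset_Zorn')
    fix C assume C: "subset.chain ons C"
    show "\<Union>C \<in> ons"
      unfolding ons_def
    proof (intro CollectI ballI)
      fix x y assume "x \<in> \<Union>C" "y \<in> \<Union>C"
      then obtain X Y where XY: "X \<in> C" "Y \<in> C" "x \<in> X" "y \<in> Y" by blast
      then have "X \<subseteq> Y \<or> Y \<subseteq> X" using C by (auto simp: subset_chain_def)
      then obtain Z where "Z \<in> C" "x \<in> Z" "y \<in> Z" using XY by blast
      then show "cinner x y = (if x = y then 1 else 0)"
        using C by (auto simp: subset_chain_def ons_def)
    qed
  qed
  then obtain S where S: "S \<in> ons" and max: "\<And>X. X \<in> ons \<Longrightarrow> S \<subseteq> X \<Longrightarrow> X = S" by blast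
  have orth: "cinner x y = (if x = y then 1 else 0)" if "x \<in> S" "y \<in> S" for x y
    using S that by (auto simp: ons_def)
  have total: "x = 0" if x: "\<And>y. y \<in> S \<Longrightarrow> cinner x y = 0" for x
  proof (rule ccontr)
    assume "x \<noteq> 0"
    define u where "u = of_real (1 / norm x) *\<^sub>C x"
    have "norm u = 1" using \<open>x \<noteq> 0\<close> by (simp add: u_def norm_divide)
    then have u1: "cinner u u = 1" by (simp add: cinner_self)
    have u0: "cinner u y = 0" "cinner y u = 0" if "y \<in> S" for y
      using x[OF that] cinner_commute[of u y] by (simp_all add: u_def cinner_scaleC_left)
    have "u \<notin> S" using u0(1)[of u] u1 by auto
    then have "insert u S \<in> ons" by (auto simp: ons_def u0 u1 orth)
    then show False using max[of "insert u S"] \<open>u \<notin> S\<close> by blast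
  qed
  have "countable S"
  proof -
    have dist: "1 < dist x y" if "x \<in> S" "y \<in> S" "x \<noteq> y" for x y
    proof (rule power2_less_imp_less)
      have "cinner (x - y) (x - y) = 2"
        using that by (simp add: cinner_diff_left cinner_diff_right orth)
      then have "(dist x y)\<^sup>2 = 2" by (simp add: dist_norm Re_cinner_self[symmetric])
      then show "1\<^sup>2 < (dist x y)\<^sup>2" by simp
    qed simp
    have "disjnt (ball x (1/2)) (ball y (1/2))" if "x \<in> S" "y \<in> S" "x \<noteq> y" for x y
      unfolding disjnt_iff
    proof (intro allI notI)
      fix z assume "z \<in> ball x (1/2) \<and> z \<in> ball y (1/2)"
      then have "dist x z < 1/2" "dist y z < 1/2" by simp_all
      then show False using dist[OF that] dist_triangle2[of x y z] by linarith
    qed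
    then have disj: "disjnt (ball x (1/2)) (ball y (1/2))" if "x \<in> S" "y \<in> S" "ball x (1/2) \<noteq> ball y (1/2)" for x y
      using that by blast
    have "countable ((\<lambda>x. ball x (1/2)) ` S)"
      by (rule countable_disjoint_open_subsets) (auto simp: pairwise_def disj)
    moreover have "inj_on (\<lambda>x. ball x (1/2)) S"
      using \<open>\<And>x y. x \<in> S \<Longrightarrow> y \<in> S \<Longrightarrow> x \<noteq> y \<Longrightarrow> disjnt (ball x (1/2)) (ball y (1/2))\<close>
      by (intro inj_onI) (metis centre_in_ball disjnt_iff half_gt_zero_iff zero_less_one)
    ultimately show ?thesis by (rule countable_image_inj_on)
  qed
  moreover have "infinite S"
  proof
    assume fin: "finite S"
    have "x \<in> complex_vector.span S" for x
    proof -
      have "x - (\<Sum>y\<in>S. cinner x y *\<^sub>C y) = 0"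
        using orthonormal_remainder[of S "\<lambda>y. y" _ x] orth fin by (intro total) simp
      moreover have "(\<Sum>y\<in>S. cinner x y *\<^sub>C y) \<in> complex_vector.span S"
        by (intro complex_vector.span_sum complex_vector.span_scale complex_vector.span_base)
      ultimately show ?thesis by simp
    qed
    then show False using inf fin by blast
  qed
  ultimately have b: "bij_betw (from_nat_into S) UNIV S" by (rule bij_betw_from_nat_into)
  have "orthonormal_basis (from_nat_into S)"
    unfolding orthonormal_basis_def
  proof (intro conjI allI impI)
    show "cinner (from_nat_into S m) (from_nat_into S n) = (if m = n then 1 else 0)" for m n
      using orth[of "from_nat_into S m" "from_nat_into S n"] bij_betw_apply[OF b]
        inj_eq[of "from_nat_into S" m n] b
      by (simp add: bij_betw_def)
    fix x assume "\<forall>n. cinner x (from_nat_into S n) = 0"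
    then show "x = 0" using b total by (metis bij_betw_iff_bijections)
  qed
  then show ?thesis by blast
qed

section \<open>Adjoints and positive operators\<close>

text \<open>A factorization lemma of Douglas type: if $\|Tx\|\le K\|Sx\|$ then $T = B^*S$ with $\|B\|\le K$.
  The case of the identity for \<open>S\<close> gives the adjoint, the case of the modulus of \<open>T\<close> the polar decomposition.
  The last conclusion says that the range of \<open>B\<close> lies in the closure of the range of \<open>S\<close>; it makes \<open>B\<close>
  unique and hence linear.\<close>

lemma riesz_operator:
  fixes S T :: "'h::separable_complex_hilbert \<Rightarrow> 'h"
  assumes S: "bounded_clinear S" and T: "bounded_clinear T"
    and dom: "\<And>x. norm (T x) \<le> K * norm (S x)" and K: "0 \<le> K"
  obtains B where "bounded_clinear B" "\<And>x y. cinner (S x) (B y) = cinner (T x) y"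
    "\<And>y. norm (B y) \<le> K * norm y"
    "\<And>y v. (\<And>x. cinner (S x) v = 0) \<Longrightarrow> cinner (B y) v = 0"
proof -
  interpret H: semi_hilbert "UNIV :: 'h set" "\<lambda>s x t y. s *\<^sub>C x + t *\<^sub>C y" cinner
    by (rule semi_hilbert_UNIV)
  have "\<exists>w. (\<forall>x. cinner (S x) w = cinner (T x) y) \<and> norm w \<le> K * norm y \<and>
      (\<forall>v. (\<forall>x. cinner (S x) v = 0) \<longrightarrow> cinner w v = 0)" for y
  proof -
    define G where "G = range (\<lambda>x. (S x, cinner (T x) y))"
    have ne: "G \<noteq> {}" by (auto simp: G_def)
    have closed: "(s *\<^sub>C x + t *\<^sub>C x', s * z + t * z') \<in> G"
      if xz: "(x, z) \<in> G" "(x', z') \<in> G" for s x z t x' z'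
    proof -
      obtain u where "x = S u" "z = cinner (T u) y" using xz(1) by (auto simp: G_def)
      moreover obtain u' where "x' = S u'" "z' = cinner (T u') y" using xz(2) by (auto simp: G_def)
      ultimately have "(s *\<^sub>C x + t *\<^sub>C x', s * z + t * z') =
          (S (s *\<^sub>C u + t *\<^sub>C u'), cinner (T (s *\<^sub>C u + t *\<^sub>C u')) y)"
        by (simp add: S T bounded_clinear_add bounded_clinear_scaleC cinner_add_left cinner_scaleC_left)
      then show ?thesis unfolding G_def by blast
    qed
    have bound: "(cmod z)\<^sup>2 \<le> (K * norm y)\<^sup>2 * Re (cinner x x)" if xz: "(x, z) \<in> G" for x z
    proof -
      obtain u where u: "x = S u" "z = cinner (T u) y" using xz by (auto simp: G_def)
      have "cmod z \<le> norm (T u) * norm y" unfolding u by (rule norm_cinner_le)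
      also have "\<dots> \<le> K * norm x * norm y" unfolding u by (intro mult_right_mono dom) simp
      finally have "(cmod z)\<^sup>2 \<le> (K * norm x * norm y)\<^sup>2" by (intro power_mono) simp_all
      then show ?thesis by (simp add: Re_cinner_self power_mult_distrib mult_ac)
    qed
    have "\<exists>w\<in>UNIV. (\<forall>x z. (x, z) \<in> G \<longrightarrow> cinner x w = z) \<and> (norm w)\<^sup>2 \<le> (K * norm y)\<^sup>2 \<and>
        (\<forall>v\<in>UNIV. (\<forall>x z. (x, z) \<in> G \<longrightarrow> cinner x v = 0) \<longrightarrow> cinner w v = 0)"
      by (rule H.riesz_relation[OF UNIV_I ne closed bound zero_le_power2, unfolded Re_cinner_self])
    then obtain w where w: "\<forall>x z. (x, z) \<in> G \<longrightarrow> cinner x w = z" "(norm w)\<^sup>2 \<le> (K * norm y)\<^sup>2"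
      "\<forall>v\<in>UNIV. (\<forall>x z. (x, z) \<in> G \<longrightarrow> cinner x v = 0) \<longrightarrow> cinner w v = 0"
      by (elim bexE conjE)
    show ?thesis
    proof (intro exI[of _ w] conjI allI impI)
      show "norm w \<le> K * norm y" using power2_le_imp_le[OF w(2)] K by simp
      show "cinner (S x) w = cinner (T x) y" for x
        by (rule w(1)[rule_format]) (simp add: G_def)
      show "cinner w v = 0" if "\<forall>x. cinner (S x) v = 0" for v
        by (rule w(3)[rule_format]) (use that in \<open>auto simp: G_def\<close>)
    qed
  qed
  then obtain B where B: "\<And>x y. cinner (S x) (B y) = cinner (T x) y"
    "\<And>y. norm (B y) \<le> K * norm y"
    "\<And>y v. (\<And>x. cinner (S x) v = 0) \<Longrightarrow> cinner (B y) v = 0"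
    by metis
  have uniq: "B y + d *\<^sub>C B y' = B z" if "z = y + d *\<^sub>C y'" for y y' z d
  proof -
    define v where "v = B y + d *\<^sub>C B y' - B z"
    have "cinner (S x) v = 0" for x
      by (simp add: v_def that cinner_add_right cinner_diff_right B(1))
    then have "cinner (B u) v = 0" for u by (rule B(3))
    then have "cinner v v = 0"
      by (subst (1) v_def) (simp add: cinner_add_left cinner_diff_left cinner_scaleC_left)
    then show ?thesis by (simp add: v_def)
  qed
  have "bounded_clinear B"
  proof (rule bounded_clinearI[where K=K])
    show "B (x + y) = B x + B y" for x y using uniq[of "x + y" x 1 y] by simp
    have "B 0 = 0" using B(2)[of 0] by simp
    then show "B (c *\<^sub>C x) = c *\<^sub>C B x" for c x using uniq[of "c *\<^sub>C x" 0 c x] by simp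
  qed (rule B(2))
  then show ?thesis using B that by blast
qed

lemma
  assumes a: "bounded_clinear (a :: 'h::separable_complex_hilbert \<Rightarrow> 'h)"
  shows bounded_clinear_adj: "bounded_clinear (adj a)"
    and cinner_adj_right: "cinner x (adj a y) = cinner (a x) y"
    and adj_unique: "bounded_clinear b \<Longrightarrow> (\<And>x y. cinner (a x) y = cinner x (b y)) \<Longrightarrow> adj a = b"
    and norm_adj_le: "(\<And>x. norm (a x) \<le> K * norm x) \<Longrightarrow> 0 \<le> K \<Longrightarrow> norm (adj a y) \<le> K * norm y"
proof -
  have uniq: "adj a = b" if "bounded_clinear b" "\<And>x y. cinner (a x) y = cinner x (b y)" for b
    unfolding adj_def
  proof (rule the_equality)
    fix c assume "bounded_clinear c \<and> (\<forall>x y. cinner (a x) y = cinner x (c y))"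
    then have "cinner x (c y) = cinner x (b y)" for x y using that by metis
    then show "c = b" by (metis cinner_commute cinner_eqI ext)
  qed (use that in blast)
  then show "bounded_clinear b \<Longrightarrow> (\<And>x y. cinner (a x) y = cinner x (b y)) \<Longrightarrow> adj a = b" .
  have ex: "bounded_clinear (adj a) \<and> (\<forall>x y. cinner x (adj a y) = cinner (a x) y) \<and>
     (\<forall>y. norm (adj a y) \<le> K * norm y)" if K: "\<And>x. norm (a x) \<le> K * norm x" "0 \<le> K" for K
  proof -
    obtain b where b: "bounded_clinear b" "\<And>x y. cinner x (b y) = cinner (a x) y"
      "\<And>y. norm (b y) \<le> K * norm y"
      by (rule riesz_operator[OF bounded_clinear_id a K]) blast
    then have "adj a = b" by (intro uniq) simp_all
    then show ?thesis using b by simp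
  qed
  show "(\<And>x. norm (a x) \<le> K * norm x) \<Longrightarrow> 0 \<le> K \<Longrightarrow> norm (adj a y) \<le> K * norm y"
    using ex by blast
  obtain K where "K > 0" "\<And>x. norm (a x) \<le> K * norm x" using bounded_clinear_bounded[OF a] by blast
  then show "bounded_clinear (adj a)" "cinner x (adj a y) = cinner (a x) y"
    using ex[of K] by (simp_all add: less_imp_le)
qed

lemma cinner_adj_left:
  "bounded_clinear a \<Longrightarrow> cinner (adj a x) y = cinner x (a (y::'h::separable_complex_hilbert))"
  by (metis cinner_adj_right cinner_commute)

lemma positive_op_bounded_clinear: "positive_op P \<Longrightarrow> bounded_clinear P"
  by (simp add: positive_op_def)

lemma positive_op_nonneg: "positive_op P \<Longrightarrow> 0 \<le> Re (cinner (P x) x)"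
  by (simp add: positive_op_def)

text \<open>Polarization: the quadratic form is real at $x+y$ and at $x+iy$.\<close>

lemma positive_op_hermitian:
  assumes P: "positive_op P"
  shows "cinner (P x) y = cinner x (P y)"
proof -
  note lin = bounded_clinear_add[OF positive_op_bounded_clinear[OF P]]
    bounded_clinear_scaleC[OF positive_op_bounded_clinear[OF P]]
  have real: "Im (cinner (P z) z) = 0" for z using P by (simp add: positive_op_def)
  have "Im (cinner (P x) y) + Im (cinner (P y) x) = 0"
    using real[of "x + y"] real[of x] real[of y] by (simp add: lin cinner_add_left cinner_add_right)
  moreover have "Re (cinner (P x) y) = Re (cinner (P y) x)"
    using real[of "x + \<i> *\<^sub>C y"] real[of x] real[of y]
    by (simp add: lin cinner_add_left cinner_add_right cinner_scaleC_left)
  ultimately show ?thesis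
    by (simp add: cinner_commute[of "P y" x] complex_eq_iff)
qed

lemma positive_op_semi_inner:
  assumes P: "positive_op P"
  shows "semi_inner UNIV (\<lambda>s x t y. s *\<^sub>C x + t *\<^sub>C y) (\<lambda>x y. cinner (P x) y)"
proof
  show "cinner (P y) x = cnj (cinner (P x) y)" for x y
    by (metis P cinner_commute positive_op_hermitian)
qed (use P in \<open>auto simp: positive_op_nonneg cinner_add_left cinner_scaleC_left
    bounded_clinear_add bounded_clinear_scaleC positive_op_bounded_clinear\<close>)

lemma positive_op_cauchy_schwarz:
  assumes P: "positive_op P"
  shows "(cmod (cinner (P x) y))\<^sup>2 \<le> Re (cinner (P x) x) * Re (cinner (P y) y)"
  using semi_inner.cauchy_schwarz[OF positive_op_semi_inner[OF P]] by simp

lemma arith_geo_mean_square: "z\<^sup>2 \<le> a * b \<Longrightarrow> 0 \<le> a \<Longrightarrow> 0 \<le> b \<Longrightarrow> z \<le> (a + b) / 2" for z a b :: real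
proof (rule power2_le_imp_le)
  assume "z\<^sup>2 \<le> a * b"
  moreover have "0 \<le> (a - b)\<^sup>2" by simp
  ultimately show "z\<^sup>2 \<le> ((a + b) / 2)\<^sup>2"
    by (simp add: power2_eq_square field_simps)
qed simp

text \<open>Cauchy-Schwarz for the form of \<open>P\<close>, applied to $x$ and $Px$.\<close>

lemma positive_op_norm_square_le:
  assumes P: "positive_op P" and K: "\<And>x. norm (P x) \<le> K * norm x"
  shows "(norm (P x))\<^sup>2 \<le> K * Re (cinner (P x) x)"
proof (cases "P x = 0")
  case False
  have "((norm (P x))\<^sup>2)\<^sup>2 \<le> Re (cinner (P x) x) * Re (cinner (P (P x)) (P x))"
    using positive_op_cauchy_schwarz[OF P, of x "P x"] by (simp add: cinner_self norm_power)
  also have "\<dots> \<le> Re (cinner (P x) x) * (K * (norm (P x))\<^sup>2)"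
  proof (rule mult_left_mono)
    have "Re (cinner (P (P x)) (P x)) \<le> norm (P (P x)) * norm (P x)"
      using complex_Re_le_cmod norm_cinner_le order_trans by blast
    also have "\<dots> \<le> K * norm (P x) * norm (P x)" by (intro mult_right_mono K) simp
    finally show "Re (cinner (P (P x)) (P x)) \<le> K * (norm (P x))\<^sup>2"
      by (simp add: power2_eq_square)
  qed (rule positive_op_nonneg[OF P])
  finally show ?thesis using False by (simp add: power2_eq_square mult_ac)
qed (simp add: positive_op_nonneg[OF P])

section \<open>The square root of a positive operator\<close>

text \<open>With $B = 1 - A$ the square root is $1 - Z$ where $Z = (B + Z^2)/2$.  The iterates $Y_{n+1} = (B + Y_n^2)/2$
  converge because they are dominated by the scalar iteration $y_{n+1} = (1 + y_n^2)/2$, which increases: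
  $\|Y_{n+1}-Y_n\| \le y_{n+1}-y_n$.\<close>

lemma positive_contraction_sqrt_exists:
  fixes A :: "'h::separable_complex_hilbert \<Rightarrow> 'h"
  assumes A: "positive_op A" and A1: "\<And>x. norm (A x) \<le> norm x"
  shows "\<exists>S. positive_op S \<and> (\<forall>x. S (S x) = A x)"
proof -
  note A_lin = positive_op_bounded_clinear[OF A]
  define B where "B = (\<lambda>x. x - A x)"
  have B_lin: "bounded_clinear B"
    unfolding B_def by (intro bounded_clinear_minus bounded_clinear_id A_lin)
  have B1: "norm (B x) \<le> norm x" for x
  proof (rule power2_le_imp_le)
    have "(norm (B x))\<^sup>2 = (norm x)\<^sup>2 - 2 * (A x \<bullet> x) + (norm (A x))\<^sup>2"
      by (simp add: B_def power2_norm_eq_inner inner_diff_left inner_diff_right inner_commute)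
    moreover have "(norm (A x))\<^sup>2 \<le> A x \<bullet> x"
      using positive_op_norm_square_le[OF A, of 1 x] A1 by (simp add: inner_cinner)
    moreover have "0 \<le> A x \<bullet> x" using positive_op_nonneg[OF A] by (simp add: inner_cinner)
    ultimately show "(norm (B x))\<^sup>2 \<le> (norm x)\<^sup>2" by linarith
  qed simp
  have B_herm: "cinner (B x) y = cinner x (B y)" for x y
    by (simp add: B_def cinner_diff_left cinner_diff_right positive_op_hermitian[OF A])
  define Y where "Y = rec_nat (\<lambda>x::'h. 0) (\<lambda>_ Yn x. (1/2) *\<^sub>R (B x + Yn (Yn x)))"
  define y :: "nat \<Rightarrow> real" where "y = rec_nat 0 (\<lambda>_ yn. (1 + yn\<^sup>2) / 2)"
  have Y0: "Y 0 = (\<lambda>x. 0)" and YS: "\<And>n. Y (Suc n) = (\<lambda>x. (1/2) *\<^sub>R (B x + Y n (Y n x)))"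
    and y0: "y 0 = 0" and yS: "\<And>n. y (Suc n) = (1 + (y n)\<^sup>2) / 2"
    by (simp_all add: Y_def y_def)
  have y01: "0 \<le> y n \<and> y n \<le> 1" for n
    by (induction n) (auto simp: y0 yS power_le_one)
  have Y_lin: "bounded_clinear (Y n)" for n
    by (induction n) (auto simp: Y0 YS bounded_clinear_0
        intro!: bounded_clinear_scaleR_op bounded_clinear_plus B_lin intro: bounded_clinear_compose)
  have Y_herm: "cinner (Y n x) z = cinner x (Y n z)" for n x z
  proof (induction n arbitrary: x z)
    case (Suc n)
    show ?case
      by (simp add: YS scaleR_scaleC cinner_scaleC_left cinner_add_left cinner_add_right B_herm Suc)
  qed (simp add: Y0)
  have Y_bound: "norm (Y n x) \<le> y n * norm x" for n x
  proof (induction n arbitrary: x)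
    case (Suc n)
    have "norm (Y n (Y n x)) \<le> y n * (y n * norm x)"
      using Suc[of "Y n x"] Suc[of x] y01[of n] by (meson mult_left_mono order_trans)
    then have "norm (B x + Y n (Y n x)) \<le> norm x + y n * (y n * norm x)"
      using B1[of x] norm_triangle_ineq[of "B x" "Y n (Y n x)"] by linarith
    moreover have "norm (Y (Suc n) x) = norm (B x + Y n (Y n x)) / 2"
      unfolding YS norm_scaleR by simp
    ultimately show ?case by (simp add: yS power2_eq_square) (simp add: algebra_simps)
  qed (simp add: Y0 y0)
  \<comment> \<open>$2(Y_{n+2}-Y_{n+1}) = (Y_{n+1}-Y_n)Y_{n+1} + Y_n(Y_{n+1}-Y_n)$ and the same identity for the scalars.\<close>
  have Y_step: "norm (Y (Suc n) x - Y n x) \<le> (y (Suc n) - y n) * norm x" for n x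
  proof (induction n arbitrary: x)
    case 0
    then show ?case using B1[of x] by (simp add: Y0 YS y0 yS)
  next
    case (Suc n)
    let ?D = "\<lambda>x. Y (Suc n) x - Y n x" and ?d = "y (Suc n) - y n"
    have split: "Y (Suc (Suc n)) x - Y (Suc n) x = (1/2) *\<^sub>R (?D (Y (Suc n) x) + Y n (?D x))"
      unfolding YS[of "Suc n"] by (subst (2) YS)
        (simp add: bounded_clinear_diff[OF Y_lin] flip: scaleR_right_diff_distrib)
    have d: "0 \<le> ?d"
    proof (rule ccontr)
      assume "\<not> 0 \<le> ?d"
      then show False using yS[of n] zero_le_power2[of "y n - 1"]
        by (simp add: power2_eq_square algebra_simps)
    qed
    have "norm (?D (Y (Suc n) x)) \<le> ?d * (y (Suc n) * norm x)"
      using Suc[of "Y (Suc n) x"] Y_bound[of "Suc n" x] d by (meson mult_left_mono order_trans)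
    moreover have "norm (Y n (?D x)) \<le> y n * (?d * norm x)"
      using Y_bound[of n "?D x"] Suc[of x] y01[of n] by (meson mult_left_mono order_trans)
    ultimately have "norm (?D (Y (Suc n) x) + Y n (?D x)) \<le> ?d * (y (Suc n) * norm x) + y n * (?d * norm x)"
      by (meson add_mono norm_triangle_ineq order_trans)
    also have "\<dots> = 2 * ((y (Suc (Suc n)) - y (Suc n)) * norm x)"
      by (simp add: yS[of "Suc n"] yS[of n] field_simps power2_eq_square)
    finally show ?case unfolding split by simp
  qed
  have "y n \<le> y (Suc n)" for n
    using yS[of n] zero_le_power2[of "y n - 1"] by (simp add: power2_eq_square algebra_simps)
  then have y_mono: "incseq y" by (rule incseq_SucI)
  have "convergent y"
    by (rule Bseq_mono_convergent[OF BseqI'[where K=1]])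
      (use y01 y_mono in \<open>auto simp: incseq_def\<close>)
  then have y_cauchy: "Cauchy y" by (rule convergent_Cauchy)
  have Y_diff: "norm (Y m x - Y n x) \<le> \<bar>y m - y n\<bar> * norm x" for m n x
  proof -
    have *: "norm (Y (n + k) x - Y n x) \<le> (y (n + k) - y n) * norm x" for n k
    proof (induction k)
      case (Suc k)
      show ?case
        using Suc Y_step[of "n + k" x]
          norm_triangle_ineq[of "Y (Suc (n + k)) x - Y (n + k) x" "Y (n + k) x - Y n x"]
        by (simp add: algebra_simps)
    qed simp
    show ?thesis
    proof (cases "m \<ge> n")
      case True
      then show ?thesis using *[of n "m - n"] y_mono by (simp add: incseq_def)
    next
      case False
      then show ?thesis using *[of m "n - m"] y_mono by (simp add: incseq_def norm_minus_commute)
    qed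
  qed
  have "convergent (\<lambda>n. Y n x)" for x
  proof -
    have "Cauchy (\<lambda>n. Y n x)"
    proof (rule metric_CauchyI)
      fix e :: real assume "0 < e"
      then have "0 < e / (norm x + 1)" by (simp add: add_nonneg_pos)
      then obtain N where N: "\<And>m n. m \<ge> N \<Longrightarrow> n \<ge> N \<Longrightarrow> \<bar>y m - y n\<bar> < e / (norm x + 1)"
        using y_cauchy unfolding Cauchy_def dist_real_def by blast
      have "dist (Y m x) (Y n x) < e" if "m \<ge> N" "n \<ge> N" for m n
      proof -
        have "dist (Y m x) (Y n x) \<le> \<bar>y m - y n\<bar> * norm x" using Y_diff by (simp add: dist_norm)
        also have "\<dots> \<le> \<bar>y m - y n\<bar> * (norm x + 1)" by (intro mult_left_mono) auto
        also have "\<dots> < e" using N[OF that] by (simp add: pos_less_divide_eq add_nonneg_pos)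
        finally show ?thesis .
      qed
      then show "\<exists>N. \<forall>m\<ge>N. \<forall>n\<ge>N. dist (Y m x) (Y n x) < e" by blast
    qed
    then show ?thesis by (rule Cauchy_convergent)
  qed
  define Z where "Z = (\<lambda>x. lim (\<lambda>n. Y n x))"
  have Z: "(\<lambda>n. Y n x) \<longlonglongrightarrow> Z x" for x
    using \<open>convergent (\<lambda>n. Y n x)\<close> by (simp add: Z_def convergent_LIMSEQ_iff)
  have Z1: "norm (Z x) \<le> norm x" for x
  proof (rule LIMSEQ_le_const2[OF tendsto_norm[OF Z]])
    show "\<exists>N. \<forall>n\<ge>N. norm (Y n x) \<le> norm x"
      using Y_bound[of _ x] y01 by (metis mult_left_le_one_le norm_ge_zero order_trans)
  qed
  have Z_lin: "bounded_clinear Z"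
  proof (rule bounded_clinearI[where K=1])
    fix x z
    have "(\<lambda>n. Y n (x + z)) \<longlonglongrightarrow> Z x + Z z"
      unfolding bounded_clinear_add[OF Y_lin] by (intro tendsto_add Z)
    then show "Z (x + z) = Z x + Z z" using Z LIMSEQ_unique by blast
  next
    fix c x
    have "(\<lambda>n. Y n (c *\<^sub>C x)) \<longlonglongrightarrow> c *\<^sub>C Z x"
      unfolding bounded_clinear_scaleC[OF Y_lin] by (intro tendsto_scaleC tendsto_const Z)
    then show "Z (c *\<^sub>C x) = c *\<^sub>C Z x" using Z LIMSEQ_unique by blast
  qed (simp add: Z1)
  have Z_herm: "cinner (Z x) z = cinner x (Z z)" for x z
  proof (rule LIMSEQ_unique)
    show "(\<lambda>n. cinner (Y n x) z) \<longlonglongrightarrow> cinner (Z x) z" by (intro tendsto_cinner Z tendsto_const)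
    show "(\<lambda>n. cinner (Y n x) z) \<longlonglongrightarrow> cinner x (Z z)"
      unfolding Y_herm by (intro tendsto_cinner Z tendsto_const)
  qed
  have Z_fix: "Z x = (1/2) *\<^sub>R (B x + Z (Z x))" for x
  proof (rule LIMSEQ_unique)
    show "(\<lambda>n. Y (Suc n) x) \<longlonglongrightarrow> Z x" by (rule LIMSEQ_Suc[OF Z])
    have "(\<lambda>n. Y n (Y n x - Z x)) \<longlonglongrightarrow> 0"
    proof (rule tendsto_norm_zero_cancel, rule tendsto_sandwich[OF _ _ tendsto_const])
      show "(\<lambda>n. norm (Y n x - Z x)) \<longlonglongrightarrow> 0"
        using Z[of x] by (intro tendsto_norm_zero LIM_zero)
      show "\<forall>\<^sub>F n in sequentially. norm (Y n (Y n x - Z x)) \<le> norm (Y n x - Z x)"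
        using Y_bound y01 by (intro always_eventually allI)
          (metis mult_left_le_one_le norm_ge_zero order_trans)
    qed simp
    then have "(\<lambda>n. Y n (Y n x - Z x) + Y n (Z x)) \<longlonglongrightarrow> 0 + Z (Z x)" by (intro tendsto_add Z)
    then have "(\<lambda>n. Y n (Y n x)) \<longlonglongrightarrow> Z (Z x)" by (simp add: bounded_clinear_diff[OF Y_lin])
    then show "(\<lambda>n. Y (Suc n) x) \<longlonglongrightarrow> (1/2) *\<^sub>R (B x + Z (Z x))"
      unfolding YS by (intro tendsto_intros)
  qed
  show ?thesis
  proof (intro exI[of _ "\<lambda>x. x - Z x"] conjI allI)
    show "positive_op (\<lambda>x. x - Z x)"
      unfolding positive_op_def
    proof (intro conjI allI)
      show "bounded_clinear (\<lambda>x. x - Z x)" by (intro bounded_clinear_minus bounded_clinear_id Z_lin)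
      show "Im (cinner (x - Z x) x) = 0" for x
        using Z_herm[of x x] cinner_commute[of "Z x" x] by (simp add: cinner_diff_left complex_eq_iff)
      have "Re (cinner (Z x) x) \<le> norm x * norm x" for x
        using Z1[of x] norm_cinner_le[of "Z x" x] complex_Re_le_cmod[of "cinner (Z x) x"]
          mult_right_mono[OF Z1[of x] norm_ge_zero[of x]] by linarith
      then show "0 \<le> Re (cinner (x - Z x) x)" for x
        by (simp add: cinner_diff_left Re_cinner_self power2_eq_square)
    qed
    show "x - Z x - Z (x - Z x) = A x" for x
    proof -
      have "2 *\<^sub>R Z x = 2 *\<^sub>R ((1/2) *\<^sub>R (B x + Z (Z x)))"
        using Z_fix[of x] by (rule arg_cong)
      then have "2 *\<^sub>R Z x = B x + Z (Z x)" by simp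
      then show ?thesis
        by (simp add: bounded_clinear_diff[OF Z_lin] B_def scaleR_2 algebra_simps)
    qed
  qed
qed

lemma positive_op_scaleR: "positive_op P \<Longrightarrow> 0 \<le> r \<Longrightarrow> positive_op (\<lambda>x. r *\<^sub>R P x)"
  using bounded_clinear_scaleR_op[of P r]
  by (simp add: positive_op_def scaleR_scaleC cinner_scaleC_left)

lemma positive_op_add: "positive_op P \<Longrightarrow> positive_op Q \<Longrightarrow> positive_op (\<lambda>x. P x + Q x)"
  by (simp add: positive_op_def bounded_clinear_plus cinner_add_left)

lemma positive_sqrt_exists:
  fixes A :: "'h::separable_complex_hilbert \<Rightarrow> 'h"
  assumes A: "positive_op A"
  obtains S where "positive_op S" "\<And>x. S (S x) = A x"
proof -
  obtain K where K: "K > 0" "\<And>x. norm (A x) \<le> K * norm x"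
    using bounded_clinear_bounded[OF positive_op_bounded_clinear[OF A]] by blast
  have "positive_op (\<lambda>x. (1 / K) *\<^sub>R A x)" using A K by (intro positive_op_scaleR) auto
  moreover have "norm ((1 / K) *\<^sub>R A x) \<le> norm x" for x
    using K(1) K(2)[of x] by (simp add: field_simps)
  ultimately obtain S where S: "positive_op S" "\<And>x. S (S x) = (1 / K) *\<^sub>R A x"
    using positive_contraction_sqrt_exists by blast
  show ?thesis
  proof
    show "positive_op (\<lambda>x. sqrt K *\<^sub>R S x)" using S K by (intro positive_op_scaleR) auto
    show "sqrt K *\<^sub>R S (sqrt K *\<^sub>R S x) = A x" for x
      using K(1) by (simp add: S bounded_clinear_scaleR[OF positive_op_bounded_clinear[OF S(1)]])
  qed
qed

text \<open>Let $D = P - Q$.  From $P^2 = Q^2$ one gets $PD = -DQ$ and $QD = -DP$.  Along approximate eigenvectors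
  $x_n$ of $D^2$ for the value $\|D\|^2$, the number $(PD^2x_n,x_n) = -(QDx_n,Dx_n)$ is at most 0 and
  asymptotic to $\|D\|^2(Px_n,x_n)$, so $Px_n \to 0$; likewise $Qx_n \to 0$, which forces $D = 0$.\<close>

lemma positive_sqrt_unique:
  fixes P Q :: "'h::separable_complex_hilbert \<Rightarrow> 'h"
  assumes P: "positive_op P" and Q: "positive_op Q" and PQ: "\<And>x. P (P x) = Q (Q x)"
  shows "P = Q"
proof (rule ccontr)
  assume "P \<noteq> Q"
  note P_lin = positive_op_bounded_clinear[OF P] and Q_lin = positive_op_bounded_clinear[OF Q]
  define D where "D = (\<lambda>x. P x - Q x)"
  have D_lin: "bounded_clinear D" unfolding D_def by (intro bounded_clinear_minus P_lin Q_lin)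
  then have D_bl: "bounded_linear D" by (simp add: bounded_clinear_def)
  have D_herm: "D x \<bullet> y = x \<bullet> D y" for x y
    by (simp add: D_def inner_cinner cinner_diff_left cinner_diff_right
        positive_op_hermitian[OF P] positive_op_hermitian[OF Q])
  have PD: "P (D x) = - D (Q x)" and QD: "Q (D x) = - D (P x)" for x
    by (simp_all add: D_def bounded_clinear_diff[OF P_lin] bounded_clinear_diff[OF Q_lin] PQ)
  define L where "L = onorm D"
  have L: "L > 0"
    using \<open>P \<noteq> Q\<close> onorm_pos_lt[OF D_bl] by (auto simp: L_def D_def fun_eq_iff)
  have "\<exists>x. norm x = 1 \<and> L - 1 / Suc n < norm (D x)" for n
  proof (rule ccontr)
    assume no: "\<not> ?thesis"
    have "norm (D x) \<le> max 0 (L - 1 / Suc n) * norm x" for x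
    proof (cases "x = 0")
      case False
      then have "norm (D ((1 / norm x) *\<^sub>R x)) \<le> L - 1 / Suc n"
        using no by (metis norm_sgn not_le sgn_div_norm inverse_eq_divide)
      then have "norm (D x) \<le> (L - 1 / Suc n) * norm x"
        using False by (simp add: bounded_clinear_scaleR[OF D_lin] field_simps)
      also have "\<dots> \<le> max 0 (L - 1 / Suc n) * norm x" by (intro mult_right_mono) auto
      finally show ?thesis .
    qed (simp add: bounded_clinear_zero[OF D_lin])
    then have "L \<le> max 0 (L - 1 / Suc n)" unfolding L_def by (intro onorm_bound) auto
    then show False using L by (simp add: max_def split: if_splits)
  qed
  then obtain x where x: "\<And>n. norm (x n) = 1" "\<And>n. L - 1 / Suc n < norm (D (x n))" by metis
  have D_le: "norm (D y) \<le> L * norm y" for y unfolding L_def by (rule onorm[OF D_bl])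
  have Dx: "(\<lambda>n. norm (D (x n))) \<longlonglongrightarrow> L"
  proof (rule tendsto_sandwich[OF _ _ _ tendsto_const])
    have "(\<lambda>n. L - 1 / Suc n) \<longlonglongrightarrow> L - 0" by (intro tendsto_intros LIMSEQ_Suc lim_1_over_n)
    then show "(\<lambda>n. L - 1 / Suc n) \<longlonglongrightarrow> L" by simp
    show "\<forall>\<^sub>F n in sequentially. norm (D (x n)) \<le> L"
      using D_le[of "x _"] x(1) by (simp add: always_eventually)
  qed (use x(2) in \<open>auto intro!: always_eventually less_imp_le\<close>)
  define r where "r = (\<lambda>n. D (D (x n)) - L\<^sup>2 *\<^sub>R x n)"
  \<comment> \<open>\<open>r n\<close> is the error of \<open>x n\<close> as an eigenvector of $D^2$.\<close>
  have r2: "(norm (r n))\<^sup>2 \<le> L\<^sup>2 * (L\<^sup>2 - (norm (D (x n)))\<^sup>2)" for n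
  proof -
    have expand: "(norm (a - c *\<^sub>R b))\<^sup>2 = (norm a)\<^sup>2 - 2 * c * (a \<bullet> b) + c\<^sup>2 * (norm b)\<^sup>2"
      for a b :: 'h and c
      unfolding power2_norm_eq_inner
      by (simp add: inner_diff_left inner_diff_right inner_commute[of b a] power2_eq_square algebra_simps)
    have "D (D (x n)) \<bullet> x n = (norm (D (x n)))\<^sup>2"
      unfolding D_herm power2_norm_eq_inner ..
    then have "(norm (r n))\<^sup>2 = (norm (D (D (x n))))\<^sup>2 - 2 * L\<^sup>2 * (norm (D (x n)))\<^sup>2 + L\<^sup>2 * L\<^sup>2"
      unfolding r_def expand by (simp add: x(1) power2_eq_square)
    moreover have "(norm (D (D (x n))))\<^sup>2 \<le> (L * norm (D (x n)))\<^sup>2"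
      by (intro power_mono D_le) simp
    ultimately show ?thesis by (simp add: power_mult_distrib algebra_simps)
  qed
  have "(\<lambda>n. (norm (r n))\<^sup>2) \<longlonglongrightarrow> 0"
  proof (rule tendsto_sandwich[OF _ _ tendsto_const])
    have "(\<lambda>n. L\<^sup>2 * (L\<^sup>2 - (norm (D (x n)))\<^sup>2)) \<longlonglongrightarrow> L\<^sup>2 * (L\<^sup>2 - L\<^sup>2)"
      by (intro tendsto_intros Dx)
    then show "(\<lambda>n. L\<^sup>2 * (L\<^sup>2 - (norm (D (x n)))\<^sup>2)) \<longlonglongrightarrow> 0" by simp
  qed (use r2 in auto)
  then have "(\<lambda>n. sqrt ((norm (r n))\<^sup>2)) \<longlonglongrightarrow> sqrt 0" by (rule tendsto_real_sqrt)
  then have r0: "(\<lambda>n. norm (r n)) \<longlonglongrightarrow> 0" by simp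
  have vanish: "(\<lambda>n. norm (R (x n))) \<longlonglongrightarrow> 0"
    if R: "positive_op R" and R': "positive_op R'" and RD: "\<And>x. R (D x) = - D (R' x)" for R R'
  proof -
    obtain K where K: "K > 0" "\<And>x. norm (R x) \<le> K * norm x"
      using bounded_clinear_bounded[OF positive_op_bounded_clinear[OF R]] by blast
    have "L\<^sup>2 * (norm (R (x n)))\<^sup>2 \<le> K * K * norm (r n)" for n
    proof -
      have "R (D (D (x n))) \<bullet> x n = - (R' (D (x n)) \<bullet> D (x n))"
        by (simp add: RD D_herm)
      also have "\<dots> \<le> 0" using positive_op_nonneg[OF R'] by (simp add: inner_cinner)
      finally have "R (r n) \<bullet> x n + L\<^sup>2 * (R (x n) \<bullet> x n) \<le> 0"
        by (simp add: r_def bounded_clinear_diff[OF positive_op_bounded_clinear[OF R]]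
            bounded_clinear_scaleR[OF positive_op_bounded_clinear[OF R]] inner_diff_left)
      moreover have "- (R (r n) \<bullet> x n) \<le> norm (R (r n)) * norm (x n)"
        using norm_cauchy_schwarz[of "- R (r n)" "x n"] by simp
      ultimately have "L\<^sup>2 * (R (x n) \<bullet> x n) \<le> K * norm (r n)"
        using K(2)[of "r n"] x(1)[of n] by simp
      then have "K * (L\<^sup>2 * (R (x n) \<bullet> x n)) \<le> K * (K * norm (r n))"
        using K(1) by (intro mult_left_mono) auto
      moreover have "(norm (R (x n)))\<^sup>2 \<le> K * (R (x n) \<bullet> x n)"
        using positive_op_norm_square_le[OF R K(2)] by (simp add: inner_cinner)
      then have "L\<^sup>2 * (norm (R (x n)))\<^sup>2 \<le> L\<^sup>2 * (K * (R (x n) \<bullet> x n))"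
        by (intro mult_left_mono) auto
      ultimately show ?thesis by (simp add: mult_ac)
    qed
    then have le: "(norm (R (x n)))\<^sup>2 \<le> K * K / L\<^sup>2 * norm (r n)" for n
      using L by (simp add: field_simps)
    have "(\<lambda>n. (norm (R (x n)))\<^sup>2) \<longlonglongrightarrow> 0"
    proof (rule tendsto_sandwich[OF _ _ tendsto_const])
      show "(\<lambda>n. K * K / L\<^sup>2 * norm (r n)) \<longlonglongrightarrow> 0"
        using tendsto_mult_left[OF r0, of "K * K / L\<^sup>2"] by simp
    qed (use le in auto)
    then have "(\<lambda>n. sqrt ((norm (R (x n)))\<^sup>2)) \<longlonglongrightarrow> sqrt 0" by (rule tendsto_real_sqrt)
    then show ?thesis by simp
  qed
  have "(\<lambda>n. norm (P (x n)) + norm (Q (x n))) \<longlonglongrightarrow> 0 + 0"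
    by (intro tendsto_add vanish[OF P Q PD] vanish[OF Q P QD])
  then have "L \<le> 0 + 0"
    by (rule LIMSEQ_le[OF Dx]) (auto simp: D_def norm_triangle_ineq4)
  then show False using L by simp
qed

section \<open>The modulus and the trace\<close>

lemma
  fixes T :: "'h::separable_complex_hilbert \<Rightarrow> 'h"
  assumes T: "bounded_clinear T"
  shows positive_abs_op: "positive_op (abs_op T)"
    and abs_op_square: "abs_op T (abs_op T x) = adj T (T x)"
proof -
  have "positive_op (\<lambda>x. adj T (T x))"
    unfolding positive_op_def
    by (auto simp: bounded_clinear_compose bounded_clinear_adj T cinner_adj_left Re_cinner_self)
  then obtain S where S: "positive_op S" "\<And>x. S (S x) = adj T (T x)"
    by (rule positive_sqrt_exists) blast
  have "\<exists>!P. positive_op P \<and> P \<circ> P = adj T \<circ> T"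
  proof (rule ex1I[of _ S])
    show "P = S" if "positive_op P \<and> P \<circ> P = adj T \<circ> T" for P
      using that S by (intro positive_sqrt_unique) (auto simp: fun_eq_iff)
  qed (use S in \<open>auto simp: fun_eq_iff\<close>)
  then have "positive_op (abs_op T) \<and> abs_op T \<circ> abs_op T = adj T \<circ> T"
    unfolding abs_op_def by (rule theI')
  then show "positive_op (abs_op T)" "abs_op T (abs_op T x) = adj T (T x)"
    by (auto simp: fun_eq_iff)
qed

lemma norm_abs_op:
  assumes T: "bounded_clinear T"
  shows "norm (abs_op T x) = norm (T x)"
proof -
  have "cinner (abs_op T x) (abs_op T x) = cinner (T x) (T x)"
    by (metis T abs_op_square cinner_adj_left positive_abs_op positive_op_hermitian)
  then show ?thesis by (metis Re_cinner_self norm_ge_zero power2_eq_iff_nonneg)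
qed

lemma abs_op_positive:
  assumes P: "positive_op P"
  shows "abs_op P = P"
proof (rule positive_sqrt_unique)
  have lin: "bounded_clinear P" using P by (rule positive_op_bounded_clinear)
  show "positive_op (abs_op P)" by (rule positive_abs_op[OF lin])
  have "adj P = P" using adj_unique[OF lin lin positive_op_hermitian[OF P]] .
  then show "abs_op P (abs_op P x) = P (P x)" for x by (simp add: abs_op_square[OF lin])
qed (rule P)

text \<open>\<open>B\<close> is the adjoint of the partial isometry of the polar decomposition: $T = B^*|T|$ and $BT = |T|$.\<close>

lemma polar_decomposition:
  assumes T: "bounded_clinear T"
  obtains B where "bounded_clinear B" "\<And>y. norm (B y) \<le> norm y"
    "\<And>x y. cinner (abs_op T x) (B y) = cinner (T x) y" "\<And>x. B (T x) = abs_op T x"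
proof -
  note abs_lin = positive_op_bounded_clinear[OF positive_abs_op[OF T]]
  obtain B where B: "bounded_clinear B" "\<And>x y. cinner (abs_op T x) (B y) = cinner (T x) y"
    "\<And>y. norm (B y) \<le> 1 * norm y"
    "\<And>y v. (\<And>x. cinner (abs_op T x) v = 0) \<Longrightarrow> cinner (B y) v = 0"
    by (rule riesz_operator[OF abs_lin T, of 1]) (auto simp: norm_abs_op[OF T])
  have "B (T x) = abs_op T x" for x
  proof -
    define v where "v = B (T x) - abs_op T x"
    have orth: "cinner (abs_op T z) v = 0" for z
      using positive_op_hermitian[OF positive_abs_op[OF T], of "abs_op T z" x]
      by (simp add: v_def cinner_diff_right B(2) abs_op_square[OF T] cinner_adj_left[OF T]
          flip: positive_op_hermitian[OF positive_abs_op[OF T]])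
    then have "cinner (B (T x)) v = 0" by (rule B(4))
    with orth[of x] have "cinner v v = 0"
      by (subst (1) v_def) (simp add: cinner_diff_left)
    then show ?thesis by (simp add: v_def)
  qed
  then show ?thesis using B that by simp
qed

text \<open>For $A = S^2$ the sum on the left is a sum of $\|SVe_n\|^2$.  Expanding in the basis and exchanging the
  order of summation bounds it by the sum of $\|V^*Se_k\|^2$, where $V^*$ is a contraction.\<close>

lemma trace_compression_le:
  fixes A V :: "'h::separable_complex_hilbert \<Rightarrow> 'h"
  assumes e: "orthonormal_basis e" and A: "positive_op A" and sum: "summable (\<lambda>n. Re (cinner (A (e n)) (e n)))"
    and V: "bounded_clinear V" "\<And>x. norm (V x) \<le> norm x"
  shows "(\<Sum>n<N. Re (cinner (A (V (e n))) (V (e n)))) \<le> (\<Sum>n. Re (cinner (A (e n)) (e n)))"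
proof -
  obtain S where S: "positive_op S" "\<And>x. S (S x) = A x" by (rule positive_sqrt_exists[OF A]) blast
  have A_S: "Re (cinner (A x) x) = (norm (S x))\<^sup>2" for x
    by (metis S Re_cinner_self positive_op_hermitian)
  have move: "cinner (S (V (e n))) (e k) = cnj (cinner (adj V (S (e k))) (e n))" for n k
    by (metis S(1) V(1) cinner_adj_right cinner_commute positive_op_hermitian)
  have "(\<Sum>n<N. (norm (S (V (e n))))\<^sup>2) = (\<Sum>n<N. \<Sum>k. (cmod (cinner (S (V (e n))) (e k)))\<^sup>2)"
    using sums_unique[OF parseval[OF e]] by simp
  also have "\<dots> = (\<Sum>k. \<Sum>n<N. (cmod (cinner (S (V (e n))) (e k)))\<^sup>2)"
    by (rule suminf_sum[symmetric]) (rule sums_summable[OF parseval[OF e]])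
  also have "\<dots> \<le> (\<Sum>k. (norm (S (e k)))\<^sup>2)"
  proof (rule suminf_le)
    fix k
    have "(\<Sum>n<N. (cmod (cinner (S (V (e n))) (e k)))\<^sup>2) \<le> (norm (adj V (S (e k))))\<^sup>2"
      unfolding move complex_mod_cnj by (rule bessel) (auto simp: basis_orthonormal[OF e])
    also have "\<dots> \<le> (norm (S (e k)))\<^sup>2"
      using norm_adj_le[OF V(1), of 1] V(2) by (intro power_mono) auto
    finally show "(\<Sum>n<N. (cmod (cinner (S (V (e n))) (e k)))\<^sup>2) \<le> (norm (S (e k)))\<^sup>2" .
  next
    show "summable (\<lambda>k. \<Sum>n<N. (cmod (cinner (S (V (e n))) (e k)))\<^sup>2)"
      by (intro summable_sum sums_summable[OF parseval[OF e]])
    show "summable (\<lambda>k. (norm (S (e k)))\<^sup>2)" using sum by (simp add: A_S)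
  qed
  finally show ?thesis by (simp add: A_S)
qed

text \<open>$(|T|e_n,e_n) = (Te_n,B^*e_n)$ for the contraction \<open>B\<close> of the polar decomposition, and the domination
  bounds this by diagonal entries of \<open>A\<close> and of a compression of \<open>A\<close>.\<close>

lemma summable_abs_op_of_dominated:
  fixes T A :: "'h::separable_complex_hilbert \<Rightarrow> 'h"
  assumes e: "orthonormal_basis e" and A: "positive_op A" and sum: "summable (\<lambda>n. Re (cinner (A (e n)) (e n)))"
    and T: "bounded_clinear T"
    and dom: "\<And>x y. cmod (cinner (T x) y) \<le> Re (cinner (A x) x) + Re (cinner (A y) y)"
  shows "summable (\<lambda>n. Re (cinner (abs_op T (e n)) (e n)))"
proof -
  obtain B where B: "bounded_clinear B" "\<And>y. norm (B y) \<le> norm y" "\<And>x. B (T x) = abs_op T x"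
    by (rule polar_decomposition[OF T]) blast
  let ?a = "\<lambda>n. Re (cinner (A (e n)) (e n))" and ?b = "\<lambda>n. Re (cinner (A (adj B (e n))) (adj B (e n)))"
  have le: "Re (cinner (abs_op T (e n)) (e n)) \<le> ?a n + ?b n" for n
  proof -
    have "cinner (abs_op T (e n)) (e n) = cinner (T (e n)) (adj B (e n))"
      by (simp add: cinner_adj_right[OF B(1)] B(3))
    then show ?thesis using dom[of "e n" "adj B (e n)"] complex_Re_le_cmod order_trans by metis
  qed
  have b: "(\<Sum>n<N. ?b n) \<le> suminf ?a" for N
    using norm_adj_le[OF B(1), of 1] B(2)
    by (intro trace_compression_le[OF e A sum bounded_clinear_adj[OF B(1)]]) simp
  have "summable ?b"
    by (rule summableI_nonneg_bounded[OF _ b]) (rule positive_op_nonneg[OF A])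
  then have "summable (\<lambda>n. ?a n + ?b n)" using sum by (rule summable_add[rotated])
  then show ?thesis
    by (rule summable_comparison_test'[where N=0])
      (use le positive_op_nonneg[OF positive_abs_op[OF T]] in auto)
qed

text \<open>$(Te_n,e_n) = (|T|e_n,Be_n)$ is bounded by the mean of the diagonal entries of $|T|$ and of its compression
  by \<open>B\<close>.\<close>

lemma sum_diagonal_le_trace_norm:
  fixes T :: "'h::separable_complex_hilbert \<Rightarrow> 'h"
  assumes e: "orthonormal_basis e" and T: "bounded_clinear T"
    and sum: "summable (\<lambda>n. Re (cinner (abs_op T (e n)) (e n)))"
  shows "(\<Sum>n<N. cmod (cinner (T (e n)) (e n))) \<le> (\<Sum>n. Re (cinner (abs_op T (e n)) (e n)))"
proof -
  obtain B where B: "bounded_clinear B" "\<And>y. norm (B y) \<le> norm y"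
    "\<And>x y. cinner (abs_op T x) (B y) = cinner (T x) y"
    by (rule polar_decomposition[OF T]) blast
  let ?a = "\<lambda>n. Re (cinner (abs_op T (e n)) (e n))"
    and ?b = "\<lambda>n. Re (cinner (abs_op T (B (e n))) (B (e n)))"
  note pos = positive_abs_op[OF T]
  have "cmod (cinner (T (e n)) (e n)) \<le> (?a n + ?b n) / 2" for n
    using positive_op_cauchy_schwarz[OF pos, of "e n" "B (e n)"]
    by (intro arith_geo_mean_square positive_op_nonneg[OF pos]) (simp_all add: B(3))
  then have "(\<Sum>n<N. cmod (cinner (T (e n)) (e n))) \<le> (\<Sum>n<N. (?a n + ?b n) / 2)"
    by (rule sum_mono)
  also have "\<dots> = ((\<Sum>n<N. ?a n) + (\<Sum>n<N. ?b n)) / 2"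
    by (simp add: sum.distrib flip: sum_divide_distrib)
  also have "\<dots> \<le> (suminf ?a + suminf ?a) / 2"
    using sum_le_suminf[OF sum, of "{..<N}"] trace_compression_le[OF e pos sum B(1,2), of N]
      positive_op_nonneg[OF pos] by simp
  finally show ?thesis by simp
qed

section \<open>The space of zero mean square integrable functions\<close>

definition L2_inner :: "'w measure \<Rightarrow> ('w \<Rightarrow> 'a::complex_inner) \<Rightarrow> ('w \<Rightarrow> 'a) \<Rightarrow> complex" where
  "L2_inner M f g = (\<integral>\<omega>. cinner (f \<omega>) (g \<omega>) \<partial>M)"

abbreviation L2_dist :: "'w measure \<Rightarrow> ('w \<Rightarrow> 'a::{banach, second_countable_topology}) \<Rightarrow> ('w \<Rightarrow> 'a) \<Rightarrow> real" where
  "L2_dist M f g \<equiv> L2_norm M (\<lambda>\<omega>. f \<omega> - g \<omega>)"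

abbreviation L2_tendsto :: "'w measure \<Rightarrow> (nat \<Rightarrow> 'w \<Rightarrow> 'a::{banach, second_countable_topology}) \<Rightarrow> ('w \<Rightarrow> 'a) \<Rightarrow> bool" where
  "L2_tendsto M X f \<equiv> (\<lambda>n. L2_dist M (X n) f) \<longlonglongrightarrow> 0"

lemma L2_0_measurable [measurable_dest]: "f \<in> L2_0 M \<Longrightarrow> f \<in> borel_measurable M"
  by (simp add: L2_0_def)

lemma L2_0_integrable_square: "f \<in> L2_0 M \<Longrightarrow> integrable M (\<lambda>\<omega>. (norm (f \<omega>))\<^sup>2)"
  by (simp add: L2_0_def)

lemma L2_0_integrable_norm_mult:
  assumes f: "f \<in> L2_0 M" and g: "g \<in> L2_0 M"
  shows "integrable M (\<lambda>\<omega>. norm (f \<omega>) * norm (g \<omega>))"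
proof (rule Bochner_Integration.integrable_bound)
  show "integrable M (\<lambda>\<omega>. (norm (f \<omega>))\<^sup>2 + (norm (g \<omega>))\<^sup>2)"
    by (intro Bochner_Integration.integrable_add L2_0_integrable_square f g)
  have "a * b \<le> a\<^sup>2 + b\<^sup>2" if "0 \<le> a" "0 \<le> b" for a b :: real
    using sum_squares_bound[of a b] mult_nonneg_nonneg[OF that] by linarith
  then show "AE \<omega> in M. norm (norm (f \<omega>) * norm (g \<omega>)) \<le> norm ((norm (f \<omega>))\<^sup>2 + (norm (g \<omega>))\<^sup>2)"
    by (simp add: abs_mult)
qed (use f g in measurable)

lemma L2_0_integrable_cinner:
  assumes f: "f \<in> L2_0 M" and g: "g \<in> L2_0 M"
  shows "integrable M (\<lambda>\<omega>. cinner (f \<omega>) (g \<omega>))"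
  by (rule Bochner_Integration.integrable_bound[OF L2_0_integrable_norm_mult[OF f g]])
    (use f g norm_cinner_le in \<open>auto simp: abs_mult\<close>)

lemma L2_norm_square: "(L2_norm M f)\<^sup>2 = (\<integral>\<omega>. (norm (f \<omega>))\<^sup>2 \<partial>M)"
  by (simp add: L2_norm_def)

lemma Re_L2_inner_self:
  assumes "f \<in> L2_0 M" shows "Re (L2_inner M f f) = (L2_norm M f)\<^sup>2"
proof -
  have "L2_inner M f f = (\<integral>\<omega>. complex_of_real ((norm (f \<omega>))\<^sup>2) \<partial>M)"
    unfolding L2_inner_def cinner_self ..
  also have "\<dots> = of_real (\<integral>\<omega>. (norm (f \<omega>))\<^sup>2 \<partial>M)"
    by (rule integral_complex_of_real)
  finally show ?thesis by (simp add: L2_norm_square)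
qed

lemma L2_norm_nonneg [simp]: "0 \<le> L2_norm M f"
  by (simp add: L2_norm_def)

lemma L2_norm_minus_commute:
  "L2_dist M f g = L2_dist M g f"
  by (simp add: L2_norm_def norm_minus_commute)

lemma L2_norm_eq_0D:
  assumes f: "f \<in> L2_0 M" and "L2_norm M f = 0"
  shows "AE \<omega> in M. f \<omega> = 0"
proof -
  have "(\<integral>\<omega>. (norm (f \<omega>))\<^sup>2 \<partial>M) = 0" using assms by (simp add: L2_norm_def)
  then have "AE \<omega> in M. (norm (f \<omega>))\<^sup>2 = 0"
    by (subst (asm) integral_nonneg_eq_0_iff_AE[OF L2_0_integrable_square[OF f]]) auto
  then show ?thesis by simp
qed

context prob_space
begin

lemma integrable_of_square:
  fixes f :: "'a \<Rightarrow> 'b::{banach, second_countable_topology}"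
  assumes f: "f \<in> borel_measurable M" and sq: "integrable M (\<lambda>\<omega>. (norm (f \<omega>))\<^sup>2)"
  shows "integrable M f"
proof (rule Bochner_Integration.integrable_bound[OF _ f])
  show "integrable M (\<lambda>\<omega>. 1 + (norm (f \<omega>))\<^sup>2)"
    by (intro Bochner_Integration.integrable_add sq integrable_const)
  have "x \<le> 1 + x\<^sup>2" for x :: real
    using zero_le_power2[of "x - 1"] zero_le_power2[of x]
    by (simp add: power2_eq_square algebra_simps) (use zero_le_square[of x] in linarith)
  then show "AE \<omega> in M. norm (f \<omega>) \<le> norm (1 + (norm (f \<omega>))\<^sup>2)" by (simp add: abs_of_nonneg)
qed

lemma L2_0_integrable: "f \<in> L2_0 M \<Longrightarrow> integrable M f"
  by (rule integrable_of_square[OF L2_0_measurable L2_0_integrable_square])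

text \<open>The variance of $\|f\|$ is nonnegative.\<close>

lemma norm_integral_square_le:
  fixes f :: "'a \<Rightarrow> 'b::{banach, second_countable_topology}"
  assumes [measurable]: "f \<in> borel_measurable M" and i: "integrable M (\<lambda>\<omega>. (norm (f \<omega>))\<^sup>2)" "integrable M f"
  shows "(\<integral>\<omega>. norm (f \<omega>) \<partial>M)\<^sup>2 \<le> (\<integral>\<omega>. (norm (f \<omega>))\<^sup>2 \<partial>M)"
proof -
  define c where "c = (\<integral>\<omega>. norm (f \<omega>) \<partial>M)"
  have "0 \<le> (\<integral>\<omega>. (norm (f \<omega>) - c)\<^sup>2 \<partial>M)" by simp
  also have "(\<lambda>\<omega>. (norm (f \<omega>) - c)\<^sup>2) = (\<lambda>\<omega>. (norm (f \<omega>))\<^sup>2 - 2 * c * norm (f \<omega>) + c\<^sup>2)"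
    by (auto simp: power2_eq_square algebra_simps)
  also have "(\<integral>\<omega>. (norm (f \<omega>))\<^sup>2 - 2 * c * norm (f \<omega>) + c\<^sup>2 \<partial>M) =
      (\<integral>\<omega>. (norm (f \<omega>))\<^sup>2 \<partial>M) - 2 * c * (\<integral>\<omega>. norm (f \<omega>) \<partial>M) + c\<^sup>2"
    using i(1) integrable_norm[OF i(2)] by (simp add: prob_space)
  finally show ?thesis by (simp add: c_def power2_eq_square)
qed

lemma L2_0_add:
  assumes f: "f \<in> L2_0 M" and g: "g \<in> L2_0 M"
  shows "(\<lambda>\<omega>. f \<omega> + g \<omega>) \<in> L2_0 M"
  unfolding L2_0_def
proof (intro CollectI conjI)
  show "(\<lambda>\<omega>. f \<omega> + g \<omega>) \<in> borel_measurable M" using f g by measurable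
  show "integrable M (\<lambda>\<omega>. (norm (f \<omega> + g \<omega>))\<^sup>2)"
  proof (rule Bochner_Integration.integrable_bound)
    show "integrable M (\<lambda>\<omega>. 2 * (norm (f \<omega>))\<^sup>2 + 2 * (norm (g \<omega>))\<^sup>2)"
      by (intro Bochner_Integration.integrable_add integrable_mult_right L2_0_integrable_square f g)
    have "(norm (a + b))\<^sup>2 \<le> 2 * (norm a)\<^sup>2 + 2 * (norm b)\<^sup>2" for a b :: 'b
    proof -
      have "(norm (a + b))\<^sup>2 \<le> (norm a + norm b)\<^sup>2" by (intro power_mono norm_triangle_ineq) simp
      then show ?thesis
        using zero_le_power2[of "norm a - norm b"] by (simp add: power2_eq_square algebra_simps)
    qed
    then show "AE \<omega> in M. norm ((norm (f \<omega> + g \<omega>))\<^sup>2) \<le> norm (2 * (norm (f \<omega>))\<^sup>2 + 2 * (norm (g \<omega>))\<^sup>2)"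
      by simp
  qed (use f g in measurable)
  show "(\<integral>\<omega>. f \<omega> + g \<omega> \<partial>M) = 0"
    using f g by (simp add: L2_0_integrable) (simp add: L2_0_def)
qed

lemma L2_0_bounded_linear:
  assumes f: "f \<in> L2_0 M" and a: "bounded_linear a"
  shows "(\<lambda>\<omega>. a (f \<omega>)) \<in> L2_0 M"
  unfolding L2_0_def
proof (intro CollectI conjI)
  have "continuous_on UNIV a" using a by (rule linear_continuous_on)
  from measurable_compose_rev[OF borel_measurable_continuous_onI[OF this] L2_0_measurable[OF f]]
  show m: "(\<lambda>\<omega>. a (f \<omega>)) \<in> borel_measurable M" .
  obtain K where K: "K > 0" "\<And>x. norm (a x) \<le> norm x * K" using bounded_linear.pos_bounded[OF a] by blast
  show "integrable M (\<lambda>\<omega>. (norm (a (f \<omega>)))\<^sup>2)"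
  proof (rule Bochner_Integration.integrable_bound)
    show "integrable M (\<lambda>\<omega>. K\<^sup>2 * (norm (f \<omega>))\<^sup>2)"
      by (intro integrable_mult_right L2_0_integrable_square f)
    have "(norm (a x))\<^sup>2 \<le> K\<^sup>2 * (norm x)\<^sup>2" for x
      using power_mono[OF K(2)[of x], of 2] by (simp add: power_mult_distrib mult.commute)
    then show "AE \<omega> in M. norm ((norm (a (f \<omega>)))\<^sup>2) \<le> norm (K\<^sup>2 * (norm (f \<omega>))\<^sup>2)"
      by (simp add: abs_mult)
  qed (use m in measurable)
  show "(\<integral>\<omega>. a (f \<omega>) \<partial>M) = 0"
    using integral_bounded_linear[OF a L2_0_integrable[OF f]] f a
    by (simp add: L2_0_def linear_0 bounded_linear.linear)
qed

lemma L2_0_zero: "(\<lambda>\<omega>. 0) \<in> L2_0 M"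
  by (simp add: L2_0_def)

lemma L2_0_scaleC:
  "f \<in> L2_0 M \<Longrightarrow> (\<lambda>\<omega>. c *\<^sub>C f \<omega>) \<in> L2_0 M"
  by (rule L2_0_bounded_linear[OF _ bounded_bilinear.bounded_linear_right[OF bounded_bilinear_scaleC]])

lemma L2_0_diff:
  assumes "f \<in> L2_0 M" "g \<in> L2_0 M" shows "(\<lambda>\<omega>. f \<omega> - g \<omega>) \<in> L2_0 M"
  using L2_0_add[OF assms(1) L2_0_bounded_linear[OF assms(2) bounded_linear_minus[OF bounded_linear_ident]]]
  by simp

lemma L2_0_sum: "(\<And>i. i \<in> F \<Longrightarrow> f i \<in> L2_0 M) \<Longrightarrow> (\<lambda>\<omega>. \<Sum>i\<in>F. f i \<omega>) \<in> L2_0 M"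
  by (induction F rule: infinite_finite_induct) (simp_all add: L2_0_zero L2_0_add)

text \<open>The theorem of Riesz and Fischer.  On a probability space a Cauchy sequence in mean square is Cauchy in
  mean, so a subsequence converges almost everywhere; the limit has mean zero because $|\int f|\le\|f-X_n\|$.\<close>

lemma L2_0_complete:
  fixes X :: "nat \<Rightarrow> 'a \<Rightarrow> 'b::{banach, second_countable_topology}"
  assumes X: "\<And>n. X n \<in> L2_0 M"
    and cauchy: "\<And>e. 0 < e \<Longrightarrow> \<exists>N. \<forall>m\<ge>N. \<forall>n\<ge>N. (L2_dist M (X m) (X n))\<^sup>2 < e"
  shows "\<exists>f\<in>L2_0 M. (\<lambda>n. (L2_dist M (X n) f)\<^sup>2) \<longlonglongrightarrow> 0"
proof -
  note [measurable] = L2_0_measurable[OF X]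
  have D: "(\<lambda>\<omega>. X m \<omega> - X n \<omega>) \<in> L2_0 M" for m n by (intro L2_0_diff X)
  have L1: "\<exists>N. \<forall>i\<ge>N. \<forall>j\<ge>N. (LINT \<omega>|M. norm (X i \<omega> - X j \<omega>)) < e" if "e > 0" for e
  proof -
    obtain N where N: "\<And>m n. m \<ge> N \<Longrightarrow> n \<ge> N \<Longrightarrow> (L2_dist M (X m) (X n))\<^sup>2 < e\<^sup>2"
      using cauchy[of "e\<^sup>2"] \<open>e > 0\<close> by auto
    have "(LINT \<omega>|M. norm (X i \<omega> - X j \<omega>)) < e" if "i \<ge> N" "j \<ge> N" for i j
    proof (rule power2_less_imp_less)
      show "(LINT \<omega>|M. norm (X i \<omega> - X j \<omega>))\<^sup>2 < e\<^sup>2"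
        using norm_integral_square_le[OF L2_0_measurable[OF D] L2_0_integrable_square[OF D] L2_0_integrable[OF D], of i j]
          N[OF that] by (simp add: L2_norm_square)
    qed (use \<open>e > 0\<close> in simp)
    then show ?thesis by blast
  qed
  obtain r where r: "strict_mono r" "AE \<omega> in M. Cauchy (\<lambda>i. X (r i) \<omega>)"
    using cauchy_L1_AE_cauchy_subseq[OF L2_0_integrable[OF X] L1] by blast
  define f where "f = (\<lambda>\<omega>. lim (\<lambda>i. X (r i) \<omega>))"
  have f_meas [measurable]: "f \<in> borel_measurable M"
    unfolding f_def by (rule borel_measurable_lim_metric) measurable
  have f_lim: "AE \<omega> in M. (\<lambda>i. X (r i) \<omega>) \<longlonglongrightarrow> f \<omega>"
    using r(2) by eventually_elim (simp add: f_def Cauchy_convergent convergent_LIMSEQ_iff[symmetric])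
  \<comment> \<open>Fatou's lemma turns almost everywhere convergence along the subsequence into convergence in mean square.\<close>
  have fatou: "(\<integral>\<^sup>+\<omega>. ennreal ((norm (X n \<omega> - f \<omega>))\<^sup>2) \<partial>M) \<le> ennreal e"
    if N: "\<And>m. m \<ge> N \<Longrightarrow> (L2_dist M (X n) (X m))\<^sup>2 < e" for n N e
  proof -
    have "(\<integral>\<^sup>+\<omega>. ennreal ((norm (X n \<omega> - f \<omega>))\<^sup>2) \<partial>M) =
        (\<integral>\<^sup>+\<omega>. liminf (\<lambda>i. ennreal ((norm (X n \<omega> - X (r i) \<omega>))\<^sup>2)) \<partial>M)"
    proof (rule nn_integral_cong_AE)
      show "AE \<omega> in M. ennreal ((norm (X n \<omega> - f \<omega>))\<^sup>2) = liminf (\<lambda>i. ennreal ((norm (X n \<omega> - X (r i) \<omega>))\<^sup>2))"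
        using f_lim
      proof eventually_elim
        case (elim \<omega>)
        then have "(\<lambda>i. ennreal ((norm (X n \<omega> - X (r i) \<omega>))\<^sup>2)) \<longlonglongrightarrow> ennreal ((norm (X n \<omega> - f \<omega>))\<^sup>2)"
          by (intro tendsto_ennrealI tendsto_intros)
        then show ?case by (intro lim_imp_Liminf[symmetric]) simp_all
      qed
    qed
    also have "\<dots> \<le> liminf (\<lambda>i. \<integral>\<^sup>+\<omega>. ennreal ((norm (X n \<omega> - X (r i) \<omega>))\<^sup>2) \<partial>M)"
      by (rule nn_integral_liminf) measurable
    also have "\<dots> \<le> ennreal e"
    proof (rule Liminf_le)
      have "(\<integral>\<^sup>+\<omega>. ennreal ((norm (X n \<omega> - X (r i) \<omega>))\<^sup>2) \<partial>M) \<le> ennreal e" if "i \<ge> N" for i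
      proof -
        have "(\<integral>\<^sup>+\<omega>. ennreal ((norm (X n \<omega> - X (r i) \<omega>))\<^sup>2) \<partial>M) = ennreal ((L2_dist M (X n) (X (r i)))\<^sup>2)"
          unfolding L2_norm_square by (rule nn_integral_eq_integral[OF L2_0_integrable_square[OF D]]) simp
        moreover have "r i \<ge> N" using that seq_suble[OF r(1), of i] by linarith
        ultimately show ?thesis using N[of "r i"] by (simp add: ennreal_leI less_imp_le)
      qed
      then show "\<forall>\<^sub>F i in sequentially. (\<integral>\<^sup>+\<omega>. ennreal ((norm (X n \<omega> - X (r i) \<omega>))\<^sup>2) \<partial>M) \<le> ennreal e"
        unfolding eventually_sequentially by blast
    qed simp
    finally show ?thesis .
  qed
  have int: "integrable M (\<lambda>\<omega>. (norm (X n \<omega> - f \<omega>))\<^sup>2)"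
      and le: "(\<integral>\<omega>. (norm (X n \<omega> - f \<omega>))\<^sup>2 \<partial>M) \<le> e"
    if near: "\<And>m. m \<ge> N \<Longrightarrow> (L2_dist M (X n) (X m))\<^sup>2 < e" for n N e
  proof -
    have F: "(\<integral>\<^sup>+\<omega>. ennreal ((norm (X n \<omega> - f \<omega>))\<^sup>2) \<partial>M) \<le> ennreal e"
      using near by (rule fatou)
    have e: "0 \<le> e" using near[of N] zero_le_power2 less_imp_le order_trans by blast
    show i: "integrable M (\<lambda>\<omega>. (norm (X n \<omega> - f \<omega>))\<^sup>2)"
      unfolding integrable_iff_bounded using le_less_trans[OF F ennreal_less_top] by simp
    have "ennreal (\<integral>\<omega>. (norm (X n \<omega> - f \<omega>))\<^sup>2 \<partial>M) \<le> ennreal e"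
      using F nn_integral_eq_integral[OF i] by simp
    then show "(\<integral>\<omega>. (norm (X n \<omega> - f \<omega>))\<^sup>2 \<partial>M) \<le> e" using e by (simp add: ennreal_le_iff)
  qed
  have conv: "(\<lambda>n. (\<integral>\<omega>. (norm (X n \<omega> - f \<omega>))\<^sup>2 \<partial>M)) \<longlonglongrightarrow> 0"
  proof (rule LIMSEQ_I)
    fix e :: real assume "0 < e"
    then obtain N where N: "\<And>m n. m \<ge> N \<Longrightarrow> n \<ge> N \<Longrightarrow> (L2_dist M (X m) (X n))\<^sup>2 < e / 2"
      using cauchy[of "e / 2"] by auto
    have "norm ((\<integral>\<omega>. (norm (X n \<omega> - f \<omega>))\<^sup>2 \<partial>M) - 0) < e" if "n \<ge> N" for n
      using le[of N n "e / 2"] N that \<open>0 < e\<close> by simp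
    then show "\<exists>N. \<forall>n\<ge>N. norm ((\<integral>\<omega>. (norm (X n \<omega> - f \<omega>))\<^sup>2 \<partial>M) - 0) < e" by blast
  qed
  obtain N where N: "\<And>n. n \<ge> N \<Longrightarrow> integrable M (\<lambda>\<omega>. (norm (X n \<omega> - f \<omega>))\<^sup>2)"
    using cauchy[of 1] int by (metis zero_less_one)
  have diff_int: "integrable M (\<lambda>\<omega>. X n \<omega> - f \<omega>)" if "n \<ge> N" for n
    by (rule integrable_of_square[OF _ N[OF that]]) measurable
  have f_int: "integrable M f"
    using Bochner_Integration.integrable_diff[OF L2_0_integrable[OF X] diff_int[OF order_refl], of N] by simp
  have mean: "(\<integral>\<omega>. f \<omega> \<partial>M) = 0"
  proof -
    have le: "(norm (\<integral>\<omega>. f \<omega> \<partial>M))\<^sup>2 \<le> (\<integral>\<omega>. (norm (X n \<omega> - f \<omega>))\<^sup>2 \<partial>M)" if "n \<ge> N" for n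
    proof -
      have "(\<integral>\<omega>. X n \<omega> - f \<omega> \<partial>M) = - (\<integral>\<omega>. f \<omega> \<partial>M)"
        using L2_0_integrable[OF X, of n] f_int X[of n] by (simp add: L2_0_def)
      then have "norm (\<integral>\<omega>. f \<omega> \<partial>M) \<le> (\<integral>\<omega>. norm (X n \<omega> - f \<omega>) \<partial>M)"
        using integral_norm_bound[of M "\<lambda>\<omega>. X n \<omega> - f \<omega>"] by simp
      then have "(norm (\<integral>\<omega>. f \<omega> \<partial>M))\<^sup>2 \<le> (\<integral>\<omega>. norm (X n \<omega> - f \<omega>) \<partial>M)\<^sup>2" by (intro power_mono) simp_all
      also have "\<dots> \<le> (\<integral>\<omega>. (norm (X n \<omega> - f \<omega>))\<^sup>2 \<partial>M)"
        by (intro norm_integral_square_le N that diff_int) measurable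
      finally show ?thesis .
    qed
    have "(norm (\<integral>\<omega>. f \<omega> \<partial>M))\<^sup>2 \<le> 0"
      by (rule LIMSEQ_le_const[OF conv]) (use le in blast)
    then show ?thesis by simp
  qed
  have "integrable M (\<lambda>\<omega>. (norm (f \<omega>))\<^sup>2)"
  proof (rule Bochner_Integration.integrable_bound)
    show "integrable M (\<lambda>\<omega>. 2 * (norm (X N \<omega>))\<^sup>2 + 2 * (norm (X N \<omega> - f \<omega>))\<^sup>2)"
      by (intro Bochner_Integration.integrable_add integrable_mult_right L2_0_integrable_square X N) simp
    have "(norm b)\<^sup>2 \<le> 2 * (norm a)\<^sup>2 + 2 * (norm (a - b))\<^sup>2" for a b :: 'b
    proof -
      have "norm b \<le> norm a + norm (a - b)" using norm_triangle_sub[of b a] by (simp add: norm_minus_commute)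
      then have "(norm b)\<^sup>2 \<le> (norm a + norm (a - b))\<^sup>2" by (intro power_mono) simp_all
      then show ?thesis
        using zero_le_power2[of "norm a - norm (a - b)"] by (simp add: power2_eq_square algebra_simps)
    qed
    then show "AE \<omega> in M. norm ((norm (f \<omega>))\<^sup>2) \<le> norm (2 * (norm (X N \<omega>))\<^sup>2 + 2 * (norm (X N \<omega> - f \<omega>))\<^sup>2)"
      by simp
  qed measurable
  then have "f \<in> L2_0 M" using mean f_meas by (simp add: L2_0_def)
  then show ?thesis using conv by (intro bexI[of _ f]) (simp_all add: L2_norm_square)
qed

lemma L2_0_semi_hilbert:
  "semi_hilbert (L2_0 M :: ('a \<Rightarrow> 'b::{banach, second_countable_topology, complex_inner}) set)
     (\<lambda>s f t g \<omega>. s *\<^sub>C f \<omega> + t *\<^sub>C g \<omega>) (L2_inner M)"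
proof
  fix f g :: "'a \<Rightarrow> 'b" and s t assume f: "f \<in> L2_0 M" and g: "g \<in> L2_0 M"
  show lin: "(\<lambda>\<omega>. s *\<^sub>C f \<omega> + t *\<^sub>C g \<omega>) \<in> L2_0 M" by (intro L2_0_add L2_0_scaleC f g)
  show "L2_inner M (\<lambda>\<omega>. s *\<^sub>C f \<omega> + t *\<^sub>C g \<omega>) h = s * L2_inner M f h + t * L2_inner M g h"
    if h: "h \<in> L2_0 M" for h
    using L2_0_integrable_cinner[OF f h] L2_0_integrable_cinner[OF g h]
    by (simp add: L2_inner_def cinner_add_left cinner_scaleC_left)
  show "L2_inner M g f = cnj (L2_inner M f g)"
    unfolding L2_inner_def by (subst cinner_commute) (rule Bochner_Integration.integral_cnj)
  show "0 \<le> Re (L2_inner M f f)" by (simp add: Re_L2_inner_self f)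
next
  fix X :: "nat \<Rightarrow> 'a \<Rightarrow> 'b"
  assume X: "\<And>n. X n \<in> L2_0 M"
  have D: "Re (L2_inner M (\<lambda>\<omega>. 1 *\<^sub>C f \<omega> + (-1) *\<^sub>C g \<omega>) (\<lambda>\<omega>. 1 *\<^sub>C f \<omega> + (-1) *\<^sub>C g \<omega>))
      = (L2_dist M f g)\<^sup>2" if "f \<in> L2_0 M" "g \<in> L2_0 M" for f g :: "'a \<Rightarrow> 'b"
    using Re_L2_inner_self[OF L2_0_diff[OF that]] by (simp add: complex_vector.scale_minus_left)
  assume "\<And>e. 0 < e \<Longrightarrow> \<exists>N. \<forall>m\<ge>N. \<forall>n\<ge>N. Re (L2_inner M (\<lambda>\<omega>. 1 *\<^sub>C X m \<omega> + (-1) *\<^sub>C X n \<omega>) (\<lambda>\<omega>. 1 *\<^sub>C X m \<omega> + (-1) *\<^sub>C X n \<omega>)) < e"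
  then have "\<And>e. 0 < e \<Longrightarrow> \<exists>N. \<forall>m\<ge>N. \<forall>n\<ge>N. (L2_dist M (X m) (X n))\<^sup>2 < e"
    unfolding D[OF X X] .
  from L2_0_complete[OF X this] obtain f where f: "f \<in> L2_0 M"
    "(\<lambda>n. (L2_dist M (X n) f)\<^sup>2) \<longlonglongrightarrow> 0" by blast
  then show "\<exists>f\<in>L2_0 M. (\<lambda>n. Re (L2_inner M (\<lambda>\<omega>. 1 *\<^sub>C X n \<omega> + (-1) *\<^sub>C f \<omega>) (\<lambda>\<omega>. 1 *\<^sub>C X n \<omega> + (-1) *\<^sub>C f \<omega>))) \<longlonglongrightarrow> 0"
    by (intro bexI[of _ f]) (simp_all only: D[OF X f(1)])
qed

end

section \<open>The Gramian\<close>

context prob_space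
begin

lemma L2_inner_le:
  fixes f g :: "'a \<Rightarrow> 'b::separable_complex_hilbert"
  assumes f: "f \<in> L2_0 M" and g: "g \<in> L2_0 M"
  shows "cmod (L2_inner M f g) \<le> L2_norm M f * L2_norm M g"
proof (rule power2_le_imp_le)
  interpret L2: semi_hilbert "L2_0 M :: ('a \<Rightarrow> 'b) set"
    "\<lambda>s f t g \<omega>. s *\<^sub>C f \<omega> + t *\<^sub>C g \<omega>" "L2_inner M"
    by (rule L2_0_semi_hilbert)
  show "(cmod (L2_inner M f g))\<^sup>2 \<le> (L2_norm M f * L2_norm M g)\<^sup>2"
    using L2.cauchy_schwarz[OF f g] by (simp add: Re_L2_inner_self f g power_mult_distrib)
qed simp

lemma L2_norm_triangle:
  fixes f g :: "'a \<Rightarrow> 'b::separable_complex_hilbert"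
  assumes f: "f \<in> L2_0 M" and g: "g \<in> L2_0 M"
  shows "L2_norm M (\<lambda>\<omega>. f \<omega> + g \<omega>) \<le> L2_norm M f + L2_norm M g"
proof (rule power2_le_imp_le)
  interpret L2: semi_hilbert "L2_0 M :: ('a \<Rightarrow> 'b) set"
    "\<lambda>s f t g \<omega>. s *\<^sub>C f \<omega> + t *\<^sub>C g \<omega>" "L2_inner M"
    by (rule L2_0_semi_hilbert)
  have "(L2_norm M (\<lambda>\<omega>. f \<omega> + g \<omega>))\<^sup>2 = (L2_norm M f)\<^sup>2 + 2 * Re (L2_inner M f g) + (L2_norm M g)\<^sup>2"
    using L2.nsq_lin[OF f g, of 1 1] by (simp add: Re_L2_inner_self f g L2_0_add)
  also have "\<dots> \<le> (L2_norm M f + L2_norm M g)\<^sup>2"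
    using L2_inner_le[OF f g] complex_Re_le_cmod[of "L2_inner M f g"]
    by (simp add: power2_sum)
  finally show "(L2_norm M (\<lambda>\<omega>. f \<omega> + g \<omega>))\<^sup>2 \<le> (L2_norm M f + L2_norm M g)\<^sup>2" .
qed simp

lemma L2_norm_diff_triangle:
  fixes f g h :: "'a \<Rightarrow> 'b::separable_complex_hilbert"
  assumes f: "f \<in> L2_0 M" and g: "g \<in> L2_0 M" and h: "h \<in> L2_0 M"
  shows "L2_dist M f h \<le> L2_dist M f g + L2_dist M g h"
  using L2_norm_triangle[OF L2_0_diff[OF f g] L2_0_diff[OF g h]] by simp

lemma L2_norm_bounded_linear_le:
  fixes f :: "'a \<Rightarrow> 'b::separable_complex_hilbert"
  assumes f: "f \<in> L2_0 M" and a: "bounded_linear a" and K: "0 \<le> K" "\<And>x. norm (a x) \<le> K * norm x"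
  shows "L2_norm M (\<lambda>\<omega>. a (f \<omega>)) \<le> K * L2_norm M f"
proof (rule power2_le_imp_le)
  have "(\<integral>\<omega>. (norm (a (f \<omega>)))\<^sup>2 \<partial>M) \<le> (\<integral>\<omega>. K\<^sup>2 * (norm (f \<omega>))\<^sup>2 \<partial>M)"
    by (intro integral_mono L2_0_integrable_square L2_0_bounded_linear[OF f a] integrable_mult_right f)
      (use power_mono[OF K(2), where n=2] in \<open>simp add: power_mult_distrib\<close>)
  then show "(L2_norm M (\<lambda>\<omega>. a (f \<omega>)))\<^sup>2 \<le> (K * L2_norm M f)\<^sup>2"
    by (simp add: L2_norm_square power_mult_distrib)
qed (use K in simp)

lemma integrable_rank_one:
  fixes f g :: "'a \<Rightarrow> 'b::separable_complex_hilbert"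
  assumes f: "f \<in> L2_0 M" and g: "g \<in> L2_0 M"
  shows "integrable M (\<lambda>\<omega>. rank_one (f \<omega>) (g \<omega>) h)"
proof (rule Bochner_Integration.integrable_bound)
  show "integrable M (\<lambda>\<omega>. norm h * (norm (f \<omega>) * norm (g \<omega>)))"
    by (intro integrable_mult_right L2_0_integrable_norm_mult f g)
  have "cmod (cinner h y) * norm x \<le> norm h * (norm x * norm y)" for x y :: 'b
    using mult_right_mono[OF norm_cinner_le[of h y] norm_ge_zero[of x]] by (simp add: mult_ac)
  then show "AE \<omega> in M. norm (rank_one (f \<omega>) (g \<omega>) h) \<le> norm (norm h * (norm (f \<omega>) * norm (g \<omega>)))"
    by (simp add: rank_one_def abs_mult)
qed (use f g in \<open>simp add: rank_one_def\<close>)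

lemma L2_0_cinner:
  fixes f :: "'a \<Rightarrow> 'b::separable_complex_hilbert"
  assumes "f \<in> L2_0 M" shows "(\<lambda>\<omega>. cinner (f \<omega>) k) \<in> L2_0 M"
  by (rule L2_0_bounded_linear[OF assms bounded_bilinear.bounded_linear_left[OF bounded_bilinear_cinner]])

text \<open>This identity translates between operator-valued Gramians and scalar inner products.\<close>

lemma cinner_gramian:
  fixes f g :: "'a \<Rightarrow> 'b::separable_complex_hilbert"
  assumes f: "f \<in> L2_0 M" and g: "g \<in> L2_0 M"
  shows "cinner (gramian M f g h) k = L2_inner M (\<lambda>\<omega>. cinner (f \<omega>) k) (\<lambda>\<omega>. cinner (g \<omega>) h)"
proof -
  have "cinner (gramian M f g h) k = (\<integral>\<omega>. cinner (rank_one (f \<omega>) (g \<omega>) h) k \<partial>M)"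
    unfolding gramian_def
    by (rule integral_bounded_linear[OF bounded_bilinear.bounded_linear_left[OF bounded_bilinear_cinner]
          integrable_rank_one[OF f g], symmetric])
  also have "\<dots> = (\<integral>\<omega>. cinner (cinner (f \<omega>) k) (cinner (g \<omega>) h) \<partial>M)"
    by (intro Bochner_Integration.integral_cong refl)
      (simp add: rank_one_def cinner_scaleC_left cinner_complex_def cinner_commute[of _ h] mult.commute)
  finally show ?thesis by (simp add: L2_inner_def)
qed

lemma gramian_eqI:
  fixes f g :: "'a \<Rightarrow> 'b::separable_complex_hilbert"
  assumes "\<And>h k. cinner (gramian M f g h) k = cinner (gramian M f' g' h) k"
  shows "gramian M f g = gramian M f' g'"
  by (rule ext, rule cinner_eqI, rule assms)

lemma cmod_cinner_gramian_le:
  fixes f g :: "'a \<Rightarrow> 'b::separable_complex_hilbert"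
  assumes f: "f \<in> L2_0 M" and g: "g \<in> L2_0 M"
  shows "cmod (cinner (gramian M f g h) k) \<le> norm k * L2_norm M f * (norm h * L2_norm M g)"
proof -
  have le: "L2_norm M (\<lambda>\<omega>. cinner (f \<omega>) k) \<le> norm k * L2_norm M f"
    if "f \<in> L2_0 M" for f :: "'a \<Rightarrow> 'b" and k
    using norm_cinner_le[of _ k]
    by (intro L2_norm_bounded_linear_le[OF that bounded_bilinear.bounded_linear_left[OF bounded_bilinear_cinner]])
      (simp_all add: mult.commute)
  have "cmod (cinner (gramian M f g h) k) \<le>
      L2_norm M (\<lambda>\<omega>. cinner (f \<omega>) k) * L2_norm M (\<lambda>\<omega>. cinner (g \<omega>) h)"
    unfolding cinner_gramian[OF f g] by (intro L2_inner_le L2_0_cinner f g)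
  also have "\<dots> \<le> norm k * L2_norm M f * (norm h * L2_norm M g)"
    by (intro mult_mono le f g) simp_all
  finally show ?thesis .
qed

lemma bounded_clinear_gramian:
  fixes f g :: "'a \<Rightarrow> 'b::separable_complex_hilbert"
  assumes f: "f \<in> L2_0 M" and g: "g \<in> L2_0 M"
  shows "bounded_clinear (gramian M f g)"
proof (rule bounded_clinearI[where K = "L2_norm M f * L2_norm M g"])
  note i = integrable_rank_one[OF f g]
  show "gramian M f g (x + y) = gramian M f g x + gramian M f g y" for x y
    using i[of x] i[of y] by (simp add: gramian_def rank_one_def cinner_add_left scaleC_add_left)
  show "gramian M f g (c *\<^sub>C x) = c *\<^sub>C gramian M f g x" for c x
    using integral_bounded_linear[OF bounded_bilinear.bounded_linear_right[OF bounded_bilinear_scaleC] i, of c x]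
    by (simp add: gramian_def rank_one_def cinner_scaleC_left scaleC_scaleC)
  show "norm (gramian M f g x) \<le> L2_norm M f * L2_norm M g * norm x" for x
  proof (cases "gramian M f g x = 0")
    case False
    have "(norm (gramian M f g x))\<^sup>2 \<le> norm (gramian M f g x) * L2_norm M f * (norm x * L2_norm M g)"
      using cmod_cinner_gramian_le[OF f g, of x "gramian M f g x"] by (simp add: cinner_self norm_power)
    then show ?thesis using False by (simp add: power2_eq_square mult_ac)
  qed simp
qed

lemma gramian_diff_left:
  fixes f g :: "'a \<Rightarrow> 'b::separable_complex_hilbert"
  assumes "f \<in> L2_0 M" "f' \<in> L2_0 M" "g \<in> L2_0 M"
  shows "gramian M (\<lambda>\<omega>. f \<omega> - f' \<omega>) g h = gramian M f g h - gramian M f' g h"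
  using integrable_rank_one[of f g h] integrable_rank_one[of f' g h] assms
  by (simp add: gramian_def rank_one_def scaleC_diff_right)

lemma gramian_diff_right:
  fixes f g :: "'a \<Rightarrow> 'b::separable_complex_hilbert"
  assumes "f \<in> L2_0 M" "g \<in> L2_0 M" "g' \<in> L2_0 M"
  shows "gramian M f (\<lambda>\<omega>. g \<omega> - g' \<omega>) h = gramian M f g h - gramian M f g' h"
  using integrable_rank_one[of f g h] integrable_rank_one[of f g' h] assms
  by (simp add: gramian_def rank_one_def cinner_diff_right complex_vector.scale_left_diff_distrib)

lemma gramian_sum_left:
  fixes f :: "'i \<Rightarrow> 'a \<Rightarrow> 'b::separable_complex_hilbert"
  assumes "\<And>i. i \<in> F \<Longrightarrow> f i \<in> L2_0 M" "g \<in> L2_0 M"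
  shows "gramian M (\<lambda>\<omega>. \<Sum>i\<in>F. f i \<omega>) g h = (\<Sum>i\<in>F. gramian M (f i) g h)"
  using integrable_rank_one[OF assms, of _ h] unfolding gramian_def rank_one_def
  by (simp add: complex_vector.scale_sum_right)

lemma gramian_sum_right:
  fixes g :: "'i \<Rightarrow> 'a \<Rightarrow> 'b::separable_complex_hilbert"
  assumes "\<And>i. i \<in> F \<Longrightarrow> g i \<in> L2_0 M" "f \<in> L2_0 M"
  shows "gramian M f (\<lambda>\<omega>. \<Sum>i\<in>F. g i \<omega>) h = (\<Sum>i\<in>F. gramian M f (g i) h)"
  using integrable_rank_one[OF assms(2,1), of _ h] unfolding gramian_def rank_one_def
  by (simp add: cinner_sum_right complex_vector.scale_sum_left)

lemma gramian_op_left: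
  fixes f g :: "'a \<Rightarrow> 'b::separable_complex_hilbert"
  assumes f: "f \<in> L2_0 M" and g: "g \<in> L2_0 M" and a: "bounded_clinear a"
  shows "gramian M (\<lambda>\<omega>. a (f \<omega>)) g h = a (gramian M f g h)"
proof -
  have "bounded_linear a" using a by (simp add: bounded_clinear_def)
  from integral_bounded_linear[OF this integrable_rank_one[OF f g]]
  show ?thesis by (simp add: gramian_def rank_one_def bounded_clinear_scaleC[OF a])
qed

lemma gramian_op_right:
  fixes f g :: "'a \<Rightarrow> 'b::separable_complex_hilbert"
  assumes "bounded_clinear a"
  shows "gramian M f (\<lambda>\<omega>. a (g \<omega>)) h = gramian M f g (adj a h)"
  by (simp add: gramian_def rank_one_def cinner_adj_left[OF assms])

text \<open>Parseval's identity integrated term by term.  Consequently the Gramian determines the norm.\<close>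

lemma L2_norm_square_eq_trace_gramian:
  fixes f :: "'a \<Rightarrow> 'b::separable_complex_hilbert"
  assumes e: "orthonormal_basis e" and f: "f \<in> L2_0 M"
  shows "(\<lambda>n. Re (cinner (gramian M f f (e n)) (e n))) sums (L2_norm M f)\<^sup>2"
proof -
  note c = L2_0_cinner[OF f] and p = parseval[OF e]
  have "(\<lambda>n. \<integral>\<omega>. (cmod (cinner (f \<omega>) (e n)))\<^sup>2 \<partial>M) sums (\<integral>\<omega>. (\<Sum>n. (cmod (cinner (f \<omega>) (e n)))\<^sup>2) \<partial>M)"
  proof (rule sums_integral)
    show "integrable M (\<lambda>\<omega>. (cmod (cinner (f \<omega>) (e n)))\<^sup>2)" for n by (rule L2_0_integrable_square[OF c])
    show "AE \<omega> in M. summable (\<lambda>n. norm ((cmod (cinner (f \<omega>) (e n)))\<^sup>2))"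
      using sums_summable[OF p] by simp
    have "(\<Sum>n<N. \<integral>\<omega>. (cmod (cinner (f \<omega>) (e n)))\<^sup>2 \<partial>M) \<le> (\<integral>\<omega>. (norm (f \<omega>))\<^sup>2 \<partial>M)" for N
    proof -
      have "(\<Sum>n<N. \<integral>\<omega>. (cmod (cinner (f \<omega>) (e n)))\<^sup>2 \<partial>M) = (\<integral>\<omega>. (\<Sum>n<N. (cmod (cinner (f \<omega>) (e n)))\<^sup>2) \<partial>M)"
        by (rule Bochner_Integration.integral_sum[symmetric]) (rule L2_0_integrable_square[OF c])
      also have "\<dots> \<le> (\<integral>\<omega>. (norm (f \<omega>))\<^sup>2 \<partial>M)"
        by (intro integral_mono Bochner_Integration.integrable_sum L2_0_integrable_square c f bessel)
          (simp_all add: basis_orthonormal[OF e])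
      finally show ?thesis .
    qed
    then show "summable (\<lambda>n. \<integral>\<omega>. norm ((cmod (cinner (f \<omega>) (e n)))\<^sup>2) \<partial>M)"
      by (intro summableI_nonneg_bounded) auto
  qed
  moreover have "(\<Sum>n. (cmod (cinner x (e n)))\<^sup>2) = (norm x)\<^sup>2" for x by (rule sums_unique[OF p, symmetric])
  moreover have "Re (cinner (gramian M f f (e n)) (e n)) = (\<integral>\<omega>. (cmod (cinner (f \<omega>) (e n)))\<^sup>2 \<partial>M)" for n
    by (simp add: cinner_gramian[OF f f] Re_L2_inner_self[OF c] L2_norm_square)
  ultimately show ?thesis by (simp add: L2_norm_square)
qed

end

section \<open>Gramian unitary equivalence\<close>

text \<open>The graph of the map that sends a combination of values of \<open>\<Phi>\<close> to the same combination of values of \<open>\<Psi>\<close>.\<close>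

definition combination_pairs ::
  "('l \<Rightarrow> 'w \<Rightarrow> 'h::separable_complex_hilbert) \<Rightarrow> ('l \<Rightarrow> 'w \<Rightarrow> 'h) \<Rightarrow> (('w \<Rightarrow> 'h) \<times> ('w \<Rightarrow> 'h)) set" where
  "combination_pairs \<Phi> \<Psi> =
     {(\<lambda>\<omega>. \<Sum>i<m. a i (\<Phi> (l i) \<omega>), \<lambda>\<omega>. \<Sum>i<m. a i (\<Psi> (l i) \<omega>)) | (m::nat) a l.
        \<forall>i<m. bounded_clinear (a i)}"

lemma combination_pairsI:
  fixes m :: nat
  assumes "\<And>i. i < m \<Longrightarrow> bounded_clinear (a i)"
  shows "(\<lambda>\<omega>. \<Sum>i<m. a i (\<Phi> (l i) \<omega>), \<lambda>\<omega>. \<Sum>i<m. a i (\<Psi> (l i) \<omega>)) \<in> combination_pairs \<Phi> \<Psi>"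
proof -
  have "\<forall>i<m. bounded_clinear (a i)" using assms by simp
  then show ?thesis unfolding combination_pairs_def by blast
qed

lemma combination_pairsE:
  assumes "(x, y) \<in> combination_pairs \<Phi> \<Psi>"
  obtains m :: nat and a l where "\<And>i. i < m \<Longrightarrow> bounded_clinear (a i)"
    "x = (\<lambda>\<omega>. \<Sum>i<m. a i (\<Phi> (l i) \<omega>))" "y = (\<lambda>\<omega>. \<Sum>i<m. a i (\<Psi> (l i) \<omega>))"
  using assms unfolding combination_pairs_def by blast

lemma combination_pairs_swap: "(x, y) \<in> combination_pairs \<Phi> \<Psi> \<Longrightarrow> (y, x) \<in> combination_pairs \<Psi> \<Phi>"
  by (elim combination_pairsE) (auto intro: combination_pairsI)

lemma combination_pairs_fst: "(x, y) \<in> combination_pairs \<Phi> \<Psi> \<Longrightarrow> x \<in> module_combinations \<Phi>"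
  unfolding combination_pairs_def module_combinations_def by fast

lemma combination_pairs_total: "x \<in> module_combinations \<Phi> \<Longrightarrow> \<exists>y. (x, y) \<in> combination_pairs \<Phi> \<Psi>"
  unfolding module_combinations_def by (fastforce intro: combination_pairsI)

lemma combination_pairs_base: "(\<Phi> l, \<Psi> l) \<in> combination_pairs \<Phi> \<Psi>"
  using combination_pairsI[of 1 "\<lambda>_ x. x" \<Phi> "\<lambda>_. l" \<Psi>] by (simp add: bounded_clinear_id)

lemma combination_pairs_op:
  assumes b: "bounded_clinear b" and xy: "(x, y) \<in> combination_pairs \<Phi> \<Psi>"
  shows "(\<lambda>\<omega>. b (x \<omega>), \<lambda>\<omega>. b (y \<omega>)) \<in> combination_pairs \<Phi> \<Psi>"
proof -
  obtain m :: nat and a l where a: "\<And>i. i < m \<Longrightarrow> bounded_clinear (a i)"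
    and x: "x = (\<lambda>\<omega>. \<Sum>i<m. a i (\<Phi> (l i) \<omega>))" and y: "y = (\<lambda>\<omega>. \<Sum>i<m. a i (\<Psi> (l i) \<omega>))"
    using xy by (rule combination_pairsE) (rule that; simp)
  show ?thesis
    using combination_pairsI[of m "\<lambda>i z. b (a i z)" \<Phi> l \<Psi>] a
    by (simp add: x y bounded_clinear_compose[OF b] bounded_clinear_sum[OF b])
qed

lemma combination_pairs_add:
  assumes xy: "(x, y) \<in> combination_pairs \<Phi> \<Psi>" and xy': "(x', y') \<in> combination_pairs \<Phi> \<Psi>"
  shows "(\<lambda>\<omega>. x \<omega> + x' \<omega>, \<lambda>\<omega>. y \<omega> + y' \<omega>) \<in> combination_pairs \<Phi> \<Psi>"
proof -
  obtain m :: nat and a l where a: "\<And>i. i < m \<Longrightarrow> bounded_clinear (a i)"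
    and x: "x = (\<lambda>\<omega>. \<Sum>i<m. a i (\<Phi> (l i) \<omega>))" and y: "y = (\<lambda>\<omega>. \<Sum>i<m. a i (\<Psi> (l i) \<omega>))"
    using xy by (rule combination_pairsE) (rule that; simp)
  obtain m' :: nat and a' l' where a': "\<And>i. i < m' \<Longrightarrow> bounded_clinear (a' i)"
    and x': "x' = (\<lambda>\<omega>. \<Sum>i<m'. a' i (\<Phi> (l' i) \<omega>))" and y': "y' = (\<lambda>\<omega>. \<Sum>i<m'. a' i (\<Psi> (l' i) \<omega>))"
    using xy' by (rule combination_pairsE) (rule that; simp)
  define b k where "b = (\<lambda>i. if i < m then a i else a' (i - m))" and "k = (\<lambda>i. if i < m then l i else l' (i - m))"
  have split: "(\<Sum>i<m + m'. b i (\<Theta> (k i) \<omega>)) = (\<Sum>i<m. a i (\<Theta> (l i) \<omega>)) + (\<Sum>i<m'. a' i (\<Theta> (l' i) \<omega>))"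
    for \<Theta> and \<omega>
  proof -
    have "(\<Sum>i<m + n. b i (\<Theta> (k i) \<omega>)) = (\<Sum>i<m. b i (\<Theta> (k i) \<omega>)) + (\<Sum>i<n. b (m + i) (\<Theta> (k (m + i)) \<omega>))" for n
      by (induction n) (simp_all add: add.assoc)
    then show ?thesis by (simp add: b_def k_def)
  qed
  have "bounded_clinear (b i)" if "i < m + m'" for i
    using that a a' by (auto simp: b_def)
  from combination_pairsI[of "m + m'" b \<Phi> k \<Psi>, OF this]
  show ?thesis by (simp add: split x x' y y')
qed

lemma combination_pairs_diff:
  assumes "(x, y) \<in> combination_pairs \<Phi> \<Psi>" "(x', y') \<in> combination_pairs \<Phi> \<Psi>"
  shows "(\<lambda>\<omega>. x \<omega> - x' \<omega>, \<lambda>\<omega>. y \<omega> - y' \<omega>) \<in> combination_pairs \<Phi> \<Psi>"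
  using combination_pairs_add[OF assms(1)
      combination_pairs_op[OF bounded_clinear_minus[OF bounded_clinear_0 bounded_clinear_id] assms(2)]]
  by simp

context prob_space
begin

text \<open>The closure of that graph.  Working with the closed relation avoids any choice of representatives until the
  operator is extracted from it.\<close>

definition matched ::
  "('l \<Rightarrow> 'a \<Rightarrow> 'h::separable_complex_hilbert) \<Rightarrow> ('l \<Rightarrow> 'a \<Rightarrow> 'h) \<Rightarrow> ('a \<Rightarrow> 'h) \<Rightarrow> ('a \<Rightarrow> 'h) \<Rightarrow> bool" where
  "matched \<Phi> \<Psi> f g \<longleftrightarrow> f \<in> L2_0 M \<and> g \<in> L2_0 M \<and>
     (\<exists>X Y. (\<forall>n. (X n, Y n) \<in> combination_pairs \<Phi> \<Psi>) \<and>
        L2_tendsto M X f \<and> L2_tendsto M Y g)"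

lemma matched_swap: "matched \<Phi> \<Psi> f g \<Longrightarrow> matched \<Psi> \<Phi> g f"
  unfolding matched_def using combination_pairs_swap by blast

lemma gramian_tendsto:
  fixes f g :: "'a \<Rightarrow> 'h::separable_complex_hilbert"
  assumes X: "\<And>n. X n \<in> L2_0 M" "f \<in> L2_0 M" "L2_tendsto M X f"
    and Y: "\<And>n. Y n \<in> L2_0 M" "g \<in> L2_0 M" "L2_tendsto M Y g"
  shows "(\<lambda>n. cinner (gramian M (X n) (Y n) h) k) \<longlonglongrightarrow> cinner (gramian M f g h) k"
proof -
  define p q where "p = (\<lambda>n. L2_dist M (X n) f)" and "q = (\<lambda>n. L2_dist M (Y n) g)"
  have le: "cmod (cinner (gramian M (X n) (Y n) h) k - cinner (gramian M f g h) k) \<le>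
      norm k * p n * (norm h * (q n + L2_norm M g)) + norm k * L2_norm M f * (norm h * q n)" for n
  proof -
    have "L2_norm M (Y n) \<le> q n + L2_norm M g"
      using L2_norm_triangle[OF L2_0_diff[OF Y(1,2)] Y(2), of n] by (simp add: q_def)
    then have "norm k * p n * (norm h * L2_norm M (Y n)) \<le> norm k * p n * (norm h * (q n + L2_norm M g))"
      by (intro mult_left_mono) (simp_all add: p_def)
    moreover have "cmod (cinner (gramian M (\<lambda>\<omega>. X n \<omega> - f \<omega>) (Y n) h) k) \<le> norm k * p n * (norm h * L2_norm M (Y n))"
      unfolding p_def by (intro cmod_cinner_gramian_le L2_0_diff X Y)
    moreover have "cmod (cinner (gramian M f (\<lambda>\<omega>. Y n \<omega> - g \<omega>) h) k) \<le> norm k * L2_norm M f * (norm h * q n)"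
      unfolding q_def by (intro cmod_cinner_gramian_le L2_0_diff X Y)
    moreover have eq: "cinner (gramian M (X n) (Y n) h) k - cinner (gramian M f g h) k =
        cinner (gramian M (\<lambda>\<omega>. X n \<omega> - f \<omega>) (Y n) h) k + cinner (gramian M f (\<lambda>\<omega>. Y n \<omega> - g \<omega>) h) k"
      by (simp add: gramian_diff_left gramian_diff_right X Y cinner_diff_left)
    ultimately show ?thesis
      unfolding eq using norm_triangle_ineq[of "cinner (gramian M (\<lambda>\<omega>. X n \<omega> - f \<omega>) (Y n) h) k"
          "cinner (gramian M f (\<lambda>\<omega>. Y n \<omega> - g \<omega>) h) k"] by linarith
  qed
  have "p \<longlonglongrightarrow> 0" "q \<longlonglongrightarrow> 0" using X Y by (simp_all add: p_def q_def)
  then have "(\<lambda>n. norm k * p n * (norm h * (q n + L2_norm M g)) + norm k * L2_norm M f * (norm h * q n))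
      \<longlonglongrightarrow> norm k * 0 * (norm h * (0 + L2_norm M g)) + norm k * L2_norm M f * (norm h * 0)"
    by (intro tendsto_intros)
  then have lim: "(\<lambda>n. norm k * p n * (norm h * (q n + L2_norm M g)) + norm k * L2_norm M f * (norm h * q n))
      \<longlonglongrightarrow> 0" by simp
  have "(\<lambda>n. cmod (cinner (gramian M (X n) (Y n) h) k - cinner (gramian M f g h) k)) \<longlonglongrightarrow> 0"
    by (rule tendsto_sandwich[OF always_eventually always_eventually tendsto_const lim])
      (use le in simp_all)
  then show ?thesis by (rule LIM_zero_cancel[OF tendsto_norm_zero_cancel])
qed

context
  fixes \<Phi> \<Psi> :: "'l \<Rightarrow> 'a \<Rightarrow> 'h::separable_complex_hilbert" and e :: "nat \<Rightarrow> 'h"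
  assumes \<Phi>: "stochastic_mapping M \<Phi>" and \<Psi>: "stochastic_mapping M \<Psi>"
    and cov: "op_covariance M \<Phi> = op_covariance M \<Psi>" and e: "orthonormal_basis e"
begin

lemma L2_0_combination:
  fixes m :: nat
  assumes \<Theta>: "stochastic_mapping M \<Theta>" and a: "\<And>i. i < m \<Longrightarrow> bounded_clinear (a i)"
  shows "(\<lambda>\<omega>. \<Sum>i<m. a i (\<Theta> (l i) \<omega>)) \<in> L2_0 M"
proof (rule L2_0_sum)
  fix i assume "i \<in> {..<m}"
  then have "bounded_linear (a i)" using a by (simp add: bounded_clinear_def)
  then show "(\<lambda>\<omega>. a i (\<Theta> (l i) \<omega>)) \<in> L2_0 M"
    by (rule L2_0_bounded_linear[rotated]) (use \<Theta> in \<open>simp add: stochastic_mapping_def\<close>)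
qed

lemma combination_pairs_L2_0:
  assumes "(x, y) \<in> combination_pairs \<Phi> \<Psi>"
  shows "x \<in> L2_0 M" "y \<in> L2_0 M"
proof -
  obtain m :: nat and a l where a: "\<And>i. i < m \<Longrightarrow> bounded_clinear (a i)"
    and x: "x = (\<lambda>\<omega>. \<Sum>i<m. a i (\<Phi> (l i) \<omega>))" and y: "y = (\<lambda>\<omega>. \<Sum>i<m. a i (\<Psi> (l i) \<omega>))"
    using assms by (rule combination_pairsE) (rule that; simp)
  show "x \<in> L2_0 M" "y \<in> L2_0 M"
    unfolding x y by (intro L2_0_combination \<Phi> \<Psi> a; assumption)+
qed

text \<open>By sesquilinearity both sides are $\sum_{i,j} a_i\Gamma(\lambda_i,\lambda'_j)a_j'^*$.\<close>

lemma combination_pairs_gramian: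
  assumes xy: "(x, y) \<in> combination_pairs \<Phi> \<Psi>" and xy': "(x', y') \<in> combination_pairs \<Phi> \<Psi>"
  shows "gramian M x x' = gramian M y y'"
proof
  fix h
  obtain m :: nat and a l where a: "\<And>i. i < m \<Longrightarrow> bounded_clinear (a i)"
    and x: "x = (\<lambda>\<omega>. \<Sum>i<m. a i (\<Phi> (l i) \<omega>))" and y: "y = (\<lambda>\<omega>. \<Sum>i<m. a i (\<Psi> (l i) \<omega>))"
    using xy by (rule combination_pairsE) (rule that; simp)
  obtain m' :: nat and a' l' where a': "\<And>i. i < m' \<Longrightarrow> bounded_clinear (a' i)"
    and x': "x' = (\<lambda>\<omega>. \<Sum>i<m'. a' i (\<Phi> (l' i) \<omega>))" and y': "y' = (\<lambda>\<omega>. \<Sum>i<m'. a' i (\<Psi> (l' i) \<omega>))"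
    using xy' by (rule combination_pairsE) (rule that; simp)
  have expand: "gramian M (\<lambda>\<omega>. \<Sum>i<m. a i (\<Theta> (l i) \<omega>)) (\<lambda>\<omega>. \<Sum>j<m'. a' j (\<Theta> (l' j) \<omega>)) h =
      (\<Sum>i<m. \<Sum>j<m'. a i (op_covariance M \<Theta> (l i) (l' j) (adj (a' j) h)))"
    if \<Theta>: "stochastic_mapping M \<Theta>" for \<Theta>
  proof -
    have mem: "\<Theta> k \<in> L2_0 M" for k using \<Theta> by (simp add: stochastic_mapping_def)
    have mem_a: "(\<lambda>\<omega>. a i (\<Theta> k \<omega>)) \<in> L2_0 M" if "i < m" for i k
      using a[OF that] by (intro L2_0_bounded_linear[OF mem]) (simp add: bounded_clinear_def)
    have mem_a': "(\<lambda>\<omega>. a' i (\<Theta> k \<omega>)) \<in> L2_0 M" if "i < m'" for i k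
      using a'[OF that] by (intro L2_0_bounded_linear[OF mem]) (simp add: bounded_clinear_def)
    have "gramian M (\<lambda>\<omega>. \<Sum>i<m. a i (\<Theta> (l i) \<omega>)) (\<lambda>\<omega>. \<Sum>j<m'. a' j (\<Theta> (l' j) \<omega>)) h =
        (\<Sum>i<m. gramian M (\<lambda>\<omega>. a i (\<Theta> (l i) \<omega>)) (\<lambda>\<omega>. \<Sum>j<m'. a' j (\<Theta> (l' j) \<omega>)) h)"
      by (rule gramian_sum_left) (auto intro: mem_a L2_0_combination[OF \<Theta> a'])
    also have "\<dots> = (\<Sum>i<m. \<Sum>j<m'. gramian M (\<lambda>\<omega>. a i (\<Theta> (l i) \<omega>)) (\<lambda>\<omega>. a' j (\<Theta> (l' j) \<omega>)) h)"
      by (intro sum.cong refl gramian_sum_right) (auto intro: mem_a mem_a')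
    also have "\<dots> = (\<Sum>i<m. \<Sum>j<m'. a i (op_covariance M \<Theta> (l i) (l' j) (adj (a' j) h)))"
      by (intro sum.cong refl)
        (simp add: op_covariance_def a a' gramian_op_right gramian_op_left mem)
    finally show ?thesis .
  qed
  show "gramian M x x' h = gramian M y y' h"
    unfolding x x' y y' expand[OF \<Phi>] expand[OF \<Psi>] cov ..
qed

lemma matched_gramian:
  assumes fg: "matched \<Phi> \<Psi> f g" and fg': "matched \<Phi> \<Psi> f' g'"
  shows "gramian M f f' = gramian M g g'"
proof (rule gramian_eqI)
  fix h k
  obtain X Y where XY: "\<And>n. (X n, Y n) \<in> combination_pairs \<Phi> \<Psi>"
    "L2_tendsto M X f" "L2_tendsto M Y g"
    using fg unfolding matched_def by blast
  obtain X' Y' where XY': "\<And>n. (X' n, Y' n) \<in> combination_pairs \<Phi> \<Psi>"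
    "L2_tendsto M X' f'" "L2_tendsto M Y' g'"
    using fg' unfolding matched_def by blast
  have mem: "f \<in> L2_0 M" "g \<in> L2_0 M" "f' \<in> L2_0 M" "g' \<in> L2_0 M"
    using fg fg' by (auto simp: matched_def)
  note L = combination_pairs_L2_0[OF XY(1)] and L' = combination_pairs_L2_0[OF XY'(1)]
  have "(\<lambda>n. cinner (gramian M (X n) (X' n) h) k) \<longlonglongrightarrow> cinner (gramian M f f' h) k"
    by (rule gramian_tendsto[OF L(1) mem(1) XY(2) L'(1) mem(3) XY'(2)])
  moreover have "(\<lambda>n. cinner (gramian M (Y n) (Y' n) h) k) \<longlonglongrightarrow> cinner (gramian M g g' h) k"
    by (rule gramian_tendsto[OF L(2) mem(2) XY(3) L'(2) mem(4) XY'(3)])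
  ultimately show "cinner (gramian M f f' h) k = cinner (gramian M g g' h) k"
    unfolding combination_pairs_gramian[OF XY(1) XY'(1)] by (rule LIMSEQ_unique)
qed

lemma L2_norm_eq_of_gramian_eq:
  fixes f g :: "'a \<Rightarrow> 'h"
  assumes "f \<in> L2_0 M" "g \<in> L2_0 M" "gramian M f f = gramian M g g"
  shows "L2_norm M f = L2_norm M g"
  using L2_norm_square_eq_trace_gramian[OF e assms(1)] L2_norm_square_eq_trace_gramian[OF e assms(2)] assms(3)
  by (metis L2_norm_nonneg power2_eq_iff_nonneg sums_unique2)

lemma matched_op:
  assumes fg: "matched \<Phi> \<Psi> f g" and a: "bounded_clinear a"
  shows "matched \<Phi> \<Psi> (\<lambda>\<omega>. a (f \<omega>)) (\<lambda>\<omega>. a (g \<omega>))"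
proof -
  obtain X Y where XY: "\<And>n. (X n, Y n) \<in> combination_pairs \<Phi> \<Psi>"
    "L2_tendsto M X f" "L2_tendsto M Y g"
    and mem: "f \<in> L2_0 M" "g \<in> L2_0 M"
    using fg unfolding matched_def by blast
  have bl: "bounded_linear a" using a by (simp add: bounded_clinear_def)
  obtain K where K: "K > 0" "\<And>x. norm (a x) \<le> K * norm x" using bounded_clinear_bounded[OF a] by blast
  have lim: "(\<lambda>n. L2_norm M (\<lambda>\<omega>. a (Z n \<omega>) - a (z \<omega>))) \<longlonglongrightarrow> 0"
    if Z: "\<And>n. Z n \<in> L2_0 M" "z \<in> L2_0 M" "L2_tendsto M Z z" for Z z
  proof (rule tendsto_sandwich[OF always_eventually always_eventually tendsto_const])
    show "(\<lambda>n. K * L2_dist M (Z n) z) \<longlonglongrightarrow> 0"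
      using tendsto_mult_left[OF Z(3), of K] by simp
    show "\<forall>n. L2_norm M (\<lambda>\<omega>. a (Z n \<omega>) - a (z \<omega>)) \<le> K * L2_dist M (Z n) z"
      using L2_norm_bounded_linear_le[OF L2_0_diff[OF Z(1,2)] bl _ K(2)] K(1)
      by (simp add: bounded_clinear_diff[OF a])
  qed simp
  show ?thesis
    unfolding matched_def
    using L2_0_bounded_linear[OF mem(1) bl] L2_0_bounded_linear[OF mem(2) bl]
      combination_pairs_op[OF a XY(1)] lim[OF combination_pairs_L2_0(1)[OF XY(1)] mem(1) XY(2)]
      lim[OF combination_pairs_L2_0(2)[OF XY(1)] mem(2) XY(3)]
    by (intro conjI exI[of _ "\<lambda>n \<omega>. a (X n \<omega>)"] exI[of _ "\<lambda>n \<omega>. a (Y n \<omega>)"]) auto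
qed

lemma matched_add:
  assumes fg: "matched \<Phi> \<Psi> f g" and fg': "matched \<Phi> \<Psi> f' g'"
  shows "matched \<Phi> \<Psi> (\<lambda>\<omega>. f \<omega> + f' \<omega>) (\<lambda>\<omega>. g \<omega> + g' \<omega>)"
proof -
  obtain X Y where XY: "\<And>n. (X n, Y n) \<in> combination_pairs \<Phi> \<Psi>"
    "L2_tendsto M X f" "L2_tendsto M Y g"
    using fg unfolding matched_def by blast
  obtain X' Y' where XY': "\<And>n. (X' n, Y' n) \<in> combination_pairs \<Phi> \<Psi>"
    "L2_tendsto M X' f'" "L2_tendsto M Y' g'"
    using fg' unfolding matched_def by blast
  have mem: "f \<in> L2_0 M" "g \<in> L2_0 M" "f' \<in> L2_0 M" "g' \<in> L2_0 M"
    using fg fg' by (auto simp: matched_def)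
  note L = combination_pairs_L2_0[OF XY(1)] and L' = combination_pairs_L2_0[OF XY'(1)]
  have lim: "(\<lambda>n. L2_norm M (\<lambda>\<omega>. Z n \<omega> + Z' n \<omega> - (z \<omega> + z' \<omega>))) \<longlonglongrightarrow> 0"
    if Z: "\<And>n. Z n \<in> L2_0 M" "z \<in> L2_0 M" "L2_tendsto M Z z"
      and Z': "\<And>n. Z' n \<in> L2_0 M" "z' \<in> L2_0 M" "L2_tendsto M Z' z'"
    for Z Z' :: "nat \<Rightarrow> 'a \<Rightarrow> 'h" and z z'
  proof (rule tendsto_sandwich[OF always_eventually always_eventually tendsto_const])
    show "(\<lambda>n. L2_dist M (Z n) z + L2_dist M (Z' n) z') \<longlonglongrightarrow> 0"
      using tendsto_add[OF Z(3) Z'(3)] by simp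
    show "\<forall>n. L2_norm M (\<lambda>\<omega>. Z n \<omega> + Z' n \<omega> - (z \<omega> + z' \<omega>)) \<le>
        L2_dist M (Z n) z + L2_dist M (Z' n) z'"
      using L2_norm_triangle[OF L2_0_diff[OF Z(1,2)] L2_0_diff[OF Z'(1,2)]] by (simp add: algebra_simps)
  qed simp
  show ?thesis
    unfolding matched_def
    using L2_0_add[OF mem(1,3)] L2_0_add[OF mem(2,4)] combination_pairs_add[OF XY(1) XY'(1)]
      lim[OF L(1) mem(1) XY(2) L'(1) mem(3) XY'(2)] lim[OF L(2) mem(2) XY(3) L'(2) mem(4) XY'(3)]
    by (intro conjI exI[of _ "\<lambda>n \<omega>. X n \<omega> + X' n \<omega>"] exI[of _ "\<lambda>n \<omega>. Y n \<omega> + Y' n \<omega>"]) auto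
qed

text \<open>The difference of two pairs is matched, so $g-g'$ has the Gramian, hence the norm, of $f-f'$.\<close>

lemma matched_AE_unique:
  assumes fg: "matched \<Phi> \<Psi> f g" and fg': "matched \<Phi> \<Psi> f' g'" and ae: "AE \<omega> in M. f \<omega> = f' \<omega>"
  shows "AE \<omega> in M. g \<omega> = g' \<omega>"
proof -
  have diff: "matched \<Phi> \<Psi> (\<lambda>\<omega>. f \<omega> - f' \<omega>) (\<lambda>\<omega>. g \<omega> - g' \<omega>)"
    using matched_add[OF fg matched_op[OF fg' bounded_clinear_minus[OF bounded_clinear_0 bounded_clinear_id]]]
    by simp
  have eq: "gramian M (\<lambda>\<omega>. f \<omega> - f' \<omega>) (\<lambda>\<omega>. f \<omega> - f' \<omega>) = gramian M (\<lambda>\<omega>. g \<omega> - g' \<omega>) (\<lambda>\<omega>. g \<omega> - g' \<omega>)"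
    and mem: "(\<lambda>\<omega>. f \<omega> - f' \<omega>) \<in> L2_0 M" "(\<lambda>\<omega>. g \<omega> - g' \<omega>) \<in> L2_0 M"
    using matched_gramian[OF diff diff] diff by (simp_all add: matched_def)
  have "(\<integral>\<omega>. (norm (f \<omega> - f' \<omega>))\<^sup>2 \<partial>M) = 0"
    by (rule integral_eq_zero_AE) (use ae in auto)
  then have "L2_dist M f f' = 0" by (simp add: L2_norm_def)
  then have "L2_dist M g g' = 0"
    using L2_norm_eq_of_gramian_eq[OF mem eq] by simp
  then have "AE \<omega> in M. g \<omega> - g' \<omega> = 0" by (rule L2_norm_eq_0D[OF mem(2)])
  then show ?thesis by simp
qed

lemma matched_modular_domain:
  assumes "matched \<Phi> \<Psi> f g" shows "f \<in> modular_domain M \<Phi>"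
proof -
  obtain X Y where XY: "\<And>n. (X n, Y n) \<in> combination_pairs \<Phi> \<Psi>"
    "L2_tendsto M X f" and f: "f \<in> L2_0 M"
    using assms unfolding matched_def by blast
  have "\<exists>x\<in>module_combinations \<Phi>. L2_dist M f x < \<epsilon>" if "\<epsilon> > 0" for \<epsilon>
  proof -
    have "\<forall>\<^sub>F n in sequentially. L2_dist M (X n) f < \<epsilon>"
      using order_tendstoD(2)[OF XY(2) that] .
    then obtain n where "L2_dist M (X n) f < \<epsilon>"
      by (auto simp: eventually_sequentially)
    then show ?thesis
      using combination_pairs_fst[OF XY(1)] by (auto simp: L2_norm_minus_commute[of M f])
  qed
  then show ?thesis using f by (auto simp: modular_domain_def)
qed

text \<open>Approximate \<open>f\<close> by combinations.  The corresponding combinations of \<open>\<Psi>\<close> have the same distances, so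
  they form a Cauchy sequence.\<close>

lemma matched_total:
  assumes f: "f \<in> modular_domain M \<Phi>" shows "\<exists>g. matched \<Phi> \<Psi> f g"
proof -
  have fL: "f \<in> L2_0 M" using f by (simp add: modular_domain_def)
  have "\<exists>x y. (x, y) \<in> combination_pairs \<Phi> \<Psi> \<and> L2_dist M f x < 1 / Suc n" for n
  proof -
    have "\<exists>x\<in>module_combinations \<Phi>. L2_dist M f x < 1 / Suc n"
      using f by (simp add: modular_domain_def)
    then show ?thesis using combination_pairs_total by blast
  qed
  then obtain X Y where XY: "\<And>n. (X n, Y n) \<in> combination_pairs \<Phi> \<Psi>"
    and near: "\<And>n. L2_dist M f (X n) < 1 / Suc n" by metis
  note L = combination_pairs_L2_0[OF XY]
  have isom: "L2_dist M (Y m) (Y n) = L2_dist M (X m) (X n)" for m n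
    using combination_pairs_diff[OF XY XY, of m n] L
    by (intro L2_norm_eq_of_gramian_eq L2_0_diff combination_pairs_gramian[symmetric])
  have close: "L2_dist M (X m) (X n) \<le> 1 / Suc m + 1 / Suc n" for m n
    using L2_norm_diff_triangle[OF L(1) fL L(1), of m n] near[of m] near[of n]
    by (simp add: L2_norm_minus_commute[of M f])
  have "\<exists>g\<in>L2_0 M. (\<lambda>n. (L2_dist M (Y n) g)\<^sup>2) \<longlonglongrightarrow> 0"
  proof (rule L2_0_complete[OF L(2)])
    fix \<epsilon> :: real assume "0 < \<epsilon>"
    then obtain N where N: "2 / sqrt \<epsilon> < real N" using reals_Archimedean2 by blast
    have "(L2_dist M (Y m) (Y n))\<^sup>2 < \<epsilon>" if "m \<ge> N" "n \<ge> N" for m n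
    proof -
      have small: "1 / Suc k < sqrt \<epsilon> / 2" if "k \<ge> N" for k
      proof -
        have "2 / sqrt \<epsilon> < Suc k" using N that by linarith
        then show ?thesis using \<open>0 < \<epsilon>\<close> by (simp add: field_simps)
      qed
      have "L2_dist M (Y m) (Y n) < sqrt \<epsilon>"
        using close[of m n] small[of m] small[of n] that unfolding isom by linarith
      then have "(L2_dist M (Y m) (Y n))\<^sup>2 < (sqrt \<epsilon>)\<^sup>2" by (intro power_strict_mono) simp_all
      then show ?thesis using \<open>0 < \<epsilon>\<close> by simp
    qed
    then show "\<exists>N. \<forall>m\<ge>N. \<forall>n\<ge>N. (L2_dist M (Y m) (Y n))\<^sup>2 < \<epsilon>" by blast
  qed
  then obtain g where g: "g \<in> L2_0 M" "(\<lambda>n. (L2_dist M (Y n) g)\<^sup>2) \<longlonglongrightarrow> 0" by blast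
  from tendsto_real_sqrt[OF g(2)] have Yg: "L2_tendsto M Y g" by simp
  have Xf: "L2_tendsto M X f"
  proof (rule tendsto_sandwich[OF always_eventually always_eventually tendsto_const])
    show "(\<lambda>n. 1 / real (Suc n)) \<longlonglongrightarrow> 0" by (rule LIMSEQ_Suc[OF lim_1_over_n])
    show "\<forall>n. L2_dist M (X n) f \<le> 1 / real (Suc n)"
      using near by (simp add: L2_norm_minus_commute[of M _ f] less_imp_le)
  qed simp
  show ?thesis using fL g(1) XY Xf Yg unfolding matched_def by blast
qed

lemma matched_base: "matched \<Phi> \<Psi> (\<Phi> l) (\<Psi> l)"
proof -
  have "L2_dist M f f = 0" for f :: "'a \<Rightarrow> 'h" by (simp add: L2_norm_def)
  then show ?thesis
    using combination_pairs_base[of \<Phi> l \<Psi>] \<Phi> \<Psi> unfolding matched_def stochastic_mapping_def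
    by (intro conjI exI[of _ "\<lambda>_. \<Phi> l"] exI[of _ "\<lambda>_. \<Psi> l"]) auto
qed

end

theorem gramian_unitary_equivalence:
  fixes \<Phi> \<Psi> :: "'l \<Rightarrow> 'a \<Rightarrow> 'h::separable_complex_hilbert" and e :: "nat \<Rightarrow> 'h"
  assumes \<Phi>: "stochastic_mapping M \<Phi>" and \<Psi>: "stochastic_mapping M \<Psi>"
    and cov: "op_covariance M \<Phi> = op_covariance M \<Psi>" and e: "orthonormal_basis e"
  shows "\<exists>W. gramian_unitary M (modular_domain M \<Phi>) (modular_domain M \<Psi>) W \<and>
    (\<forall>l. AE \<omega> in M. \<Psi> l \<omega> = W (\<Phi> l) \<omega>)"
proof -
  define W where "W = (\<lambda>f. SOME g. matched \<Phi> \<Psi> f g)"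
  note ctx = \<Phi> \<Psi> cov e and ctx' = \<Psi> \<Phi> cov[symmetric] e
  have W: "matched \<Phi> \<Psi> f (W f)" if "f \<in> modular_domain M \<Phi>" for f
    unfolding W_def using matched_total[OF ctx that] by (rule someI_ex)
  have dom: "f \<in> modular_domain M \<Phi>" if "matched \<Phi> \<Psi> f g" for f g
    using that by (rule matched_modular_domain[OF ctx])
  have unique: "AE \<omega> in M. W f \<omega> = g \<omega>" if "matched \<Phi> \<Psi> f g" for f g
    using matched_AE_unique[OF ctx W[OF dom[OF that]] that] by simp
  have "gramian_unitary M (modular_domain M \<Phi>) (modular_domain M \<Psi>) W"
    unfolding gramian_unitary_def
  proof (intro conjI ballI allI impI)
    fix f assume f: "f \<in> modular_domain M \<Phi>"
    show "W f \<in> modular_domain M \<Psi>"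
      using matched_modular_domain[OF ctx' matched_swap[OF W[OF f]]] .
    fix g assume g: "g \<in> modular_domain M \<Phi>"
    show "AE \<omega> in M. W f \<omega> = W g \<omega>" if "AE \<omega> in M. f \<omega> = g \<omega>"
      by (rule matched_AE_unique[OF ctx W[OF f] W[OF g] that])
    show "AE \<omega> in M. W (\<lambda>\<omega>. f \<omega> + g \<omega>) \<omega> = W f \<omega> + W g \<omega>"
      by (rule unique[OF matched_add[OF ctx W[OF f] W[OF g]]])
    show "gramian M (W f) (W g) = gramian M f g"
      by (rule matched_gramian[OF ctx W[OF f] W[OF g], symmetric])
  next
    fix a :: "'h \<Rightarrow> 'h" and f assume f: "f \<in> modular_domain M \<Phi>" and a: "bounded_clinear a"
    show "AE \<omega> in M. W (\<lambda>\<omega>. a (f \<omega>)) \<omega> = a (W f \<omega>)"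
      by (rule unique[OF matched_op[OF ctx W[OF f] a]])
  next
    fix g assume "g \<in> modular_domain M \<Psi>"
    then obtain f where "matched \<Psi> \<Phi> g f" using matched_total[OF ctx'] by blast
    then have "matched \<Phi> \<Psi> f g" by (rule matched_swap)
    then show "\<exists>f\<in>modular_domain M \<Phi>. AE \<omega> in M. W f \<omega> = g \<omega>" using dom unique by blast
  qed
  moreover have "AE \<omega> in M. \<Psi> l \<omega> = W (\<Phi> l) \<omega>" for l
    using unique[OF matched_base[OF ctx], of l] by (auto simp: eq_commute)
  ultimately show ?thesis by blast
qed

end

section \<open>Gram vectors of positive definite kernels\<close>

text \<open>The form is only required to have nonnegative real part, so Hermitian symmetry is a separate condition.\<close>

definition pd_kernel :: "('i \<Rightarrow> 'i \<Rightarrow> complex) \<Rightarrow> bool" where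
  "pd_kernel K \<longleftrightarrow> (\<forall>i j. K j i = cnj (K i j)) \<and>
     (\<forall>F c. finite F \<longrightarrow> 0 \<le> Re (\<Sum>i\<in>F. \<Sum>j\<in>F. c i * cnj (c j) * K i j))"

definition kernel_form :: "('i \<Rightarrow> 'i \<Rightarrow> complex) \<Rightarrow> 'i set \<Rightarrow> ('i \<Rightarrow> complex) \<Rightarrow> ('i \<Rightarrow> complex) \<Rightarrow> complex" where
  "kernel_form K F c d = (\<Sum>i\<in>F. \<Sum>j\<in>F. c i * cnj (d j) * K i j)"

lemma pd_kernel_hermitian: "pd_kernel K \<Longrightarrow> K j i = cnj (K i j)"
  unfolding pd_kernel_def by blast

lemma kernel_form_nonneg: "pd_kernel K \<Longrightarrow> finite F \<Longrightarrow> 0 \<le> Re (kernel_form K F c c)"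
  unfolding pd_kernel_def kernel_form_def by blast

lemma pd_kernel_semi_inner:
  assumes K: "pd_kernel K" and F: "finite F"
  shows "semi_inner UNIV (\<lambda>s c t d i. s * c i + t * d i) (kernel_form K F)"
proof
  fix c d :: "'a \<Rightarrow> complex"
  show "0 \<le> Re (kernel_form K F c c)" using K F by (rule kernel_form_nonneg)
  have swap: "cnj (c i * cnj (d j) * K i j) = d j * cnj (c i) * K j i" for i j
    using pd_kernel_hermitian[OF K, of j i] by simp
  have "cnj (kernel_form K F c d) = (\<Sum>i\<in>F. \<Sum>j\<in>F. d j * cnj (c i) * K j i)"
    unfolding kernel_form_def cnj_sum swap ..
  then show "kernel_form K F d c = cnj (kernel_form K F c d)"
    by (simp only: kernel_form_def) (rule sum.swap)
  fix s t e
  show "kernel_form K F (\<lambda>i. s * c i + t * d i) e = s * kernel_form K F c e + t * kernel_form K F d e"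
    by (simp add: kernel_form_def algebra_simps sum.distrib sum_distrib_left)
qed simp

lemma kernel_form_extend:
  assumes "finite F'" "F \<subseteq> F'"
  shows "kernel_form K F' (\<lambda>i. if i \<in> F then c i else 0) (\<lambda>i. if i \<in> F then d i else 0) = kernel_form K F c d"
proof -
  have "kernel_form K F' (\<lambda>i. if i \<in> F then c i else 0) (\<lambda>i. if i \<in> F then d i else 0) =
     (\<Sum>i\<in>F'. if i \<in> F then (\<Sum>j\<in>F'. if j \<in> F then c i * cnj (d j) * K i j else 0) else 0)"
    unfolding kernel_form_def by (intro sum.cong refl) (auto intro!: sum.cong)
  also have "\<dots> = kernel_form K F c d"
    using assms by (simp add: kernel_form_def sum.inter_restrict[symmetric] Int_absorb1)
  finally show ?thesis .
qed

text \<open>Pairing with the point mass at \<open>i\<close> turns the form into the functional that a Gram vector for \<open>i\<close> has to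
  represent.\<close>

lemma kernel_form_delta_right:
  assumes "finite F" "i \<in> F"
  shows "kernel_form K F c (\<lambda>k. if k = i then 1 else 0) = (\<Sum>j\<in>F. c j * K j i)"
proof -
  have "(\<Sum>k\<in>F. c j * cnj (if k = i then 1 else 0) * K j k) = c j * K j i" for j
  proof -
    have "(\<Sum>k\<in>F. c j * cnj (if k = i then 1 else 0) * K j k) = (\<Sum>k\<in>F. if k = i then c j * K j k else 0)"
      by (intro sum.cong) auto
    then show ?thesis using assms by (simp add: sum.delta)
  qed
  then show ?thesis by (simp add: kernel_form_def)
qed

text \<open>Cauchy-Schwarz for the form of the kernel on \<open>insert i F\<close>, against the point mass at \<open>i\<close>.  It bounds
  the functional that the Gram vector of \<open>i\<close> has to represent on the Gram vectors of \<open>F\<close>.\<close>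

lemma pd_kernel_functional_bound:
  assumes K: "pd_kernel K" and F: "finite F"
  shows "(cmod (\<Sum>j\<in>F. c j * K j i))\<^sup>2 \<le> Re (K i i) * Re (kernel_form K F c c)"
proof -
  let ?G = "insert i F" and ?c = "\<lambda>j. if j \<in> F then c j else 0" and ?d = "\<lambda>k. if k = i then 1 else 0"
  have G: "finite ?G" using F by simp
  have "kernel_form K ?G ?c ?d = (\<Sum>j\<in>?G. if j \<in> F then c j * K j i else 0)"
    unfolding kernel_form_delta_right[OF G insertI1] by (intro sum.cong) auto
  also have "\<dots> = (\<Sum>j\<in>F. c j * K j i)"
    using F by (subst sum.inter_restrict[symmetric]) (auto intro: sum.cong)
  finally have "kernel_form K ?G ?c ?d = (\<Sum>j\<in>F. c j * K j i)" .
  moreover have "kernel_form K ?G ?d ?d = K i i"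
  proof -
    have "(\<Sum>j\<in>?G. ?d j * K j i) = (\<Sum>j\<in>?G. if j = i then K j i else 0)"
      by (intro sum.cong) auto
    then show ?thesis
      unfolding kernel_form_delta_right[OF G insertI1] using G by (simp only: sum.delta) simp
  qed
  moreover have "kernel_form K ?G ?c ?c = kernel_form K F c c"
    by (rule kernel_form_extend) (use F in auto)
  ultimately show ?thesis
    using semi_inner.cauchy_schwarz[OF pd_kernel_semi_inner[OF K G], of ?c ?d] by (simp add: mult.commute)
qed

lemma pd_kernel_diagonal:
  assumes K: "pd_kernel K" shows "0 \<le> Re (K i i)" "Im (K i i) = 0"
proof -
  show "0 \<le> Re (K i i)"
    using kernel_form_nonneg[OF K, of "{i}" "\<lambda>_. 1"] by (simp add: kernel_form_def)
  have "cnj (K i i) = K i i" using pd_kernel_hermitian[OF K] by (rule sym)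
  then show "Im (K i i) = 0" by (metis Reals_cnj_iff complex_is_Real_iff)
qed

text \<open>The previous bound for a difference of two point masses: rows of the kernel are continuous for the distance
  that the kernel itself defines.\<close>

lemma pd_kernel_difference_bound:
  assumes K: "pd_kernel K"
  shows "(cmod (K j k - K i k))\<^sup>2 \<le> Re (K k k) * (Re (K i i) - 2 * Re (K j i) + Re (K j j))"
proof (cases "i = j")
  case True
  then show ?thesis by (simp add: K pd_kernel_diagonal)
next
  case False
  let ?c = "\<lambda>x. if x = j then 1 else -1"
  have herm: "K i j = cnj (K j i)" using K by (rule pd_kernel_hermitian)
  have "(\<Sum>x\<in>{i, j}. ?c x * K x k) = K j k - K i k" using False by simp
  moreover have "Re (kernel_form K {i, j} ?c ?c) = Re (K i i) - 2 * Re (K j i) + Re (K j j)"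
    using False by (simp add: kernel_form_def herm)
  ultimately show ?thesis
    using pd_kernel_functional_bound[OF K, of "{i, j}" ?c k] by simp
qed

context semi_hilbert
begin


text \<open>Given Gram vectors for \<open>B\<close>, this is the component of a Gram vector for \<open>i\<close> in their closed span.  The
  linear relation for the Riesz theorem pairs $\sum c_jv_j$ with $\sum c_jK_{ji}$.  Linear combinations are
  recognized by their inner products, as \<open>lin\<close> offers no finite sums.\<close>

lemma kernel_riesz:
  assumes K: "pd_kernel K" and x0: "x0 \<in> V" and v: "\<And>j. j \<in> B \<Longrightarrow> v j \<in> V"
    and gram: "\<And>j k. j \<in> B \<Longrightarrow> k \<in> B \<Longrightarrow> ip (v j) (v k) = K j k"
  shows "\<exists>w\<in>V. (\<forall>j\<in>B. ip (v j) w = K j i) \<and> nsq w \<le> Re (K i i) \<and>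
    (\<forall>y\<in>V. (\<forall>j\<in>B. ip (v j) y = 0) \<longrightarrow> ip w y = 0)"
proof -
  \<comment> \<open>\<open>rep F c x\<close>: \<open>x\<close> has the same inner products as the combination of the \<open>v j\<close> with coefficients \<open>c\<close>.\<close>
  define rep where "rep = (\<lambda>F c x. finite F \<and> F \<subseteq> B \<and> (\<forall>y\<in>V. ip x y = (\<Sum>j\<in>F. c j * ip (v j) y)))"
  define G where "G = {(x, z). x \<in> V \<and> (\<exists>F c. rep F c x \<and> z = (\<Sum>j\<in>F. c j * K j i))}"
  have GV: "x \<in> V" if "(x, z) \<in> G" for x z using that by (simp add: G_def)
  have "(lin 0 x0 0 x0, 0) \<in> G"
    unfolding G_def rep_def by (auto simp: lin_mem x0 ip_lin_left intro!: exI[of _ "{}"])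
  then have ne: "G \<noteq> {}" by blast
  have base: "(v j, K j i) \<in> G" if "j \<in> B" for j
    unfolding G_def rep_def using that
    by (auto simp: v intro!: exI[of _ "{j}"] exI[of _ "\<lambda>_. 1"])
  have closed: "(lin s x t x', s * z + t * z') \<in> G" if xz: "(x, z) \<in> G" "(x', z') \<in> G" for s x z t x' z'
  proof -
    obtain F c where F: "finite F" "F \<subseteq> B" "\<And>y. y \<in> V \<Longrightarrow> ip x y = (\<Sum>j\<in>F. c j * ip (v j) y)"
      "z = (\<Sum>j\<in>F. c j * K j i)" and x: "x \<in> V" using xz(1) by (auto simp: G_def rep_def)
    obtain F' c' where F': "finite F'" "F' \<subseteq> B" "\<And>y. y \<in> V \<Longrightarrow> ip x' y = (\<Sum>j\<in>F'. c' j * ip (v j) y)"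
      "z' = (\<Sum>j\<in>F'. c' j * K j i)" and x': "x' \<in> V" using xz(2) by (auto simp: G_def rep_def)
    define d where "d = (\<lambda>j. s * (if j \<in> F then c j else 0) + t * (if j \<in> F' then c' j else 0))"
    have split: "(\<Sum>j\<in>F \<union> F'. d j * h j) = s * (\<Sum>j\<in>F. c j * h j) + t * (\<Sum>j\<in>F'. c' j * h j)" for h
    proof -
      have "(\<Sum>j\<in>F \<union> F'. d j * h j) = s * (\<Sum>j\<in>F \<union> F'. if j \<in> F then c j * h j else 0)
          + t * (\<Sum>j\<in>F \<union> F'. if j \<in> F' then c' j * h j else 0)"
        unfolding sum_distrib_left sum.distrib[symmetric] by (intro sum.cong) (auto simp: d_def algebra_simps)
      then show ?thesis
        using F(1) F'(1) by (simp add: sum.inter_restrict[symmetric] Int_absorb1 Int_absorb2)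
    qed
    have "rep (F \<union> F') d (lin s x t x')"
      unfolding rep_def using F F' x x' by (simp add: split ip_lin_left)
    moreover have "s * z + t * z' = (\<Sum>j\<in>F \<union> F'. d j * K j i)"
      by (simp add: split F(4) F'(4))
    ultimately show ?thesis unfolding G_def using lin_mem[OF x x'] by blast
  qed
  have bound: "(cmod z)\<^sup>2 \<le> Re (K i i) * nsq x" if xz: "(x, z) \<in> G" for x z
  proof -
    obtain F c where F: "finite F" "F \<subseteq> B" "\<And>y. y \<in> V \<Longrightarrow> ip x y = (\<Sum>j\<in>F. c j * ip (v j) y)"
      "z = (\<Sum>j\<in>F. c j * K j i)" and x: "x \<in> V" using xz by (auto simp: G_def rep_def)
    have "ip (v j) x = (\<Sum>k\<in>F. cnj (c k) * K j k)" if "j \<in> F" for j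
    proof -
      have "ip (v j) x = cnj (\<Sum>k\<in>F. c k * ip (v k) (v j))"
        using F(2) v that x F(3)[of "v j"] ip_commute[of x "v j"] by auto
      also have "\<dots> = (\<Sum>k\<in>F. cnj (c k) * ip (v j) (v k))"
        unfolding cnj_sum complex_cnj_mult
        using F(2) that by (intro sum.cong refl) (metis ip_commute subsetD v)
      also have "\<dots> = (\<Sum>k\<in>F. cnj (c k) * K j k)"
        using F(2) that by (intro sum.cong) (auto simp: gram subset_iff)
      finally show ?thesis .
    qed
    then have "ip x x = kernel_form K F c c"
      unfolding F(3)[OF x] kernel_form_def by (simp add: sum_distrib_left mult_ac)
    then show ?thesis using pd_kernel_functional_bound[OF K F(1), of c i] F(4) by simp
  qed
  have "\<exists>w\<in>V. (\<forall>x z. (x, z) \<in> G \<longrightarrow> ip x w = z) \<and> nsq w \<le> Re (K i i) \<and>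
    (\<forall>y\<in>V. (\<forall>x z. (x, z) \<in> G \<longrightarrow> ip x y = 0) \<longrightarrow> ip w y = 0)"
    by (rule riesz_relation[OF GV ne closed bound pd_kernel_diagonal(1)[OF K]])
  then obtain w where w: "w \<in> V" "\<forall>x z. (x, z) \<in> G \<longrightarrow> ip x w = z" "nsq w \<le> Re (K i i)"
    "\<forall>y\<in>V. (\<forall>x z. (x, z) \<in> G \<longrightarrow> ip x y = 0) \<longrightarrow> ip w y = 0" by (elim bexE conjE)
  have "ip w y = 0" if y: "y \<in> V" "\<forall>j\<in>B. ip (v j) y = 0" for y
  proof -
    have "ip x y = 0" if "(x, z) \<in> G" for x z
      using that y by (auto simp: G_def rep_def subset_iff)
    then show ?thesis using w(4) y(1) by blast
  qed
  then show ?thesis using w base by blast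
qed

text \<open>Cholesky decomposition along a well-ordering.  The vector for \<open>x\<close> is the component \<open>w\<close> prescribed in the
  closed span of its predecessors, plus the multiple of \<open>u x\<close> that corrects the norm.  The recursion
  keeps each vector orthogonal to all later \<open>u y\<close>; thus \<open>u x\<close> is orthogonal to all predecessors and to \<open>w\<close>.\<close>

lemma transfinite_cholesky:
  fixes K :: "'i \<Rightarrow> 'i \<Rightarrow> complex"
  assumes K: "pd_kernel K" and u: "\<And>i. i \<in> J \<Longrightarrow> u i \<in> V"
    and orth: "\<And>i j. i \<in> J \<Longrightarrow> j \<in> J \<Longrightarrow> ip (u i) (u j) = (if i = j then 1 else 0)"
  shows "\<exists>v. \<forall>i\<in>J. v i \<in> V \<and> (\<forall>j\<in>J. ip (v i) (v j) = K i j)"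
proof -
  obtain r :: "'i rel" where r: "Well_order r" "Field r = UNIV"
    using well_ordering by (elim exE conjE)
  define R where "R = r - Id"
  have wf: "wf R" using r by (simp add: R_def well_order_on_def)
  have lin_r: "trans r" "antisym r" "total_on UNIV r"
    using r by (auto simp: well_order_on_def linear_order_on_def partial_order_on_def preorder_on_def)
  have total: "(x, y) \<in> R \<or> x = y \<or> (y, x) \<in> R" for x y
    using lin_r(3) by (auto simp: R_def total_on_def)
  have trans: "(x, z) \<in> R" if "(x, y) \<in> R" "(y, z) \<in> R" for x y z
    using that lin_r(1,2) unfolding R_def trans_def antisym_def by blast
  have irrefl: "(x, x) \<notin> R" for x by (simp add: R_def)
  define P where "P = (\<lambda>f x v. x \<in> J \<longrightarrow> v \<in> V \<and> (\<forall>y\<in>J. (y, x) \<in> R \<longrightarrow> ip (f y) v = K y x) \<and>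
      nsq v = Re (K x x) \<and> (\<forall>y\<in>J. (x, y) \<in> R \<longrightarrow> ip v (u y) = 0))"
  have gram: "ip (f y) (f z) = K y z"
    if f: "\<And>y. y \<in> B \<Longrightarrow> P f y (f y)" and B: "B \<subseteq> J" and yz: "y \<in> B" "z \<in> B" for f B y z
  proof -
    have J: "y \<in> J" "z \<in> J" using B yz by auto
    have V: "f y \<in> V" "f z \<in> V" using f[OF yz(1)] f[OF yz(2)] J by (auto simp: P_def)
    consider "(y, z) \<in> R" | "y = z" | "(z, y) \<in> R" using total by blast
    then show ?thesis
    proof cases
      case 1
      then show ?thesis using f[OF yz(2)] J by (auto simp: P_def)
    next
      case 2
      have "nsq (f y) = Re (K y y)" using f[OF yz(1)] J by (auto simp: P_def)
      moreover have "Im (ip (f y) (f y)) = 0" using ip_commute[OF V(1) V(1)] by (simp add: complex_eq_iff)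
      ultimately show ?thesis using 2 pd_kernel_diagonal(2)[OF K] by (simp add: complex_eq_iff)
    next
      case 3
      then have "ip (f z) (f y) = K z y" using f[OF yz(1)] J by (auto simp: P_def)
      then show ?thesis using ip_commute[OF V(2) V(1)] pd_kernel_hermitian[OF K, of y z] by simp
    qed
  qed
  have "\<exists>f. \<forall>x. P f x (f x)"
  proof (rule dependent_wf_choice[OF wf])
    show "P f x v = P g x v" if "\<And>z. (z, x) \<in> R \<Longrightarrow> f z = g z" for f g x v
      using that by (auto simp: P_def)
    show "\<exists>v. P f x v" if IH: "\<And>y. (y, x) \<in> R \<Longrightarrow> P f y (f y)" for x f
    proof (cases "x \<in> J")
      case x: True
      define B where "B = {y \<in> J. (y, x) \<in> R}"
      have fV: "f j \<in> V" if "j \<in> B" for j using IH[of j] that by (auto simp: P_def B_def)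
      have "\<exists>w\<in>V. (\<forall>j\<in>B. ip (f j) w = K j x) \<and> nsq w \<le> Re (K x x) \<and>
          (\<forall>y\<in>V. (\<forall>j\<in>B. ip (f j) y = 0) \<longrightarrow> ip w y = 0)"
        by (rule kernel_riesz[OF K u[OF x] fV gram[where B=B]]) (use IH in \<open>auto simp: B_def\<close>)
      then obtain w where w: "w \<in> V" "\<And>j. j \<in> B \<Longrightarrow> ip (f j) w = K j x" "nsq w \<le> Re (K x x)"
        "\<And>y. y \<in> V \<Longrightarrow> (\<And>j. j \<in> B \<Longrightarrow> ip (f j) y = 0) \<Longrightarrow> ip w y = 0" by blast
      have f_u: "ip (f j) (u y) = 0" if "j \<in> B" "y \<in> J" "y = x \<or> (x, y) \<in> R" for j y
        using IH[of j] that trans[of j x y] by (auto simp: P_def B_def)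
      have w_u: "ip w (u y) = 0" if "y \<in> J" "y = x \<or> (x, y) \<in> R" for y
        by (rule w(4)) (use u f_u that in auto)
      define s where "s = complex_of_real (sqrt (Re (K x x) - nsq w))"
      have s: "(cmod s)\<^sup>2 = Re (K x x) - nsq w" using w(3) by (simp add: s_def)
      show ?thesis
      proof (intro exI[of _ "lin 1 w s (u x)"])
        show "P f x (lin 1 w s (u x))"
          unfolding P_def
        proof (intro impI conjI ballI)
          show "lin 1 w s (u x) \<in> V" by (intro lin_mem w u x)
          show "nsq (lin 1 w s (u x)) = Re (K x x)"
            using w_u[OF x] orth[OF x x] by (simp add: nsq_lin w u x s)
          show "ip (f y) (lin 1 w s (u x)) = K y x" if "y \<in> J" "(y, x) \<in> R" for y
            using that fV[of y] w(2)[of y] f_u[of y x] x by (simp add: ip_lin_right w(1) u B_def)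
          show "ip (lin 1 w s (u x)) (u y) = 0" if "y \<in> J" "(x, y) \<in> R" for y
            using that w_u[of y] orth[OF x, of y] irrefl[of x] by (auto simp: ip_lin_left w(1) u x)
        qed
      qed
    qed (simp add: P_def)
  qed
  then obtain f where f: "\<And>x. P f x (f x)" by blast
  have "f i \<in> V" if "i \<in> J" for i using f[of i] that by (simp add: P_def)
  moreover have "ip (f i) (f j) = K i j" if "i \<in> J" "j \<in> J" for i j
    by (rule gram[where B=J]) (use f that in auto)
  ultimately show ?thesis by blast
qed

text \<open>If the point mass at \<open>i\<close> can be approximated by point masses in \<open>J\<close>, in the distance defined by the
  kernel, then its component in the closed span of the Gram vectors for \<open>J\<close> is already a Gram vector.  For
  \<open>J = UNIV\<close> the approximation is trivial.\<close>

lemma gram_vectors_exist: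
  assumes K: "pd_kernel K" and u: "\<And>i. i \<in> J \<Longrightarrow> u i \<in> V"
    and orth: "\<And>i j. i \<in> J \<Longrightarrow> j \<in> J \<Longrightarrow> ip (u i) (u j) = (if i = j then 1 else 0)"
    and dense: "\<And>i \<epsilon>. 0 < \<epsilon> \<Longrightarrow> \<exists>j\<in>J. Re (K i i) - 2 * Re (K j i) + Re (K j j) < \<epsilon>"
  shows "\<exists>w. (\<forall>i. w i \<in> V) \<and> (\<forall>i j. ip (w i) (w j) = K i j)"
proof -
  have "\<exists>v. \<forall>i\<in>J. v i \<in> V \<and> (\<forall>j\<in>J. ip (v i) (v j) = K i j)"
    by (rule transfinite_cholesky[OF K u orth])
  then obtain v where v: "\<And>i. i \<in> J \<Longrightarrow> v i \<in> V" "\<And>i j. i \<in> J \<Longrightarrow> j \<in> J \<Longrightarrow> ip (v i) (v j) = K i j"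
    by blast
  obtain x0 where x0: "x0 \<in> V" using dense[of 1] u by (metis zero_less_one)
  have "\<exists>w\<in>V. (\<forall>j\<in>J. ip (v j) w = K j i) \<and> nsq w \<le> Re (K i i)" for i
  proof -
    have "\<exists>w\<in>V. (\<forall>j\<in>J. ip (v j) w = K j i) \<and> nsq w \<le> Re (K i i) \<and>
        (\<forall>y\<in>V. (\<forall>j\<in>J. ip (v j) y = 0) \<longrightarrow> ip w y = 0)"
      by (rule kernel_riesz[OF K x0 v])
    then show ?thesis by blast
  qed
  then obtain w where w: "\<And>i. w i \<in> V" "\<And>i j. j \<in> J \<Longrightarrow> ip (v j) (w i) = K j i" "\<And>i. nsq (w i) \<le> Re (K i i)"
    by metis
  have "ip (w i) (w k) = K i k" for i k
  proof (rule ccontr)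
    define z where "z = ip (w i) (w k) - K i k"
    assume "ip (w i) (w k) \<noteq> K i k"
    then have z: "(cmod z)\<^sup>2 > 0" by (simp add: z_def)
    have Kk: "0 \<le> Re (K k k)" by (rule pd_kernel_diagonal[OF K])
    \<comment> \<open>Both parts of \<open>z\<close> below have square at most \<open>\<epsilon> * Re (K k k)\<close>, so $|z|^2$ is at most four times that.\<close>
    define \<epsilon> where "\<epsilon> = (cmod z)\<^sup>2 / (4 * Re (K k k) + 1)"
    have "0 < \<epsilon>" using z Kk by (simp add: \<epsilon>_def add_nonneg_pos)
    then obtain j where j: "j \<in> J" "Re (K i i) - 2 * Re (K j i) + Re (K j j) < \<epsilon>" using dense by blast
    let ?\<delta> = "Re (K i i) - 2 * Re (K j i) + Re (K j j)"
    have "nsq (lin 1 (w i) (-1) (v j)) \<le> ?\<delta>"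
      using w(1)[of i] w(3)[of i] v[OF j(1)] j(1) ip_commute[OF v(1)[OF j(1)] w(1)[of i]] w(2)[OF j(1), of i]
      by (simp add: nsq_lin)
    then have "nsq (lin 1 (w i) (-1) (v j)) * nsq (w k) \<le> ?\<delta> * Re (K k k)"
      by (intro mult_mono w(3) ip_nonneg w(1))
        (use ip_nonneg[OF lin_mem[OF w(1)[of i] v(1)[OF j(1)], of 1 "-1"]] in linarith)+
    then have 1: "(cmod (ip (w i) (w k) - K j k))\<^sup>2 \<le> ?\<delta> * Re (K k k)"
      using cauchy_schwarz[OF lin_mem[OF w(1)[of i] v(1)[OF j(1)], of 1 "-1"] w(1)[of k]]
      by (simp add: ip_lin_left w v(1)[OF j(1)] j(1))
    have 2: "(cmod (K j k - K i k))\<^sup>2 \<le> ?\<delta> * Re (K k k)"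
      using pd_kernel_difference_bound[OF K, of j k i] by (simp add: mult.commute)
    have "(cmod z)\<^sup>2 \<le> (cmod (ip (w i) (w k) - K j k) + cmod (K j k - K i k))\<^sup>2"
      using norm_triangle_ineq[of "ip (w i) (w k) - K j k" "K j k - K i k"]
      by (intro power_mono) (simp_all add: z_def)
    also have "\<dots> \<le> 2 * (cmod (ip (w i) (w k) - K j k))\<^sup>2 + 2 * (cmod (K j k - K i k))\<^sup>2"
      using zero_le_power2[of "cmod (ip (w i) (w k) - K j k) - cmod (K j k - K i k)"]
      by (simp add: power2_eq_square algebra_simps)
    also have "\<dots> \<le> 4 * (?\<delta> * Re (K k k))" using 1 2 by linarith
    also have "\<dots> \<le> 4 * (\<epsilon> * Re (K k k))" using j(2) Kk by (intro mult_left_mono mult_right_mono) auto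
    also have "\<dots> < (cmod z)\<^sup>2"
      using z Kk by (simp add: \<epsilon>_def field_simps)
    finally show False by simp
  qed
  then show ?thesis using w(1) by blast
qed

end

section \<open>Operator-valued kernels\<close>

lemma bounded_clinear_rank_one: "bounded_clinear (rank_one h (k::'h::complex_inner))"
proof (rule bounded_clinearI[where K = "norm h * norm k"])
  show "norm (rank_one h k x) \<le> norm h * norm k * norm x" for x
    using mult_right_mono[OF norm_cinner_le[of x k] norm_ge_zero[of h]] by (simp add: rank_one_def mult_ac)
qed (simp_all add: rank_one_def cinner_add_left cinner_scaleC_left scaleC_add_left scaleC_scaleC)

lemma adj_rank_one: "adj (rank_one h k) = rank_one k (h::'h::separable_complex_hilbert)"
  by (rule adj_unique[OF bounded_clinear_rank_one bounded_clinear_rank_one])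
    (simp add: rank_one_def cinner_scaleC_left cinner_commute[of h])

context
  fixes \<Gamma> :: "'l \<Rightarrow> 'l \<Rightarrow> 'h::separable_complex_hilbert \<Rightarrow> 'h"
  assumes tc: "trace_class_kernel \<Gamma>" and pd: "positive_definite_kernel \<Gamma>"
    and basis: "orthonormal_basis (some_basis :: nat \<Rightarrow> 'h)"
begin

lemma kernel_bounded_clinear: "bounded_clinear (\<Gamma> l m)"
  using tc by (simp add: trace_class_kernel_def trace_class_def)

text \<open>Take $a_i = h\otimes\overline{k_i}$ with a unit vector $h$ in the definition of positivity.  Then the
  operator is the scalar in question times $h\otimes\overline{h}$.\<close>

lemma kernel_vector_form:
  fixes m :: nat
  shows "Im (\<Sum>i<m. \<Sum>j<m. cinner (\<Gamma> (l i) (l j) (k j)) (k i)) = 0"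
    and "0 \<le> Re (\<Sum>i<m. \<Sum>j<m. cinner (\<Gamma> (l i) (l j) (k j)) (k i))"
proof -
  define h :: 'h where "h = some_basis 0"
  have h: "cinner h h = 1" using basis_orthonormal[OF basis, of 0 0] by (simp add: h_def)
  define a where "a = (\<lambda>i. rank_one h (k i))"
  have "\<forall>i<m. bounded_clinear (a i)" by (simp add: a_def bounded_clinear_rank_one)
  then have pos: "positive_op (\<lambda>x. \<Sum>i<m. \<Sum>j<m. a i (\<Gamma> (l i) (l j) (adj (a j) x)))"
    using pd unfolding positive_definite_kernel_def by blast
  have "a i (\<Gamma> (l i) (l j) (adj (a j) h)) = cinner (\<Gamma> (l i) (l j) (k j)) (k i) *\<^sub>C h" for i j
    unfolding a_def adj_rank_one by (simp add: rank_one_def h)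
  then have eq: "cinner (\<Sum>i<m. \<Sum>j<m. a i (\<Gamma> (l i) (l j) (adj (a j) h))) h =
      (\<Sum>i<m. \<Sum>j<m. cinner (\<Gamma> (l i) (l j) (k j)) (k i))"
    by (simp add: cinner_sum_left cinner_scaleC_left h)
  have "\<forall>x. Im (cinner (\<Sum>i<m. \<Sum>j<m. a i (\<Gamma> (l i) (l j) (adj (a j) x))) x) = 0 \<and>
      0 \<le> Re (cinner (\<Sum>i<m. \<Sum>j<m. a i (\<Gamma> (l i) (l j) (adj (a j) x))) x)"
    using pos unfolding positive_op_def by (rule conjunct2)
  from this[rule_format, of h]
  show "Im (\<Sum>i<m. \<Sum>j<m. cinner (\<Gamma> (l i) (l j) (k j)) (k i)) = 0"
    "0 \<le> Re (\<Sum>i<m. \<Sum>j<m. cinner (\<Gamma> (l i) (l j) (k j)) (k i))"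
    unfolding eq by (rule conjunct1, rule conjunct2)
qed

lemma pd_kernel_of_operator_kernel: "pd_kernel (\<lambda>i j. cinner (\<Gamma> (p i) (p j) (k j)) (k i))"
proof -
  define K where "K = (\<lambda>i j. cinner (\<Gamma> (p i) (p j) (k j)) (k i))"
  have form: "Im (\<Sum>i\<in>F. \<Sum>j\<in>F. c i * cnj (c j) * K i j) = 0 \<and> 0 \<le> Re (\<Sum>i\<in>F. \<Sum>j\<in>F. c i * cnj (c j) * K i j)"
    if F: "finite F" for F c
  proof -
    obtain g where g: "bij_betw g {0..<card F} F" using ex_bij_betw_nat_finite[OF F] by blast
    then have g: "bij_betw g {..<card F} F" by (simp add: atLeast0LessThan)
    have "(\<Sum>i\<in>F. \<Sum>j\<in>F. c i * cnj (c j) * K i j) =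
        (\<Sum>i<card F. \<Sum>j<card F. c (g i) * cnj (c (g j)) * K (g i) (g j))"
      by (simp add: sum.reindex_bij_betw[OF g, symmetric])
    also have "\<dots> = (\<Sum>i<card F. \<Sum>j<card F. cinner (\<Gamma> (p (g i)) (p (g j)) (cnj (c (g j)) *\<^sub>C k (g j))) (cnj (c (g i)) *\<^sub>C k (g i)))"
      by (intro sum.cong refl)
        (simp add: K_def bounded_clinear_scaleC[OF kernel_bounded_clinear] cinner_scaleC_left)
    finally show ?thesis
      using kernel_vector_form[of "\<lambda>i. p (g i)" "\<lambda>i. cnj (c (g i)) *\<^sub>C k (g i)" "card F"] by simp
  qed
  have "K j i = cnj (K i j)" for i j
  proof (cases "i = j")
    case True
    then show ?thesis using form[of "{i}" "\<lambda>_. 1"] by (simp add: complex_eq_iff)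
  next
    case False
    have d: "Im (K i i) = 0" "Im (K j j) = 0" using form[of "{i}" "\<lambda>_. 1"] form[of "{j}" "\<lambda>_. 1"] by simp_all
    have "Im (K i j) + Im (K j i) = 0" using form[of "{i, j}" "\<lambda>_. 1"] d False by simp
    moreover have "Re (K j i) = Re (K i j)"
      using form[of "{i, j}" "\<lambda>x. if x = i then 1 else \<i>"] d False by simp
    ultimately show ?thesis by (simp add: complex_eq_iff)
  qed
  then have "pd_kernel K" using form unfolding pd_kernel_def by blast
  then show ?thesis by (simp add: K_def)
qed

lemma positive_op_kernel_diagonal: "positive_op (\<Gamma> l l)"
proof -
  note pdK = pd_kernel_of_operator_kernel[of "\<lambda>_. l" "\<lambda>x. x"]
  show ?thesis
    unfolding positive_op_def using kernel_bounded_clinear pd_kernel_diagonal[OF pdK] by simp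
qed

lemma summable_kernel_diagonal: "summable (\<lambda>n. Re (cinner (\<Gamma> l l (some_basis n)) (some_basis n)))"
  using tc abs_op_positive[OF positive_op_kernel_diagonal, of l]
  unfolding trace_class_kernel_def trace_class_def by metis

text \<open>Positivity at the two vectors \<open>x\<close> at \<open>l\<close> and \<open>y\<close> at \<open>m\<close>, indexed by the truth values.\<close>

lemma kernel_cauchy_schwarz:
  "(cmod (cinner (\<Gamma> l m y) x))\<^sup>2 \<le> Re (cinner (\<Gamma> l l x) x) * Re (cinner (\<Gamma> m m y) y)"
proof -
  define p where "p = (\<lambda>b. if b then l else m)"
  define k where "k = (\<lambda>b. if b then x else y)"
  note pdK = pd_kernel_of_operator_kernel[of p k]
  show ?thesis
    using pd_kernel_functional_bound[OF pdK, of "{True}" "\<lambda>_. 1" False]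
    by (simp add: kernel_form_def p_def k_def mult.commute)
qed

text \<open>The matrix $(\Gamma(\lambda_i,\lambda_j))$ at the points \<open>l\<close>, \<open>m\<close>, \<open>l'\<close>, \<open>m'\<close> is positive, so its entries
  are dominated by the sum \<open>A\<close> of the diagonal ones, which is a positive trace class operator.
  Hence the difference is trace class, and its trace norm bounds its diagonal.\<close>

lemma kernel_difference_trace_norm:
  "(\<Sum>n<N. cmod (cinner (\<Gamma> l m (some_basis n) - \<Gamma> l' m' (some_basis n)) (some_basis n)))
    \<le> trace_norm (\<lambda>x. \<Gamma> l m x - \<Gamma> l' m' x)"
proof -
  define A where "A = (\<lambda>x. (\<Gamma> l l x + \<Gamma> m m x) + (\<Gamma> l' l' x + \<Gamma> m' m' x))"
  have A: "positive_op A"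
    unfolding A_def by (intro positive_op_add positive_op_kernel_diagonal)
  have "summable (\<lambda>n. (Re (cinner (\<Gamma> l l (some_basis n)) (some_basis n)) + Re (cinner (\<Gamma> m m (some_basis n)) (some_basis n)))
      + (Re (cinner (\<Gamma> l' l' (some_basis n)) (some_basis n)) + Re (cinner (\<Gamma> m' m' (some_basis n)) (some_basis n))))"
    by (intro summable_add summable_kernel_diagonal)
  then have sum: "summable (\<lambda>n. Re (cinner (A (some_basis n)) (some_basis n)))"
    by (simp add: A_def cinner_add_left)
  have lin: "bounded_clinear (\<lambda>x. \<Gamma> l m x - \<Gamma> l' m' x)"
    by (intro bounded_clinear_minus kernel_bounded_clinear)
  note pos = positive_op_nonneg[OF positive_op_kernel_diagonal]
  have half: "cmod (cinner (\<Gamma> a b x) y) \<le> Re (cinner (\<Gamma> a a y) y) + Re (cinner (\<Gamma> b b x) x)" for a b x y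
    using arith_geo_mean_square[OF kernel_cauchy_schwarz[of a b x y] pos pos] pos[of a y] pos[of b x]
    by argo
  have "cmod (cinner (\<Gamma> l m x - \<Gamma> l' m' x) y) \<le> Re (cinner (A x) x) + Re (cinner (A y) y)" for x y
  proof -
    have "cmod (cinner (\<Gamma> l m x - \<Gamma> l' m' x) y) \<le> cmod (cinner (\<Gamma> l m x) y) + cmod (cinner (\<Gamma> l' m' x) y)"
      unfolding cinner_diff_left by (rule norm_triangle_ineq4)
    moreover have A_eq: "Re (cinner (A z) z) = Re (cinner (\<Gamma> l l z) z) + Re (cinner (\<Gamma> m m z) z)
        + (Re (cinner (\<Gamma> l' l' z) z) + Re (cinner (\<Gamma> m' m' z) z))" for z
      by (simp add: A_def cinner_add_left)
    ultimately show ?thesis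
      unfolding A_eq
      using half[of l m x y] half[of l' m' x y] pos[of l x] pos[of m y] pos[of l' x] pos[of m' y]
      by argo
  qed
  from summable_abs_op_of_dominated[OF basis A sum lin this]
  show ?thesis unfolding trace_norm_def by (rule sum_diagonal_le_trace_norm[OF basis lin])
qed

end

lemma trace_norm_zero: "trace_norm (\<lambda>x::'h::separable_complex_hilbert. 0) = 0"
proof -
  have "positive_op (\<lambda>x::'h. 0)" by (simp add: positive_op_def bounded_clinear_0)
  then show ?thesis by (simp add: trace_norm_def abs_op_positive)
qed

text \<open>The punctured limit extends to the point $(l_0,l_0)$ itself, where the trace norm is that of the zero
  operator; a product neighbourhood then gives \<open>U\<close>.\<close>

lemma continuous_kernel_near_diagonal:
  fixes \<Gamma> :: "'l::topological_space \<Rightarrow> 'l \<Rightarrow> 'h::separable_complex_hilbert \<Rightarrow> 'h"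
  assumes "continuous_kernel \<Gamma>" "0 < \<epsilon>"
  shows "\<exists>U. open U \<and> l0 \<in> U \<and> (\<forall>l\<in>U. \<forall>m\<in>U. trace_norm (\<lambda>x. \<Gamma> l m x - \<Gamma> l0 l0 x) < \<epsilon>)"
proof -
  let ?t = "\<lambda>(l, m). trace_norm (\<lambda>x. \<Gamma> l m x - \<Gamma> l0 l0 x)"
  have "(?t \<longlongrightarrow> 0) (at (l0, l0))" using assms(1) unfolding continuous_kernel_def by blast
  then have "\<forall>\<^sub>F p in at (l0, l0). ?t p < \<epsilon>" using assms(2) by (rule order_tendstoD)
  then have "\<forall>\<^sub>F p in nhds (l0, l0). p \<noteq> (l0, l0) \<longrightarrow> ?t p < \<epsilon>" by (simp add: eventually_at_filter)
  moreover have "?t (l0, l0) < \<epsilon>" using assms(2) by (simp add: trace_norm_zero)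
  ultimately have "\<forall>\<^sub>F p in nhds (l0, l0). ?t p < \<epsilon>" by (auto elim: eventually_mono)
  then obtain S where S: "open S" "(l0, l0) \<in> S" "\<And>p. p \<in> S \<Longrightarrow> ?t p < \<epsilon>"
    unfolding eventually_nhds by blast
  obtain A B where AB: "open A" "open B" "(l0, l0) \<in> A \<times> B" "A \<times> B \<subseteq> S"
    using open_prod_elim[OF S(1,2)] by blast
  show ?thesis
  proof (intro exI[of _ "A \<inter> B"] conjI ballI)
    show "trace_norm (\<lambda>x. \<Gamma> l m x - \<Gamma> l0 l0 x) < \<epsilon>" if "l \<in> A \<inter> B" "m \<in> A \<inter> B" for l m
      using S(3)[of "(l, m)"] AB(4) that by auto
  qed (use AB in auto)
qed

lemma cmod_diagonal_le_trace_norm: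
  fixes \<Gamma> :: "'l \<Rightarrow> 'l \<Rightarrow> 'h::separable_complex_hilbert \<Rightarrow> 'h"
  assumes tc: "trace_class_kernel \<Gamma>" and pd: "positive_definite_kernel \<Gamma>"
    and basis: "orthonormal_basis (some_basis :: nat \<Rightarrow> 'h)"
  shows "cmod (cinner (\<Gamma> l m (some_basis n) - \<Gamma> l' m' (some_basis n)) (some_basis n))
    \<le> trace_norm (\<lambda>x. \<Gamma> l m x - \<Gamma> l' m' x)"
proof -
  let ?f = "\<lambda>n. cmod (cinner (\<Gamma> l m (some_basis n) - \<Gamma> l' m' (some_basis n)) (some_basis n))"
  have "?f n \<le> (\<Sum>k<Suc n. ?f k)" by (rule member_le_sum) auto
  also have "\<dots> \<le> trace_norm (\<lambda>x. \<Gamma> l m x - \<Gamma> l' m' x)"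
    by (rule kernel_difference_trace_norm[OF tc pd basis])
  finally show ?thesis .
qed

lemma continuous_kernel_dense:
  fixes \<Gamma> :: "'l::topological_space \<Rightarrow> 'l \<Rightarrow> 'h::separable_complex_hilbert \<Rightarrow> 'h"
  assumes tc: "trace_class_kernel \<Gamma>" and pd: "positive_definite_kernel \<Gamma>" and cont: "continuous_kernel \<Gamma>"
    and basis: "orthonormal_basis (some_basis :: nat \<Rightarrow> 'h)" and D: "closure D = UNIV" and \<epsilon>: "0 < \<epsilon>"
  shows "\<exists>d\<in>D. Re (cinner (\<Gamma> l l (some_basis n)) (some_basis n))
      - 2 * Re (cinner (\<Gamma> d l (some_basis n)) (some_basis n)) + Re (cinner (\<Gamma> d d (some_basis n)) (some_basis n)) < \<epsilon>"
proof -
  obtain U where U: "open U" "l \<in> U" "\<forall>a\<in>U. \<forall>b\<in>U. trace_norm (\<lambda>x. \<Gamma> a b x - \<Gamma> l l x) < \<epsilon> / 3"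
    using continuous_kernel_near_diagonal[OF cont, of "\<epsilon> / 3" l] \<epsilon> by auto
  obtain d where d: "d \<in> D" "d \<in> U"
    using D U(1,2) closure_iff_nhds_not_empty[of l D] by blast
  let ?q = "\<lambda>a b. Re (cinner (\<Gamma> a b (some_basis n)) (some_basis n))"
  have near: "\<bar>?q a b - ?q l l\<bar> < \<epsilon> / 3" if "a \<in> U" "b \<in> U" for a b
  proof -
    have "\<bar>?q a b - ?q l l\<bar> \<le> cmod (cinner (\<Gamma> a b (some_basis n) - \<Gamma> l l (some_basis n)) (some_basis n))"
      using abs_Re_le_cmod[of "cinner (\<Gamma> a b (some_basis n) - \<Gamma> l l (some_basis n)) (some_basis n)"]
      by (simp add: cinner_diff_left)
    also have "\<dots> \<le> trace_norm (\<lambda>x. \<Gamma> a b x - \<Gamma> l l x)"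
      by (rule cmod_diagonal_le_trace_norm[OF tc pd basis])
    also have "\<dots> < \<epsilon> / 3" using U(3) that by blast
    finally show ?thesis .
  qed
  have "?q l l - 2 * ?q d l + ?q d d < \<epsilon>"
    using near[OF d(2) U(2)] near[OF d(2) d(2)] by linarith
  then show ?thesis using d(1) by blast
qed

section \<open>Kolmogorov factorization\<close>

context prob_space
begin

text \<open>The partial sums $\sum_{n<N} v_ne_n$ are Cauchy because they are orthogonal expansions at each point.\<close>

lemma basis_coefficients_exist:
  fixes v :: "nat \<Rightarrow> 'a \<Rightarrow> complex" and e :: "nat \<Rightarrow> 'h::separable_complex_hilbert"
  assumes e: "orthonormal_basis e" and v: "\<And>n. v n \<in> L2_0 M"
    and sum: "summable (\<lambda>n. (L2_norm M (v n))\<^sup>2)"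
  shows "\<exists>f\<in>L2_0 M. \<forall>n. AE \<omega> in M. cinner (f \<omega>) (e n) = v n \<omega>"
proof -
  define X where "X = (\<lambda>N \<omega>. \<Sum>n<N. v n \<omega> *\<^sub>C e n)"
  have X: "X N \<in> L2_0 M" for N
    unfolding X_def
    by (intro L2_0_sum L2_0_bounded_linear[OF v bounded_bilinear.bounded_linear_left[OF bounded_bilinear_scaleC]])
  define s where "s = (\<lambda>N. \<Sum>n<N. (L2_norm M (v n))\<^sup>2)"
  have diff: "(L2_dist M (X (N + k)) (X N))\<^sup>2 = s (N + k) - s N" for N k
  proof -
    have split: "(\<Sum>n<N + k. f n) = (\<Sum>n<N. f n) + (\<Sum>n\<in>{N..<N + k}. f n)" for f :: "nat \<Rightarrow> 'b::comm_monoid_add"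
      by (simp add: lessThan_atLeast0 sum.atLeastLessThan_concat)
    have "X (N + k) \<omega> - X N \<omega> = (\<Sum>n\<in>{N..<N + k}. v n \<omega> *\<^sub>C e n)" for \<omega>
      by (simp add: X_def split)
    then have "(norm (X (N + k) \<omega> - X N \<omega>))\<^sup>2 = (\<Sum>n\<in>{N..<N + k}. (cmod (v n \<omega>))\<^sup>2)" for \<omega>
      by (simp add: norm_sum_orthonormal basis_orthonormal[OF e])
    then have "(L2_dist M (X (N + k)) (X N))\<^sup>2 = (\<integral>\<omega>. (\<Sum>n\<in>{N..<N + k}. (cmod (v n \<omega>))\<^sup>2) \<partial>M)"
      by (simp add: L2_norm_square)
    also have "\<dots> = (\<Sum>n\<in>{N..<N + k}. (L2_norm M (v n))\<^sup>2)"
      unfolding L2_norm_square by (rule Bochner_Integration.integral_sum) (rule L2_0_integrable_square[OF v])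
    finally show ?thesis by (simp add: s_def split)
  qed
  have diff_abs: "(L2_dist M (X m) (X n))\<^sup>2 \<le> \<bar>s m - s n\<bar>" for m n
    using diff[of n "m - n"] diff[of m "n - m"] L2_norm_minus_commute[of M "X m" "X n"]
    by (cases "n \<le> m") auto
  have "Cauchy s"
    unfolding s_def by (rule convergent_Cauchy) (use sum in \<open>simp add: summable_iff_convergent\<close>)
  have "\<exists>f\<in>L2_0 M. (\<lambda>n. (L2_dist M (X n) f)\<^sup>2) \<longlonglongrightarrow> 0"
  proof (rule L2_0_complete[OF X])
    fix \<epsilon> :: real assume "0 < \<epsilon>"
    then obtain N where "\<And>m n. m \<ge> N \<Longrightarrow> n \<ge> N \<Longrightarrow> \<bar>s m - s n\<bar> < \<epsilon>"
      using \<open>Cauchy s\<close> unfolding Cauchy_def dist_real_def by blast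
    then show "\<exists>N. \<forall>m\<ge>N. \<forall>n\<ge>N. (L2_dist M (X m) (X n))\<^sup>2 < \<epsilon>"
      using diff_abs le_less_trans by blast
  qed
  then obtain f where f: "f \<in> L2_0 M" and lim: "(\<lambda>n. (L2_dist M (X n) f)\<^sup>2) \<longlonglongrightarrow> 0" by blast
  have "AE \<omega> in M. cinner (f \<omega>) (e k) = v k \<omega>" for k
  proof -
    have mem: "(\<lambda>\<omega>. v k \<omega> - cinner (f \<omega>) (e k)) \<in> L2_0 M" by (intro L2_0_diff v L2_0_cinner f)
    have "(L2_norm M (\<lambda>\<omega>. v k \<omega> - cinner (f \<omega>) (e k)))\<^sup>2 \<le> (L2_dist M (X n) f)\<^sup>2" if "n > k" for n
    proof -
      have "cinner (X n \<omega>) (e k) = v k \<omega>" for \<omega>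
      proof -
        have "cinner (X n \<omega>) (e k) = (\<Sum>i<n. if i = k then v i \<omega> else 0)"
          unfolding X_def cinner_sum_left
          by (intro sum.cong refl) (simp add: cinner_scaleC_left basis_orthonormal[OF e])
        then show ?thesis using that by (simp add: sum.delta)
      qed
      then have "v k \<omega> - cinner (f \<omega>) (e k) = cinner (X n \<omega> - f \<omega>) (e k)" for \<omega>
        by (simp add: cinner_diff_left)
      moreover have "cmod (cinner x (e k)) \<le> 1 * norm x" for x
        using norm_cinner_le[of x "e k"] by (simp add: norm_basis[OF e])
      ultimately have "L2_norm M (\<lambda>\<omega>. v k \<omega> - cinner (f \<omega>) (e k)) \<le> 1 * L2_dist M (X n) f"
        using L2_norm_bounded_linear_le[OF L2_0_diff[OF X f]
            bounded_bilinear.bounded_linear_left[OF bounded_bilinear_cinner], of 1 "e k" n] by simp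
      then show ?thesis by (intro power_mono) simp_all
    qed
    then have "(L2_norm M (\<lambda>\<omega>. v k \<omega> - cinner (f \<omega>) (e k)))\<^sup>2 \<le> 0"
      by (intro LIMSEQ_le_const[OF lim]) (auto intro!: exI[of _ "Suc k"])
    then have "L2_norm M (\<lambda>\<omega>. v k \<omega> - cinner (f \<omega>) (e k)) = 0" by simp
    from L2_norm_eq_0D[OF mem this] show ?thesis by eventually_elim simp
  qed
  then show ?thesis using f by blast
qed

lemma L2_inner_cong_AE:
  fixes f g :: "'a \<Rightarrow> 'b::separable_complex_hilbert"
  assumes [measurable]: "f \<in> borel_measurable M" "g \<in> borel_measurable M" "f' \<in> borel_measurable M" "g' \<in> borel_measurable M"
    and ae: "AE \<omega> in M. f \<omega> = f' \<omega>" "AE \<omega> in M. g \<omega> = g' \<omega>"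
  shows "L2_inner M f g = L2_inner M f' g'"
  unfolding L2_inner_def by (rule integral_cong_AE) (use ae in auto)

text \<open>The given variables become the coordinates of the values of \<open>\<Phi>\<close>; their squared norms sum to the trace
  of $\Gamma(\lambda,\lambda)$.\<close>

lemma factorization_of_gram_vectors:
  fixes \<Gamma> :: "'l \<Rightarrow> 'l \<Rightarrow> 'h::separable_complex_hilbert \<Rightarrow> 'h" and v :: "'l \<times> nat \<Rightarrow> 'a \<Rightarrow> complex"
  assumes tc: "trace_class_kernel \<Gamma>" and pd: "positive_definite_kernel \<Gamma>"
    and basis: "orthonormal_basis (some_basis :: nat \<Rightarrow> 'h)"
    and v: "\<And>i. v i \<in> L2_0 M"
    and gram: "\<And>l n m p. L2_inner M (v (l, n)) (v (m, p)) = cinner (\<Gamma> l m (some_basis p)) (some_basis n)"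
  shows "\<exists>\<Phi> :: 'l \<Rightarrow> 'a \<Rightarrow> 'h. stochastic_mapping M \<Phi> \<and> (\<forall>l m. \<Gamma> l m = gramian M (\<Phi> l) (\<Phi> m))"
proof -
  have "\<exists>f\<in>L2_0 M. \<forall>n. AE \<omega> in M. cinner (f \<omega>) (some_basis n :: 'h) = v (l, n) \<omega>" for l
  proof (rule basis_coefficients_exist[OF basis v])
    have "(L2_norm M (v (l, n)))\<^sup>2 = Re (cinner (\<Gamma> l l (some_basis n)) (some_basis n))" for n
      using Re_L2_inner_self[OF v, of "(l, n)"] by (simp add: gram)
    then show "summable (\<lambda>n. (L2_norm M (v (l, n)))\<^sup>2)"
      using summable_kernel_diagonal[OF tc pd basis, of l] by simp
  qed
  then obtain \<Phi> :: "'l \<Rightarrow> 'a \<Rightarrow> 'h" where \<Phi>: "\<And>l. \<Phi> l \<in> L2_0 M"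
    and coeff: "\<And>l n. AE \<omega> in M. cinner (\<Phi> l \<omega>) (some_basis n) = v (l, n) \<omega>" by metis
  have "\<Gamma> l m = gramian M (\<Phi> l) (\<Phi> m)" for l m
  proof (rule bounded_clinear_eqI[OF basis kernel_bounded_clinear[OF tc pd basis] bounded_clinear_gramian[OF \<Phi> \<Phi>]])
    fix p n
    have "cinner (gramian M (\<Phi> l) (\<Phi> m) (some_basis p)) (some_basis n) =
        L2_inner M (\<lambda>\<omega>. cinner (\<Phi> l \<omega>) (some_basis n)) (\<lambda>\<omega>. cinner (\<Phi> m \<omega>) (some_basis p))"
      by (rule cinner_gramian[OF \<Phi> \<Phi>])
    also have "\<dots> = L2_inner M (v (l, n)) (v (m, p))"
      by (rule L2_inner_cong_AE) (intro L2_0_measurable L2_0_cinner \<Phi> v coeff)+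
    finally show "cinner (\<Gamma> l m (some_basis p)) (some_basis n) = cinner (gramian M (\<Phi> l) (\<Phi> m) (some_basis p)) (some_basis n)"
      by (simp add: gram)
  qed
  then show ?thesis using \<Phi> unfolding stochastic_mapping_def by blast
qed

lemma kolmogorov_factorization_dense:
  fixes \<Gamma> :: "'l \<Rightarrow> 'l \<Rightarrow> 'h::separable_complex_hilbert \<Rightarrow> 'h"
  assumes tc: "trace_class_kernel \<Gamma>" and pd: "positive_definite_kernel \<Gamma>"
    and basis: "orthonormal_basis (some_basis :: nat \<Rightarrow> 'h)"
    and family: "L2_0_family M (D \<times> (UNIV :: nat set))"
    and dense: "\<And>l n \<epsilon>. 0 < \<epsilon> \<Longrightarrow> \<exists>d\<in>D. Re (cinner (\<Gamma> l l (some_basis n)) (some_basis n))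
      - 2 * Re (cinner (\<Gamma> d l (some_basis n)) (some_basis n)) + Re (cinner (\<Gamma> d d (some_basis n)) (some_basis n)) < \<epsilon>"
  shows "\<exists>\<Phi> :: 'l \<Rightarrow> 'a \<Rightarrow> 'h. stochastic_mapping M \<Phi> \<and> (\<forall>l m. \<Gamma> l m = gramian M (\<Phi> l) (\<Phi> m))"
proof -
  interpret L2: semi_hilbert "L2_0 M :: ('a \<Rightarrow> complex) set"
    "\<lambda>s f t g \<omega>. s *\<^sub>C f \<omega> + t *\<^sub>C g \<omega>" "L2_inner M"
    by (rule L2_0_semi_hilbert)
  define K where "K = (\<lambda>(i :: 'l \<times> nat) (j :: 'l \<times> nat).
      cinner (\<Gamma> (fst i) (fst j) (some_basis (snd j))) (some_basis (snd i)))"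
  have K: "pd_kernel K"
    unfolding K_def by (rule pd_kernel_of_operator_kernel[OF tc pd basis])
  obtain u :: "'l \<times> nat \<Rightarrow> 'a \<Rightarrow> complex" where u0: "\<forall>i\<in>D \<times> UNIV. u i \<in> L2_0 M"
    and orth0: "\<forall>i\<in>D \<times> UNIV. \<forall>j\<in>D \<times> UNIV. (\<integral>\<omega>. u i \<omega> * cnj (u j \<omega>) \<partial>M) = (if i = j then 1 else 0)"
    using family unfolding L2_0_family_def by (elim exE conjE)
  have u: "u i \<in> L2_0 M" if "i \<in> D \<times> UNIV" for i using u0 that by (rule bspec)
  have orth: "L2_inner M (u i) (u j) = (if i = j then 1 else 0)"
    if "i \<in> D \<times> UNIV" "j \<in> D \<times> UNIV" for i j
    unfolding L2_inner_def cinner_complex_def using orth0[rule_format, OF that] .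
  have "\<exists>v :: 'l \<times> nat \<Rightarrow> 'a \<Rightarrow> complex. (\<forall>i. v i \<in> L2_0 M) \<and> (\<forall>i j. L2_inner M (v i) (v j) = K i j)"
  proof (rule L2.gram_vectors_exist[where J = "D \<times> UNIV", OF K u orth])
    fix i :: "'l \<times> nat" and \<epsilon> :: real assume "0 < \<epsilon>"
    then obtain d where d: "d \<in> D" "Re (K i i) - 2 * Re (K (d, snd i) i) + Re (K (d, snd i) (d, snd i)) < \<epsilon>"
      using dense[of \<epsilon> "fst i" "snd i"] by (auto simp: K_def)
    then show "\<exists>j\<in>D \<times> UNIV. Re (K i i) - 2 * Re (K j i) + Re (K j j) < \<epsilon>" by blast
  qed
  then obtain v :: "'l \<times> nat \<Rightarrow> 'a \<Rightarrow> complex"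
    where v: "\<And>i. v i \<in> L2_0 M" "\<And>i j. L2_inner M (v i) (v j) = K i j" by blast
  show ?thesis
    by (rule factorization_of_gram_vectors[where v = v, OF tc pd basis v(1)]) (simp add: v(2) K_def)
qed

text \<open>$\|\Phi(l)-\Phi(l_0)\|^2$ is the trace of
  $(\Gamma(l,l)-\Gamma(l_0,l_0)) - (\Gamma(l,l_0)-\Gamma(l_0,l_0)) - (\Gamma(l_0,l)-\Gamma(l_0,l_0))$.\<close>

lemma continuous_mapping_of_kernel:
  fixes \<Gamma> :: "'l::topological_space \<Rightarrow> 'l \<Rightarrow> 'h::separable_complex_hilbert \<Rightarrow> 'h"
  assumes tc: "trace_class_kernel \<Gamma>" and pd: "positive_definite_kernel \<Gamma>" and cont: "continuous_kernel \<Gamma>"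
    and basis: "orthonormal_basis (some_basis :: nat \<Rightarrow> 'h)"
    and \<Phi>: "stochastic_mapping M \<Phi>" and fact: "\<And>l m. \<Gamma> l m = gramian M (\<Phi> l) (\<Phi> m)"
  shows "continuous_mapping M \<Phi>"
  unfolding continuous_mapping_def
proof (intro allI tendstoI)
  fix l0 and \<epsilon> :: real assume \<epsilon>: "0 < \<epsilon>"
  have mem: "\<Phi> l \<in> L2_0 M" for l using \<Phi> by (simp add: stochastic_mapping_def)
  let ?t = "\<lambda>a b. trace_norm (\<lambda>x. \<Gamma> a b x - \<Gamma> l0 l0 x)"
  have le: "(L2_dist M (\<Phi> l) (\<Phi> l0))\<^sup>2 \<le> ?t l l + ?t l l0 + ?t l0 l" for l
  proof (rule LIMSEQ_le_const2)
    note dm = L2_0_diff[OF mem[of l] mem[of l0]]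
    show "(\<lambda>N. \<Sum>n<N. Re (cinner (gramian M (\<lambda>\<omega>. \<Phi> l \<omega> - \<Phi> l0 \<omega>) (\<lambda>\<omega>. \<Phi> l \<omega> - \<Phi> l0 \<omega>) (some_basis n)) (some_basis n)))
        \<longlonglongrightarrow> (L2_dist M (\<Phi> l) (\<Phi> l0))\<^sup>2"
      using L2_norm_square_eq_trace_gramian[OF basis dm] by (simp add: sums_def)
    let ?f = "\<lambda>a b n. cmod (cinner (\<Gamma> a b (some_basis n) - \<Gamma> l0 l0 (some_basis n)) (some_basis n))"
    have "Re (cinner (gramian M (\<lambda>\<omega>. \<Phi> l \<omega> - \<Phi> l0 \<omega>) (\<lambda>\<omega>. \<Phi> l \<omega> - \<Phi> l0 \<omega>) h) h)
        \<le> cmod (cinner (\<Gamma> l l h - \<Gamma> l0 l0 h) h) + cmod (cinner (\<Gamma> l l0 h - \<Gamma> l0 l0 h) h) + cmod (cinner (\<Gamma> l0 l h - \<Gamma> l0 l0 h) h)"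
      for h
    proof -
      have "gramian M (\<lambda>\<omega>. \<Phi> l \<omega> - \<Phi> l0 \<omega>) (\<lambda>\<omega>. \<Phi> l \<omega> - \<Phi> l0 \<omega>) h =
          (\<Gamma> l l h - \<Gamma> l0 l0 h) - (\<Gamma> l l0 h - \<Gamma> l0 l0 h) - (\<Gamma> l0 l h - \<Gamma> l0 l0 h)"
        by (simp add: gramian_diff_left gramian_diff_right mem dm fact)
      then show ?thesis
        using complex_Re_le_cmod[of "cinner (\<Gamma> l l h - \<Gamma> l0 l0 h) h"]
          abs_Re_le_cmod[of "cinner (\<Gamma> l l0 h - \<Gamma> l0 l0 h) h"] abs_Re_le_cmod[of "cinner (\<Gamma> l0 l h - \<Gamma> l0 l0 h) h"]
        by (simp add: cinner_diff_left)
    qed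
    then have "(\<Sum>n<N. Re (cinner (gramian M (\<lambda>\<omega>. \<Phi> l \<omega> - \<Phi> l0 \<omega>) (\<lambda>\<omega>. \<Phi> l \<omega> - \<Phi> l0 \<omega>) (some_basis n)) (some_basis n)))
        \<le> (\<Sum>n<N. ?f l l n + ?f l l0 n + ?f l0 l n)" for N
      by (rule sum_mono)
    also have "(\<Sum>n<N. ?f l l n + ?f l l0 n + ?f l0 l n) \<le> ?t l l + ?t l l0 + ?t l0 l" for N
      unfolding sum.distrib by (intro add_mono kernel_difference_trace_norm[OF tc pd basis])
    finally show "\<exists>N. \<forall>n\<ge>N. (\<Sum>n<n. Re (cinner (gramian M (\<lambda>\<omega>. \<Phi> l \<omega> - \<Phi> l0 \<omega>) (\<lambda>\<omega>. \<Phi> l \<omega> - \<Phi> l0 \<omega>) (some_basis n)) (some_basis n)))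
        \<le> ?t l l + ?t l l0 + ?t l0 l"
      by blast
  qed
  obtain U where U: "open U" "l0 \<in> U" "\<forall>a\<in>U. \<forall>b\<in>U. ?t a b < \<epsilon>\<^sup>2 / 3"
    using continuous_kernel_near_diagonal[OF cont, of "\<epsilon>\<^sup>2 / 3" l0] \<epsilon> by auto
  have "L2_dist M (\<Phi> l) (\<Phi> l0) < \<epsilon>" if "l \<in> U" for l
  proof (rule power2_less_imp_less)
    have "?t l l < \<epsilon>\<^sup>2 / 3" "?t l l0 < \<epsilon>\<^sup>2 / 3" "?t l0 l < \<epsilon>\<^sup>2 / 3" using U that by blast+
    then show "(L2_dist M (\<Phi> l) (\<Phi> l0))\<^sup>2 < \<epsilon>\<^sup>2" using le[of l] by linarith
  qed (use \<epsilon> in simp)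
  then show "\<forall>\<^sub>F l in at l0. dist (L2_dist M (\<Phi> l) (\<Phi> l0)) 0 < \<epsilon>"
    unfolding eventually_at_topological using U by auto
qed

end

section \<open>The factorization theorem\<close>

theorem theorem3p3:
  fixes M :: "'w measure"
  assumes "prob_space M"
    and "\<nexists>B :: 'h::separable_complex_hilbert set. finite B \<and> complex_vector.span B = UNIV"
  shows
    \<comment> \<open>(i), for a set and for a topological space\<close>
    "(L2_0_family M (UNIV :: ('s \<times> nat) set) \<longrightarrow>
       (\<forall>\<Gamma> :: 's \<Rightarrow> 's \<Rightarrow> 'h \<Rightarrow> 'h.
         trace_class_kernel \<Gamma> \<and> positive_definite_kernel \<Gamma> \<longrightarrow>
         (\<exists>\<Phi> :: 's \<Rightarrow> 'w \<Rightarrow> 'h. stochastic_mapping M \<Phi> \<and>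
            (\<forall>l m. \<Gamma> l m = gramian M (\<Phi> l) (\<Phi> m)))))
     \<and>
     ((\<exists>D :: 't::topological_space set.
         closure D = UNIV \<and> L2_0_family M (D \<times> (UNIV :: nat set))) \<longrightarrow>
       (\<forall>\<Gamma> :: 't \<Rightarrow> 't \<Rightarrow> 'h \<Rightarrow> 'h.
         trace_class_kernel \<Gamma> \<and> positive_definite_kernel \<Gamma> \<and> continuous_kernel \<Gamma> \<longrightarrow>
         (\<exists>\<Phi> :: 't \<Rightarrow> 'w \<Rightarrow> 'h. stochastic_mapping M \<Phi> \<and> continuous_mapping M \<Phi> \<and>
            (\<forall>l m. \<Gamma> l m = gramian M (\<Phi> l) (\<Phi> m)))))
     \<comment> \<open>(ii), for a set and for a topological space\<close>
     \<and>
     (\<forall>(\<Phi>1 :: 's \<Rightarrow> 'w \<Rightarrow> 'h) \<Phi>2.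
         stochastic_mapping M \<Phi>1 \<and> stochastic_mapping M \<Phi>2 \<and>
         op_covariance M \<Phi>1 = op_covariance M \<Phi>2 \<longrightarrow>
         (\<exists>W. gramian_unitary M (modular_domain M \<Phi>2) (modular_domain M \<Phi>1) W \<and>
            (\<forall>l. AE \<omega> in M. \<Phi>1 l \<omega> = W (\<Phi>2 l) \<omega>)))
     \<and>
     (\<forall>(\<Phi>1 :: 't \<Rightarrow> 'w \<Rightarrow> 'h) \<Phi>2.
         stochastic_mapping M \<Phi>1 \<and> continuous_mapping M \<Phi>1 \<and>
         stochastic_mapping M \<Phi>2 \<and> continuous_mapping M \<Phi>2 \<and>
         op_covariance M \<Phi>1 = op_covariance M \<Phi>2 \<longrightarrow>
         (\<exists>W. gramian_unitary M (modular_domain M \<Phi>2) (modular_domain M \<Phi>1) W \<and>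
            (\<forall>l. AE \<omega> in M. \<Phi>1 l \<omega> = W (\<Phi>2 l) \<omega>)))"
proof -
  interpret prob_space M by fact
  have basis: "orthonormal_basis (some_basis :: nat \<Rightarrow> 'h)"
    unfolding some_basis_def using orthonormal_basis_exists[OF assms(2)] by (rule someI_ex)
  show ?thesis
  proof (intro conjI impI allI; (elim conjE exE)?)
    fix \<Gamma> :: "'s \<Rightarrow> 's \<Rightarrow> 'h \<Rightarrow> 'h"
    assume family: "L2_0_family M (UNIV :: ('s \<times> nat) set)"
      and \<Gamma>: "trace_class_kernel \<Gamma>" "positive_definite_kernel \<Gamma>"
    have "L2_0_family M ((UNIV :: 's set) \<times> (UNIV :: nat set))"
      using family by simp
    then show "\<exists>\<Phi> :: 's \<Rightarrow> 'w \<Rightarrow> 'h. stochastic_mapping M \<Phi> \<and> (\<forall>l m. \<Gamma> l m = gramian M (\<Phi> l) (\<Phi> m))"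
    proof (rule kolmogorov_factorization_dense[OF \<Gamma> basis])
      fix l n and \<epsilon> :: real assume "0 < \<epsilon>"
      then show "\<exists>d\<in>UNIV. Re (cinner (\<Gamma> l l (some_basis n)) (some_basis n))
          - 2 * Re (cinner (\<Gamma> d l (some_basis n)) (some_basis n))
          + Re (cinner (\<Gamma> d d (some_basis n)) (some_basis n)) < \<epsilon>"
        by (intro bexI[of _ l]) simp_all
    qed
  next
    fix D :: "'t set" and \<Gamma> :: "'t \<Rightarrow> 't \<Rightarrow> 'h \<Rightarrow> 'h"
    assume D: "closure D = UNIV" and family: "L2_0_family M (D \<times> (UNIV :: nat set))"
      and \<Gamma>: "trace_class_kernel \<Gamma>" "positive_definite_kernel \<Gamma>" and cont: "continuous_kernel \<Gamma>"
    obtain \<Phi> :: "'t \<Rightarrow> 'w \<Rightarrow> 'h" where \<Phi>: "stochastic_mapping M \<Phi>"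
      and fact: "\<And>l m. \<Gamma> l m = gramian M (\<Phi> l) (\<Phi> m)"
      using kolmogorov_factorization_dense[OF \<Gamma> basis family continuous_kernel_dense[OF \<Gamma> cont basis D]]
      by blast
    then have "continuous_mapping M \<Phi>"
      by (intro continuous_mapping_of_kernel[OF \<Gamma> cont basis])
    with \<Phi> fact show "\<exists>\<Phi> :: 't \<Rightarrow> 'w \<Rightarrow> 'h. stochastic_mapping M \<Phi> \<and> continuous_mapping M \<Phi> \<and>
        (\<forall>l m. \<Gamma> l m = gramian M (\<Phi> l) (\<Phi> m))"
      by blast
  next
    fix \<Phi>1 \<Phi>2 :: "'s \<Rightarrow> 'w \<Rightarrow> 'h"
    assume "stochastic_mapping M \<Phi>1" "stochastic_mapping M \<Phi>2" "op_covariance M \<Phi>1 = op_covariance M \<Phi>2"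
    then show "\<exists>W. gramian_unitary M (modular_domain M \<Phi>2) (modular_domain M \<Phi>1) W \<and>
        (\<forall>l. AE \<omega> in M. \<Phi>1 l \<omega> = W (\<Phi>2 l) \<omega>)"
      by (intro gramian_unitary_equivalence[OF _ _ _ basis]) simp_all
  next
    fix \<Phi>1 \<Phi>2 :: "'t \<Rightarrow> 'w \<Rightarrow> 'h"
    assume "stochastic_mapping M \<Phi>1" "stochastic_mapping M \<Phi>2" "op_covariance M \<Phi>1 = op_covariance M \<Phi>2"
    then show "\<exists>W. gramian_unitary M (modular_domain M \<Phi>2) (modular_domain M \<Phi>1) W \<and>
        (\<forall>l. AE \<omega> in M. \<Phi>1 l \<omega> = W (\<Phi>2 l) \<omega>)"
      by (intro gramian_unitary_equivalence[OF _ _ _ basis]) simp_all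
  qed
qed

end
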